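(* Let $q$ be a prime power, let $F$ be the field with $q^2$ elements, and let $V$ be an $n$-dimensional $F$-vector space with a nondegenerate Hermitian form. Using an orthonormal basis, identify linear transformations $T: V\to V$ with matrices in $M_n(q^2)$, so that $T^*$ is the conjugate transpose of $T$. Then: (1) for every invertible linear transformation $T: V \to V$, $T^*T$ is conjugate (in $\mathrm{GL}_n(q^2)$) to an element of $\mathrm{GL}_n(q)$; (2) any element of $\mathrm{GL}_n(q)$ is conjugate (in $\mathrm{GL}_n(q^2)$) to $T^*T$ for some $T \in \mathrm{GL}_n(q^2)$; (3) the map $T \mapsto T^*T$ induces bijections between the set of orbits of $\mathrm{GU}_n(q) \times \mathrm{GU}_n(q)$ on $\mathrm{GL}_n(q^2)$ and each of the following: the set of conjugacy classes of $\mathrm{GL}_n(q)$, and the set of $\mathrm{GU}_n(q)$-orbits on invertible Hermitian matrices in $M_n(q^2)$; (4) the number of orbits of $\mathrm{GU}_n(q) \times \mathrm{GU}_n(q)$ on $\mathrm{GL}_n(q^2)$ is $k(\mathrm{GL}_n(q))$.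
   Context: $M_n(q^2)$ denotes $n\times n$ matrices over $\mathbb{F}_{q^2}$, and $\mathrm{GL}_n(q)$ is the group of invertible $n \times n$ matrices over $\mathbb{F}_q$. For a matrix $A$ over $\mathbb{F}_{q^2}$, $A^*$ is the transpose of the matrix obtained by raising all entries to the $q$-th power; $A$ is Hermitian if $A = A^*$; $\mathrm{GU}_n(q) = \{X \in \mathrm{GL}_n(q^2) : XX^* = I\}$. The group $\mathrm{GU}_n(q) \times \mathrm{GU}_n(q)$ acts by $(X,Y): A \mapsto XAY^{*}$ (note $Y^* = Y^{-1}$), and $\mathrm{GU}_n(q)$ acts on Hermitian matrices by conjugation $H \mapsto YHY^{-1} = YHY^*$. For a finite group $G$, $k(G)$ is the number of conjugacy classes of $G$. *)

theory Defs
  imports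
    "Jordan_Normal_Form.Matrix"
    "HOL-Algebra.Group_Action"
    "HOL-Number_Theory.Prime_Powers"
    "HOL-Number_Theory.Residues"
    "HOL-Computational_Algebra.Polynomial"
begin

section \<open>The subfield of order q and matrix groups\<close>

text \<open>
  Throughout, the type \<open>'a\<close> is the field with \<open>q\<^sup>2\<close> elements. Its subfield with \<open>q\<close> elements is
  the fixed field of the Frobenius map; the lemmas \<open>Fq_subfield\<close> and \<open>card_Fq\<close> below confirm that
  it is a subfield of the right size.
\<close>

definition Fq :: "nat \<Rightarrow> 'a::field set" where
  "Fq q = {x. x ^ q = x}"

lemma frobenius_add:
  fixes x y :: "'a::finite_field"
  assumes q: "primepow q" and card: "card (UNIV :: 'a set) = q\<^sup>2"
  shows "(x + y) ^ q = x ^ q + y ^ q"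
proof -
  obtain p k where pk: "prime p" "k > 0" "q = p ^ k"
    using q by (auto simp: primepow_def)
  have "CHAR('a) dvd p ^ (k * 2)"
    using CHAR_dvd_CARD[where ?'a = 'a] card pk(3) by (simp add: power_mult)
  hence "CHAR('a) = p"
    using pk(1) CHAR_prime[where ?'a = 'a] prime_dvd_power primes_dvd_imp_eq by blast
  thus ?thesis
    using pk freshmans_dream'[of q k x y] by simp
qed

lemma frobenius_minus:
  fixes x :: "'a::finite_field"
  assumes "primepow q" and "card (UNIV :: 'a set) = q\<^sup>2"
  shows "(- x) ^ q = - (x ^ q)"
proof -
  have "q > 0" using assms(1) primepow_gt_Suc_0[of q] by simp
  thus ?thesis
    using frobenius_add[OF assms, of x "- x"] by (simp add: eq_neg_iff_add_eq_0 add.commute power_0_left)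
qed

lemma Fq_subfield:
  assumes "primepow q" and "card (UNIV :: 'a::finite_field set) = q\<^sup>2"
  shows "0 \<in> (Fq q :: 'a set)" "1 \<in> (Fq q :: 'a set)"
    and "x \<in> Fq q \<Longrightarrow> y \<in> Fq q \<Longrightarrow> x + y \<in> (Fq q :: 'a set)"
    and "x \<in> Fq q \<Longrightarrow> - x \<in> (Fq q :: 'a set)"
    and "x \<in> Fq q \<Longrightarrow> y \<in> Fq q \<Longrightarrow> x * y \<in> (Fq q :: 'a set)"
    and "x \<in> Fq q \<Longrightarrow> inverse x \<in> (Fq q :: 'a set)"
  using primepow_gt_Suc_0[OF assms(1)]
  by (auto simp: Fq_def frobenius_add[OF assms] frobenius_minus[OF assms]
      power_mult_distrib power_inverse power_0_left)

lemma card_Fq: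
  assumes q: "primepow q" and card: "card (UNIV :: 'a::finite_field set) = q\<^sup>2"
  shows "card (Fq q :: 'a set) = q"
proof -
  note add = frobenius_add[OF q card] and minus = frobenius_minus[OF q card]
  have q1: "q > 1" using primepow_gt_Suc_0[OF q] by simp
  let ?f = "\<lambda>x::'a. x ^ q - x"
  have roots: "card {x::'a. x ^ q = c * x} \<le> q" for c
  proof -
    let ?p = "monom 1 q - monom c 1 :: 'a poly"
    have deg: "degree ?p \<le> q"
      using q1 by (intro degree_diff_le) (auto intro: order.trans[OF degree_monom_le])
    have "coeff ?p q = 1" using q1 by simp
    hence "?p \<noteq> 0" by (metis coeff_0 zero_neq_one)
    from card_poly_roots_bound[OF this] deg show ?thesis by (simp add: poly_monom)
  qed
  have f_diff: "?f (x - y) = ?f x - ?f y" for x y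
    using add[of x "- y"] by (simp add: minus)
  have f_img: "range ?f \<subseteq> {x. x ^ q = (-1) * x}"
  proof safe
    fix x :: 'a
    have "x ^ (q * q) = x"
      using finite_field_power_card_eq_same[of x] card by (simp add: power2_eq_square)
    thus "(?f x) ^ q = (-1) * ?f x"
      using add[of "x ^ q" "- x"] by (simp add: minus flip: power_mult)
  qed
  have "q * q = card (\<Union>c\<in>range ?f. ?f -` {c})"
  proof -
    have "(\<Union>c\<in>range ?f. ?f -` {c}) = UNIV" by auto
    thus ?thesis using card by (simp only: power2_eq_square)
  qed
  also have "\<dots> \<le> (\<Sum>c\<in>range ?f. card (?f -` {c}))"
    by (rule card_UN_le) simp
  also have "\<dots> \<le> (\<Sum>c\<in>range ?f. card (Fq q :: 'a set))"
  proof (rule sum_mono)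
    fix c assume "c \<in> range ?f"
    then obtain a where a: "c = ?f a" by blast
    have "(\<lambda>x. x - a) ` (?f -` {c}) \<subseteq> Fq q"
    proof (rule image_subsetI)
      fix x assume "x \<in> ?f -` {c}"
      hence "?f x = ?f a" using a by blast
      hence "?f (x - a) = 0" using f_diff[of x a] by (simp only: diff_self)
      thus "x - a \<in> Fq q" by (simp only: Fq_def mem_Collect_eq right_minus_eq)
    qed
    moreover have "inj_on (\<lambda>x. x - a) (?f -` {c})" by (auto simp: inj_on_def)
    ultimately show "card (?f -` {c}) \<le> card (Fq q :: 'a set)"
      by (meson card_inj_on_le finite)
  qed
  also have "\<dots> = card (range ?f) * card (Fq q :: 'a set)" by simp
  also have "\<dots> \<le> q * card (Fq q :: 'a set)"
    by (rule mult_right_mono[OF order.trans[OF card_mono[OF finite f_img] roots[of "-1"]]]) (rule le0)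
  finally have "q \<le> card (Fq q :: 'a set)" using q1 by simp
  thus ?thesis using roots[of 1] by (simp add: Fq_def)
qed

text \<open>
  \<open>GL n K\<close> for a subfield \<open>K\<close> of \<open>'a\<close>: the matrices over \<open>K\<close> with an inverse over \<open>K\<close>.
  Thus \<open>GL n UNIV\<close> is \<open>GL\<^sub>n(q\<^sup>2)\<close> and \<open>GL n (Fq q)\<close> is \<open>GL\<^sub>n(q)\<close>.
\<close>

definition mats_over :: "nat \<Rightarrow> 'a set \<Rightarrow> 'a mat set" where
  "mats_over n K = {A \<in> carrier_mat n n. \<forall>i<n. \<forall>j<n. A $$ (i, j) \<in> K}"

definition GL :: "nat \<Rightarrow> 'a::field set \<Rightarrow> 'a mat monoid" where
  "GL n K = \<lparr> carrier = {A \<in> mats_over n K. \<exists>B \<in> mats_over n K. A * B = 1\<^sub>m n \<and> B * A = 1\<^sub>m n},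
              monoid.mult = (*), one = 1\<^sub>m n \<rparr>"

definition conj_trans :: "nat \<Rightarrow> 'a::field mat \<Rightarrow> 'a mat" where
  "conj_trans q A = transpose_mat (map_mat (\<lambda>x. x ^ q) A)"

definition GU :: "nat \<Rightarrow> nat \<Rightarrow> 'a::field mat monoid" where
  "GU n q = (GL n UNIV) \<lparr> carrier := {X \<in> carrier (GL n UNIV). X * conj_trans q X = 1\<^sub>m n} \<rparr>"

definition invertible_hermitian :: "nat \<Rightarrow> nat \<Rightarrow> 'a::field mat set" where
  "invertible_hermitian n q = {H \<in> carrier (GL n UNIV). H = conj_trans q H}"


section \<open>Conjugacy and the unitary actions\<close>

text \<open>
  The restricted abstractions below make the maps extensional, as the locale \<open>group_action\<close>
  of HOL-Algebra requires of its actions.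
\<close>

definition conjugate_in :: "('g, 'b) monoid_scheme \<Rightarrow> 'g \<Rightarrow> 'g \<Rightarrow> bool" where
  "conjugate_in G x y \<longleftrightarrow>
     x \<in> carrier G \<and> y \<in> carrier G \<and> (\<exists>g\<in>carrier G. y = g \<otimes>\<^bsub>G\<^esub> x \<otimes>\<^bsub>G\<^esub> inv\<^bsub>G\<^esub> g)"

definition conj_classes :: "('g, 'b) monoid_scheme \<Rightarrow> 'g set set" where
  "conj_classes G = orbits G (carrier G) (\<lambda>g. \<lambda>h\<in>carrier G. g \<otimes>\<^bsub>G\<^esub> h \<otimes>\<^bsub>G\<^esub> inv\<^bsub>G\<^esub> g)"

definition class_number :: "('g, 'b) monoid_scheme \<Rightarrow> nat" where
  "class_number G = card (conj_classes G)"

definition GUGU_orbits :: "nat \<Rightarrow> nat \<Rightarrow> 'a::field mat set set" where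
  "GUGU_orbits n q =
     orbits (GU n q \<times>\<times> GU n q) (carrier (GL n UNIV))
       (\<lambda>(X, Y). \<lambda>A\<in>carrier (GL n UNIV). X * A * conj_trans q Y)"

definition hermitian_orbits :: "nat \<Rightarrow> nat \<Rightarrow> 'a::field mat set set" where
  "hermitian_orbits n q =
     orbits (GU n q) (invertible_hermitian n q)
       (\<lambda>Y. \<lambda>H\<in>invertible_hermitian n q. Y * H * conj_trans q Y)"


section \<open>Hermitian spaces\<close>

text \<open>
  The space \<open>V\<close> is a subspace of an ambient type rather than a whole type, so that its dimension
  can be an arbitrary natural number variable: \<open>V\<close> is \<open>n\<close>-dimensional when it has an
  orthonormal basis \<open>e 0, \<dots>, e (n - 1)\<close>. The form is linear in the first argument and
  conjugate-linear in the second.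
\<close>

locale hermitian_space = vector_space scale
  for scale :: "'a::finite_field \<Rightarrow> 'v::ab_group_add \<Rightarrow> 'v" +
  fixes V :: "'v set" and q :: nat and h :: "'v \<Rightarrow> 'v \<Rightarrow> 'a"
  assumes subspace_V: "subspace V"
    and form_add: "\<lbrakk>x \<in> V; y \<in> V; z \<in> V\<rbrakk> \<Longrightarrow> h (x + y) z = h x z + h y z"
    and form_scale: "\<lbrakk>x \<in> V; y \<in> V\<rbrakk> \<Longrightarrow> h (scale c x) y = c * h x y"
    and form_conj: "\<lbrakk>x \<in> V; y \<in> V\<rbrakk> \<Longrightarrow> h y x = h x y ^ q"
    and nondegenerate: "\<lbrakk>x \<in> V; \<And>y. y \<in> V \<Longrightarrow> h x y = 0\<rbrakk> \<Longrightarrow> x = 0"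

definition orthonormal_basis ::
    "('a::field \<Rightarrow> 'v::ab_group_add \<Rightarrow> 'v) \<Rightarrow> 'v set \<Rightarrow> ('v \<Rightarrow> 'v \<Rightarrow> 'a) \<Rightarrow> nat \<Rightarrow> (nat \<Rightarrow> 'v) \<Rightarrow> bool" where
  "orthonormal_basis scale V h n e \<longleftrightarrow>
     inj_on e {..<n} \<and> \<not> Modules.module.dependent scale (e ` {..<n}) \<and>
     Modules.module.span scale (e ` {..<n}) = V \<and>
     (\<forall>i<n. \<forall>j<n. h (e i) (e j) = (if i = j then 1 else 0))"

definition linear_map_on ::
    "('a::field \<Rightarrow> 'v::ab_group_add \<Rightarrow> 'v) \<Rightarrow> 'v set \<Rightarrow> ('v \<Rightarrow> 'v) \<Rightarrow> bool" where
  "linear_map_on scale V T \<longleftrightarrow>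
     T \<in> V \<rightarrow> V \<and> (\<forall>x\<in>V. \<forall>y\<in>V. T (x + y) = T x + T y) \<and> (\<forall>c. \<forall>x\<in>V. T (scale c x) = scale c (T x))"

definition adjoint_on :: "'v set \<Rightarrow> ('v \<Rightarrow> 'v \<Rightarrow> 'a) \<Rightarrow> ('v \<Rightarrow> 'v) \<Rightarrow> 'v \<Rightarrow> 'v" where
  "adjoint_on V h T = (\<lambda>y\<in>V. THE z. z \<in> V \<and> (\<forall>x\<in>V. h (T x) y = h x z))"

definition mat_of_map ::
    "('a::field \<Rightarrow> 'v::ab_group_add \<Rightarrow> 'v) \<Rightarrow> nat \<Rightarrow> (nat \<Rightarrow> 'v) \<Rightarrow> ('v \<Rightarrow> 'v) \<Rightarrow> 'a mat" where
  "mat_of_map scale n e T =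
     mat n n (\<lambda>(i, j). Modules.module.representation scale (e ` {..<n}) (T (e j)) (e i))"

end

theory Submission
  imports Defs "HOL-Computational_Algebra.Polynomial_Factorial" "Jordan_Normal_Form.Char_Poly"
begin

text \<open>
  Every object in the statement is governed by a similarity class of matrices over the big field
  \<open>F\<close>, and the three sets of orbits are in bijection because they are three descriptions of the
  same set of classes (\<open>bij_betw_similarity_classes\<close>). Write \<open>gram T\<close> for \<open>T\<^sup>* T\<close>. Two matrices
  lie in one orbit of \<open>GU \<times> GU\<close> iff their Gram matrices are similar (\<open>GUGU_orbit_eq\<close>), Hermitian
  matrices are unitarily conjugate iff they are similar (\<open>hermitian_similar_imp_unitary\<close>), and
  matrices over the subfield that are similar over \<open>F\<close> are similar over the subfield
  (\<open>real_similar_descent\<close>). The classes that occur are the same in all three cases: each invertible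
  Hermitian matrix is a Gram matrix (\<open>hermitian_factorization\<close>) and is similar to a matrix over the
  subfield (\<open>hermitian_similar_to_real\<close>), and each invertible matrix over the subfield is similar to
  a Gram matrix (\<open>real_similar_to_hermitian\<close>).

  The first ingredient is a norm equation (\<open>poly_norm_equation\<close>): for an invertible matrix \<open>Q\<close> over
  \<open>F\<close> there is a polynomial \<open>f\<close> with \<open>f(Q) f'(Q) = Q\<close>, where \<open>f'\<close> arises from \<open>f\<close> by the Frobenius
  map on the coefficients. As some power of \<open>Q\<close> is \<open>1\<close>, this is a statement about polynomials modulo
  \<open>x\<^sup>N - 1\<close>: the class of \<open>x\<close> is a value of the norm form of \<open>F\<close> over the subfield
  (\<open>qnorm_surj_mod\<close>). It takes the place of Lang's theorem. For a Hermitian matrix \<open>H\<close> it reads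
  \<open>f(H) f(H)\<^sup>* = H\<close>. If \<open>g\<close> conjugates one Hermitian matrix to another, then \<open>g\<^sup>* g\<close> commutes with the
  first one, and a factorization \<open>g\<^sup>* g = c\<^sup>* c\<close> with \<open>c\<close> a polynomial in \<open>g\<^sup>* g\<close> makes \<open>g c\<^sup>-\<^sup>1\<close> a
  unitary matrix that does the same.

  The second ingredient is that over a finite field each matrix \<open>A\<close> satisfies \<open>A S = S A\<^sup>T\<close> with some
  invertible symmetric \<open>S\<close> (\<open>symmetric_intertwiner_transpose\<close>). If \<open>A\<close> has entries in the subfield,
  so can \<open>S\<close>, which is then Hermitian, hence \<open>S = X X\<^sup>*\<close>, and \<open>X\<^sup>-\<^sup>1 A X\<close> is Hermitian. If \<open>A\<close> is
  Hermitian, the transpose of \<open>A\<close> is its image under Frobenius, so \<open>S\<close> conjugates the latter to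
  \<open>A\<close>; the norm equation for \<open>S\<close> times its Frobenius image rescales \<open>S\<close> to a cocycle, and
  Hilbert's Theorem 90 (\<open>matrix_hilbert_90\<close>) conjugates \<open>A\<close> into the subfield.

  The symmetric matrix \<open>S\<close> and the descent of similarity both come from one induction that splits a
  cyclic block off a matrix (\<open>split_off_primary_block\<close>).
\<close>


section \<open>A norm form over polynomials modulo a polynomial\<close>

text \<open>
  The linear combination is a greatest common divisor, found by the Euclidean algorithm.
\<close>

lemma poly_bezout:
  fixes f g :: "'k::field poly"
  obtains a b where "a * f + b * g dvd f" "a * f + b * g dvd g"
proof -
  have "\<exists>a b. a * f + b * g dvd f \<and> a * f + b * g dvd g"
  proof (induction "euclidean_size g" arbitrary: f g rule: less_induct)
    case less
    show ?case
    proof (cases "g = 0")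
      case True
      thus ?thesis by (intro exI[of _ 1] exI[of _ 0]) auto
    next
      case False
      hence "euclidean_size (f mod g) < euclidean_size g"
        by (rule mod_size_less)
      from less[OF this] obtain a b where
        ab: "a * g + b * (f mod g) dvd g" "a * g + b * (f mod g) dvd f mod g" by blast
      have eq: "a * g + b * (f mod g) = b * f + (a - b * (f div g)) * g"
        by (simp add: minus_div_mult_eq_mod [symmetric] algebra_simps)
      have "a * g + b * (f mod g) dvd f"
        using ab by (metis dvd_add dvd_mult2 mod_mult_div_eq)
      with ab(1) show ?thesis unfolding eq by blast
    qed
  qed
  with that show thesis by blast
qed

lemma poly_coprime_bezout:
  fixes f g :: "'k::field poly"
  assumes "coprime f g"
  obtains a b where "a * f + b * g = 1"
proof -
  obtain a b where ab: "a * f + b * g dvd f" "a * f + b * g dvd g"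
    by (rule poly_bezout)
  hence "is_unit (a * f + b * g)" using assms coprime_common_divisor by blast
  then obtain u where "1 = (a * f + b * g) * u" by (rule dvdE)
  hence "(u * a) * f + (u * b) * g = 1" by (simp add: algebra_simps)
  thus thesis by (rule that)
qed

lemma poly_coprimeI_bezout:
  fixes f g :: "'k::field poly"
  assumes "a * f + b * g = 1"
  shows "coprime f g"
proof (rule coprimeI)
  fix c assume "c dvd f" "c dvd g"
  thus "is_unit c" using assms by (metis dvd_add dvd_mult)
qed

lemma poly_coprime_mult_dvd:
  fixes f g z :: "'k::field poly"
  assumes "coprime f g" "f dvd z" "g dvd z"
  shows "f * g dvd z"
proof -
  obtain a b where ab: "a * f + b * g = 1" using assms(1) by (rule poly_coprime_bezout)
  have "a * (f * z) + b * (g * z) = (a * f + b * g) * z" by (simp add: algebra_simps)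
  hence "z = a * (f * z) + b * (g * z)" by (simp add: ab)
  moreover have "f * g dvd f * z" "f * g dvd g * z"
    using assms by (auto simp: mult.commute[of f g] intro: mult_dvd_mono)
  ultimately show ?thesis by (metis dvd_add dvd_mult)
qed

lemma finite_poly_degree_less: "finite {p :: 'k::{finite,zero} poly. degree p < d}"
proof (rule finite_subset)
  show "{p :: 'k poly. degree p < d} \<subseteq> Poly ` {xs. length xs \<le> d}"
  proof
    fix p :: "'k poly" assume "p \<in> {p. degree p < d}"
    hence "length (coeffs p) \<le> d" by (cases "p = 0") (auto simp: length_coeffs_degree)
    thus "p \<in> Poly ` {xs. length xs \<le> d}"
      by (intro image_eqI[of _ _ "coeffs p"]) auto
  qed
  show "finite (Poly ` {xs :: 'k list. length xs \<le> d})"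
    using finite_lists_length_le[of "UNIV :: 'k set" d] by simp
qed

lemma quadratic_form_mult:
  fixes c u v :: "'r::comm_ring_1"
  shows "(u\<^sup>2 + u * v + c * v\<^sup>2) * (u'\<^sup>2 + u' * v' + c * v'\<^sup>2) =
    (u * u' - c * (v * v'))\<^sup>2 + (u * u' - c * (v * v')) * (u * v' + v * u' + v * v') +
      c * (u * v' + v * u' + v * v')\<^sup>2"
  by (simp add: algebra_simps power2_eq_square)

lemma quadratic_form_diff:
  fixes c u v :: "'r::comm_ring_1"
  shows "(u\<^sup>2 + u * v + c * v\<^sup>2) - (u'\<^sup>2 + u' * v' + c * v'\<^sup>2) =
     (u - u') * (u + u' + v) + (v - v') * (u' + c * (v + v'))"
  by (simp add: algebra_simps power2_eq_square)

lemma quadratic_form_complete_square: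
  fixes c h w v :: "'r::comm_ring_1"
  assumes h: "h + h = 1"
  shows "(w - h * v)\<^sup>2 + (w - h * v) * v + c * v\<^sup>2 = w\<^sup>2 + (c - h * h) * v\<^sup>2"
proof -
  have "(w - h * v)\<^sup>2 + (w - h * v) * v + c * v\<^sup>2 =
     w\<^sup>2 + (c - h * h) * v\<^sup>2 + (1 - (h + h)) * (w * v) - h * (1 - (h + h)) * v\<^sup>2"
    by (simp add: algebra_simps power2_eq_square)
  thus ?thesis using h by simp
qed

text \<open>
  One step of Newton's method for the norm form \<open>u\<^sup>2 + u v + c v\<^sup>2\<close>: multiplying a value \<open>Q\<close> that is
  \<open>x\<close> modulo \<open>n\<close> by the norm of \<open>(1, n s)\<close>, which is \<open>1 + n s\<close> modulo \<open>n\<^sup>2\<close>, gives a value that is \<open>x\<close>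
  modulo \<open>n\<^sup>2\<close>. Here \<open>y\<close> is an inverse of \<open>x\<close> modulo \<open>n\<close>.
\<close>

lemma quadratic_form_newton_step:
  fixes c Q :: "'r::comm_ring_1"
  assumes Q: "Q = x + n * e" and r: "1 - x * y = n * r" and s: "s = - e * y"
  shows "Q * (1\<^sup>2 + 1 * (n * s) + c * (n * s)\<^sup>2) - x =
    n\<^sup>2 * (e * r + e * s + c * s\<^sup>2 * (x + n * e))"
proof -
  have "Q * (1\<^sup>2 + 1 * (n * s) + c * (n * s)\<^sup>2) - x =
      n\<^sup>2 * (e * s + c * s\<^sup>2 * (x + n * e)) + n * e * (1 - x * y)"
    unfolding s Q by (simp add: algebra_simps power2_eq_square)
  thus ?thesis unfolding r by (simp add: algebra_simps power2_eq_square)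
qed

lemma smult_conv_mult: "smult c p = [:c:] * p"
  by simp

text \<open>
  If \<open>\<theta>\<close> has trace \<open>1\<close> and norm \<open>c\<close> over the coefficient field, this is the norm of \<open>u + \<theta> v\<close>. Taking
  the trace to be \<open>1\<close> makes odd and even characteristic uniform.
\<close>

definition qnorm :: "'k::comm_ring_1 \<Rightarrow> 'k poly \<Rightarrow> 'k poly \<Rightarrow> 'k poly" where
  "qnorm c u v = u\<^sup>2 + u * v + smult c (v\<^sup>2)"

lemma qnorm_mult:
  "qnorm c u v * qnorm c u' v' =
     qnorm c (u * u' - smult c (v * v')) (u * v' + v * u' + v * v')"
  unfolding qnorm_def smult_conv_mult by (rule quadratic_form_mult)

lemma qnorm_cong:
  fixes m :: "'k::field poly"
  assumes "m dvd u - u'" "m dvd v - v'"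
  shows "m dvd qnorm c u v - qnorm c u' v'"
proof -
  have "qnorm c u v - qnorm c u' v' =
     (u - u') * (u + u' + v) + (v - v') * (u' + [:c:] * (v + v'))"
    unfolding qnorm_def smult_conv_mult by (rule quadratic_form_diff)
  thus ?thesis using assms by (metis dvd_add dvd_mult2)
qed

text \<open>
  Modulo a prime the squaring map has fibres \<open>{r, -r}\<close>, and the fibre of \<open>0\<close> is a single point. This
  gives more squares than half of the residues, and all residues in characteristic two.
\<close>

lemma card_squares_mod_prime:
  fixes m :: "'k::finite_field poly"
  assumes m: "prime_elem m"
  defines "R \<equiv> {p :: 'k poly. degree p < degree m}"
  shows "card R < 2 * card ((\<lambda>p. p\<^sup>2 mod m) ` R)"
    and "(2 :: 'k) = 0 \<Longrightarrow> (\<lambda>p. p\<^sup>2 mod m) ` R = R"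
proof -
  have m0: "m \<noteq> 0" and deg: "degree m > 0"
    using m by (auto simp: prime_elem_def is_unit_iff_degree)
  let ?S = "(\<lambda>p. p\<^sup>2 mod m)"
  have fin: "finite R" unfolding R_def by (rule finite_poly_degree_less)
  have modR: "p mod m \<in> R" for p
    using degree_mod_less[OF m0, of p] deg by (auto simp: R_def)
  hence SR: "?S ` R \<subseteq> R" by blast
  have red: "p = r" if "p \<in> R" "r \<in> R" "m dvd p - r" for p r
  proof (rule ccontr)
    assume "p \<noteq> r"
    hence "degree m \<le> degree (p - r)" using that(3) by (intro dvd_imp_degree_le) auto
    moreover have "degree (p - r) < degree m"
      using that(1,2) by (auto simp: R_def intro: degree_diff_less)
    ultimately show False by simp
  qed
  have sq: "p = r \<or> m dvd p + r" if "p \<in> R" "r \<in> R" "?S p = ?S r" for p r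
  proof -
    have "m dvd p\<^sup>2 - r\<^sup>2" using that(3) by (simp add: mod_eq_dvd_iff)
    hence "m dvd (p - r) * (p + r)" by (simp add: power2_eq_square algebra_simps)
    thus ?thesis using m red that by (auto simp: prime_elem_dvd_mult_iff)
  qed
  show "(2 :: 'k) = 0 \<Longrightarrow> ?S ` R = R"
  proof -
    assume two: "(2 :: 'k) = 0"
    have "inj_on ?S R"
    proof (rule inj_onI)
      fix p r assume *: "p \<in> R" "r \<in> R" "?S p = ?S r"
      have "r + r = smult 2 r" by (metis one_add_one smult_add_left smult_1_left)
      hence "p + r = p - r" using two by (simp add: eq_diff_eq add.assoc)
      thus "p = r" using sq[OF *] red[OF *(1,2)] by metis
    qed
    thus ?thesis using SR fin by (simp add: endo_inj_surj)
  qed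
  have zero: "0 \<in> R" using deg by (simp add: R_def)
  have fib0: "{p \<in> R. ?S p = 0} \<subseteq> {0}"
    using red[OF _ zero] m by (auto simp: mod_eq_0_iff_dvd power2_eq_square prime_elem_dvd_mult_iff)
  have fib: "card {p \<in> R. ?S p = s} \<le> 2" for s
  proof (cases "\<exists>r\<in>R. ?S r = s")
    case True
    then obtain r where r: "r \<in> R" "?S r = s" by blast
    have "{p \<in> R. ?S p = s} \<subseteq> {r, - r}"
    proof
      fix p assume p: "p \<in> {p \<in> R. ?S p = s}"
      have "- r \<in> R" using r by (simp add: R_def)
      with sq[of p r] p r red[of p "- r"] show "p \<in> {r, - r}" by auto
    qed
    hence "card {p \<in> R. ?S p = s} \<le> card {r, - r}" by (intro card_mono) auto
    also have "\<dots> \<le> 2" by (simp add: card_insert_if)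
    finally show ?thesis .
  next
    case False
    hence "{p \<in> R. ?S p = s} = {}" by auto
    thus ?thesis by (simp only: card.empty)
  qed
  have "R = (\<Union>s\<in>?S ` R. {p \<in> R. ?S p = s})" by auto
  hence "card R \<le> (\<Sum>s\<in>?S ` R. card {p \<in> R. ?S p = s})"
    using card_UN_le[of "?S ` R" "\<lambda>s. {p \<in> R. ?S p = s}"] fin by simp
  also have "\<dots> = card {p \<in> R. ?S p = 0} + (\<Sum>s\<in>?S ` R - {0}. card {p \<in> R. ?S p = s})"
    using fin zero by (intro sum.remove) (auto intro!: image_eqI[of _ _ 0])
  also have "\<dots> \<le> card {0 :: 'k poly} + (\<Sum>s\<in>?S ` R - {0}. 2)"
    by (intro add_mono sum_mono fib card_mono fib0) auto
  also have "\<dots> = 1 + 2 * card (?S ` R - {0})" by simp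
  also have "\<dots> < 2 * card (?S ` R)"
  proof -
    have "0 \<in> ?S ` R" using zero by (intro image_eqI[of _ _ 0]) auto
    hence "Suc (card (?S ` R - {0})) = card (?S ` R)" using fin by (intro card_Suc_Diff1) auto
    thus ?thesis by simp
  qed
  finally show "card R < 2 * card (?S ` R)" .
qed

text \<open>
  Modulo a prime the norm form takes all values. In characteristic two squares suffice. In odd
  characteristic it becomes \<open>w\<^sup>2 + d v\<^sup>2\<close> after
  completing the square, where \<open>d\<close> is nonzero by the condition on \<open>c\<close>; the residues \<open>w\<^sup>2\<close> and the
  residues \<open>x - d v\<^sup>2\<close> each make up more than half of the field, so they meet.
\<close>

lemma qnorm_prime:
  fixes m x :: "'k::finite_field poly"
  assumes m: "prime_elem m" and c: "4 * c \<noteq> 1"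
  obtains u v where "m dvd qnorm c u v - x"
proof -
  define R where "R = {p :: 'k poly. degree p < degree m}"
  let ?S = "(\<lambda>p. p\<^sup>2 mod m)"
  have m0: "m \<noteq> 0" and deg: "degree m > 0"
    using m by (auto simp: prime_elem_def is_unit_iff_degree)
  have fin: "finite R" unfolding R_def by (rule finite_poly_degree_less)
  have modR: "p mod m \<in> R" for p
    using degree_mod_less[OF m0, of p] deg by (auto simp: R_def)
  note sq = card_squares_mod_prime[OF m, folded R_def]
  show thesis
  proof (cases "(2 :: 'k) = 0")
    case True
    have "x mod m \<in> ?S ` R" using sq(2)[OF True] modR by simp
    then obtain p where "x mod m = p\<^sup>2 mod m" by blast
    hence "m dvd qnorm c p 0 - x" by (simp add: qnorm_def mod_eq_dvd_iff[symmetric])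
    thus thesis by (rule that)
  next
    case False
    define d where "d = c - 1 / 4"
    have four: "(4 :: 'k) \<noteq> 0" using False by (metis mult_2 mult_eq_0_iff numeral_Bit0)
    have d: "d \<noteq> 0" using c four by (simp add: d_def field_simps)
    let ?T = "\<lambda>s. (x - smult d s) mod m"
    have injT: "inj_on ?T (?S ` R)"
    proof (rule inj_onI)
      fix s t assume st: "s \<in> ?S ` R" "t \<in> ?S ` R" "?T s = ?T t"
      have "m dvd (x - smult d s) - (x - smult d t)" using st(3) by (simp add: mod_eq_dvd_iff)
      also have "(x - smult d s) - (x - smult d t) = smult d (t - s)"
        by (simp add: smult_diff_right)
      finally have "m dvd t - s" using d by (simp add: dvd_smult_iff)
      hence "t mod m = s mod m" by (simp add: mod_eq_dvd_iff)
      thus "s = t" using st by auto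
    qed
    have "?S ` R \<inter> ?T ` ?S ` R \<noteq> {}"
    proof
      assume "?S ` R \<inter> ?T ` ?S ` R = {}"
      hence "card (?S ` R \<union> ?T ` ?S ` R) = card (?S ` R) + card (?S ` R)"
        using fin injT by (simp add: card_Un_disjoint card_image)
      moreover have "card (?S ` R \<union> ?T ` ?S ` R) \<le> card R"
        using modR by (intro card_mono fin) auto
      ultimately show False using sq(1) by simp
    qed
    then obtain w v where "w\<^sup>2 mod m = (x - smult d (v\<^sup>2 mod m)) mod m" by blast
    \<comment> \<open>The element of the second set came with \<open>v\<^sup>2\<close> reduced modulo \<open>m\<close>; undo the reduction.\<close>
    hence "m dvd w\<^sup>2 - (x - smult d (v\<^sup>2 mod m))" by (simp add: mod_eq_dvd_iff)
    moreover have "m dvd smult d (v\<^sup>2 - v\<^sup>2 mod m)" by (intro dvd_smult) simp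
    ultimately have "m dvd (w\<^sup>2 - (x - smult d (v\<^sup>2 mod m))) + smult d (v\<^sup>2 - v\<^sup>2 mod m)"
      by (rule dvd_add)
    also have "\<dots> = w\<^sup>2 + [:d:] * v\<^sup>2 - x"
      by (simp only: smult_conv_mult algebra_simps)
    also have "[:d:] = [:c:] - [:1/2:] * [:1/2:]" using False four by (simp add: d_def)
    also have "w\<^sup>2 + ([:c:] - [:1/2:] * [:1/2:]) * v\<^sup>2 = qnorm c (w - smult (1/2) v) v"
    proof -
      have "(1/2 :: 'k) + 1/2 = 2/2"
        by (simp only: add_divide_distrib[symmetric] one_add_one)
      also have "\<dots> = 1" by (rule divide_self[OF False])
      finally have "[:1/2 :: 'k:] + [:1/2:] = 1" by (simp add: one_pCons)
      from quadratic_form_complete_square[OF this, of w v "[:c:]"] show ?thesis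
        unfolding qnorm_def smult_conv_mult by (rule sym)
    qed
    finally show thesis by (rule that)
  qed
qed

text \<open>
  By induction on the degree. A factorization into coprime factors is handled by the Chinese remainder
  theorem. If \<open>m = g h\<close> and \<open>g\<close>, \<open>h\<close> share a factor \<open>d\<close>, then \<open>m\<close> divides the square of \<open>m / d\<close>, and
  a Newton step lifts a solution modulo \<open>m / d\<close>; this uses that \<open>x\<close> is invertible modulo \<open>m\<close>.
\<close>

lemma qnorm_surj_mod:
  fixes m :: "'k::finite_field poly"
  assumes c: "4 * c \<noteq> 1" and m: "poly m 0 \<noteq> 0"
  shows "\<exists>u v. m dvd qnorm c u v - [:0, 1:]"
  using m
proof (induction "degree m" arbitrary: m rule: less_induct)
  case less
  let ?x = "[:0, 1:] :: 'k poly"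
  have m0: "m \<noteq> 0" using less.prems by auto
  show ?case
  proof (cases "irreducible m \<or> is_unit m")
    case True
    thus ?thesis
    proof
      assume "irreducible m"
      hence "prime_elem m" by (rule field_poly_irreducible_imp_prime)
      thus ?thesis using qnorm_prime[OF _ c] by metis
    next
      assume "is_unit m"
      thus ?thesis by (meson dvd_trans one_dvd)
    qed
  next
    case False
    then obtain g h where gh: "m = g * h" "\<not> is_unit g" "\<not> is_unit h"
      using m0 by (auto simp: irreducible_def)
    have nz: "g \<noteq> 0" "h \<noteq> 0" using m0 gh by auto
    have p0: "poly g 0 \<noteq> 0" "poly h 0 \<noteq> 0" using less.prems gh by auto
    have dgh: "degree g > 0" "degree h > 0" using gh nz by (auto simp: is_unit_iff_degree)
    have degm: "degree m = degree g + degree h" using nz gh by (simp add: degree_mult_eq)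
    show ?thesis
    proof (cases "coprime g h")
      case True
      then obtain a b where ab: "a * g + b * h = 1" by (rule poly_coprime_bezout)
      obtain u1 v1 where 1: "g dvd qnorm c u1 v1 - ?x"
        using less.hyps[OF _ p0(1)] dgh degm by auto
      obtain u2 v2 where 2: "h dvd qnorm c u2 v2 - ?x"
        using less.hyps[OF _ p0(2)] dgh degm by auto
      define w where "w y z = y * (b * h) + z * (a * g)" for y z
      have "w y z - y = g * (a * (z - y)) \<and> w y z - z = h * (b * (y - z))" for y z
      proof -
        have "w y z - y = g * (a * (z - y)) + y * (a * g + b * h - 1)"
             "w y z - z = h * (b * (y - z)) + z * (a * g + b * h - 1)"
          unfolding w_def by (simp_all add: algebra_simps)
        thus ?thesis using ab by simp
      qed
      hence w: "g dvd w y z - y" "h dvd w y z - z" for y z by simp_all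
      let ?Q = "qnorm c (w u1 u2) (w v1 v2)"
      have "g dvd (?Q - qnorm c u1 v1) + (qnorm c u1 v1 - ?x)"
        by (intro dvd_add 1 qnorm_cong w)
      hence "g dvd ?Q - ?x" by (simp only: add_diff_eq diff_add_cancel)
      moreover have "h dvd (?Q - qnorm c u2 v2) + (qnorm c u2 v2 - ?x)"
        by (intro dvd_add 2 qnorm_cong w)
      hence "h dvd ?Q - ?x" by (simp only: add_diff_eq diff_add_cancel)
      ultimately have "m dvd ?Q - ?x"
        unfolding gh(1) by (rule poly_coprime_mult_dvd[OF True])
      thus ?thesis by blast
    next
      case False
      then obtain d where d: "d dvd g" "d dvd h" "\<not> is_unit d" by (auto simp: coprime_def)
      then obtain g' h' where g': "g = d * g'" and h': "h = d * h'" by (auto elim!: dvdE)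
      \<comment> \<open>This is \<open>m / d\<close>.\<close>
      define n where "n = d * g' * h'"
      have mn: "m = d * n" unfolding n_def gh g' h' by (simp add: algebra_simps)
      have "m dvd n\<^sup>2" unfolding n_def gh g' h' 
        by (intro dvdI[of _ _ "g' * h'"]) (simp add: power2_eq_square algebra_simps)
      have n0: "poly n 0 \<noteq> 0" using less.prems mn by auto
      have "degree n < degree m"
        using m0 d(3) unfolding mn by (auto simp: degree_mult_eq is_unit_iff_degree)
      from less.hyps[OF this n0] obtain u v where "n dvd qnorm c u v - ?x" by blast
      then obtain e where e: "qnorm c u v - ?x = n * e" by (rule dvdE)
      obtain y where y: "n dvd 1 - ?x * y"
      proof -
        obtain n1 t where n1: "n = pCons n1 t" by (cases n)
        have n1nz: "n1 \<noteq> 0" using n0 n1 by simp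
        have "1 - ?x * (- smult (inverse n1) t) = n * [:inverse n1:]"
          unfolding n1 using n1nz by (simp add: one_pCons)
        thus thesis using that by (metis dvd_triv_left)
      qed
      then obtain r where r: "1 - ?x * y = n * r" by (rule dvdE)
      define s where "s = - e * y"
      have "qnorm c u v * qnorm c 1 (n * s) - ?x = n\<^sup>2 * (e * r + e * s + smult c (s\<^sup>2) * (?x + n * e))"
        unfolding qnorm_def[of c 1] smult_conv_mult
        by (rule quadratic_form_newton_step[OF _ r s_def]) (use e in \<open>simp add: algebra_simps\<close>)
      hence "m dvd qnorm c u v * qnorm c 1 (n * s) - ?x"
        using \<open>m dvd n\<^sup>2\<close> by (metis dvd_mult2)
      thus ?thesis unfolding qnorm_mult by blast
    qed
  qed
qed

section \<open>Polynomials in a matrix and sizes of kernels\<close>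

lemma mat_det_nonzero_inverse:
  fixes A :: "'k::field mat"
  assumes A: "A \<in> carrier_mat n n" and "det A \<noteq> 0"
  obtains B where "B \<in> carrier_mat n n" "A * B = 1\<^sub>m n" "B * A = 1\<^sub>m n"
  using det_non_zero_imp_unit[OF assms, of "()"] that unfolding Units_def ring_mat_def by auto

lemma mat_right_inverse_det_nonzero:
  fixes A :: "'k::field mat"
  assumes "A \<in> carrier_mat n n" "B \<in> carrier_mat n n" "A * B = 1\<^sub>m n"
  shows "det A \<noteq> 0" "det B \<noteq> 0"
  using det_mult[OF assms(1,2)] assms(3) by auto

lemmas mat_assoc = assoc_mult_mat[of _ n n _ n _ n] for n

lemma mat_inverse_intertwine:
  fixes T :: "'k::field mat"
  assumes c: "T \<in> carrier_mat n n" "C \<in> carrier_mat n n" "A \<in> carrier_mat n n" "B \<in> carrier_mat n n"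
    and inv: "T * C = 1\<^sub>m n" "C * T = 1\<^sub>m n" and TA: "T * A = B * T"
  shows "C * B = A * C"
proof -
  have "C * (B * T) * C = C * B * (T * C)" using c by (simp add: mat_assoc[of _ n])
  hence "C * B = C * (B * T) * C" unfolding inv using c by simp
  also have "\<dots> = C * T * A * C"
    unfolding TA[symmetric] using c by (simp add: mat_assoc[of _ n])
  finally show ?thesis unfolding inv using c by simp
qed

text \<open>
  The Horner scheme for the value of a polynomial at a square matrix.
\<close>

definition poly_mat :: "'k::comm_ring_1 poly \<Rightarrow> 'k mat \<Rightarrow> 'k mat" where
  "poly_mat f A =
     fold_coeffs (\<lambda>a M. a \<cdot>\<^sub>m 1\<^sub>m (dim_row A) + A * M) f (0\<^sub>m (dim_row A) (dim_row A))"

lemma poly_mat_0 [simp]: "poly_mat 0 A = 0\<^sub>m (dim_row A) (dim_row A)"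
  by (simp add: poly_mat_def)

lemma dim_poly_mat [simp]:
  "dim_row (poly_mat f A) = dim_row A" "dim_col (poly_mat f A) = dim_row A"
proof (induction f)
  case (pCons a f)
  {
    case 1
    show ?case using pCons by (cases "f = 0") (auto simp: poly_mat_def)
  next
    case 2
    show ?case using pCons by (cases "f = 0") (auto simp: poly_mat_def)
  }
qed auto

lemma poly_mat_pCons:
  assumes "A \<in> carrier_mat n n"
  shows "poly_mat (pCons a f) A = a \<cdot>\<^sub>m 1\<^sub>m n + A * poly_mat f A"
proof (cases "a = 0 \<and> f = 0")
  case True
  thus ?thesis using assms by (auto intro!: eq_matI)
next
  case False
  thus ?thesis using assms by (cases "f = 0") (auto simp: poly_mat_def)
qed

lemma poly_mat_carrier [simp, intro]:
  assumes "A \<in> carrier_mat n n"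
  shows "poly_mat f A \<in> carrier_mat n n"
  using assms by (induction f) (auto simp: poly_mat_pCons[OF assms])

text \<open>
  This single fact yields that polynomials in commuting matrices commute, that they respect similarity,
  and that they restrict to invariant subspaces.
\<close>

lemma poly_mat_intertwine:
  assumes A: "A \<in> carrier_mat n n" and C: "C \<in> carrier_mat d d" and M: "M \<in> carrier_mat n d"
    and AM: "A * M = M * C"
  shows "poly_mat f A * M = M * poly_mat f C"
proof (induction f)
  case 0
  show ?case using A C M by auto
next
  case (pCons a f)
  note c = A C M poly_mat_carrier[OF A, of f] poly_mat_carrier[OF C, of f]
  have "poly_mat (pCons a f) A * M = (a \<cdot>\<^sub>m 1\<^sub>m n) * M + (A * poly_mat f A) * M"
    unfolding poly_mat_pCons[OF A] using c by (intro add_mult_distrib_mat[of _ n n]) auto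
  also have "(a \<cdot>\<^sub>m 1\<^sub>m n) * M = M * (a \<cdot>\<^sub>m 1\<^sub>m d)"
    using M by (simp add: mult_smult_distrib[OF M, of _ d] mult_smult_assoc_mat[of _ n n _ d])
  also have "(A * poly_mat f A) * M = A * (poly_mat f A * M)"
    using c by (simp add: assoc_mult_mat[of _ n n _ n _ d])
  also have "\<dots> = A * M * poly_mat f C"
    using c unfolding pCons.IH by (simp add: assoc_mult_mat[of _ n n _ d _ d])
  also have "\<dots> = M * (C * poly_mat f C)"
    using c unfolding AM by (simp add: assoc_mult_mat[of _ n d _ d _ d])
  also have "M * (a \<cdot>\<^sub>m 1\<^sub>m d) + M * (C * poly_mat f C) = M * poly_mat (pCons a f) C"
    unfolding poly_mat_pCons[OF C] using c by (intro mult_add_distrib_mat[symmetric, of _ n d]) auto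
  finally show ?case .
qed

lemma poly_mat_add:
  assumes A: "A \<in> carrier_mat n n"
  shows "poly_mat (f + g) A = poly_mat f A + poly_mat g A"
proof (induction f g rule: poly_induct2)
  case 0
  show ?case using A by auto
next
  case (pCons a f b g)
  have c: "poly_mat f A \<in> carrier_mat n n" "poly_mat g A \<in> carrier_mat n n"
    using A by auto
  have "A * poly_mat (f + g) A = A * poly_mat f A + A * poly_mat g A"
    unfolding pCons.IH using A c by (intro mult_add_distrib_mat) auto
  moreover have "(a + b) \<cdot>\<^sub>m 1\<^sub>m n = a \<cdot>\<^sub>m 1\<^sub>m n + b \<cdot>\<^sub>m (1\<^sub>m n :: 'a mat)"
    by (auto intro!: eq_matI)
  ultimately show ?case
    using A c by (auto simp: poly_mat_pCons[OF A] intro!: eq_matI simp del: index_mult_mat(1))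
qed

lemma poly_mat_smult:
  assumes A: "A \<in> carrier_mat n n"
  shows "poly_mat (smult c f) A = c \<cdot>\<^sub>m poly_mat f A"
proof (induction f)
  case 0
  show ?case using A by auto
next
  case (pCons a f)
  have "A * (c \<cdot>\<^sub>m poly_mat f A) = c \<cdot>\<^sub>m (A * poly_mat f A)"
    using A by (intro mult_smult_distrib) auto
  with pCons show ?case
    using A by (auto simp: poly_mat_pCons[OF A] algebra_simps intro!: eq_matI simp del: index_mult_mat(1))
qed

lemma poly_mat_1 [simp]:
  assumes A: "A \<in> carrier_mat n n"
  shows "poly_mat 1 A = 1\<^sub>m n"
  unfolding one_pCons poly_mat_pCons[OF A] using A by auto

lemma poly_mat_x [simp]:
  assumes A: "A \<in> carrier_mat n n"
  shows "poly_mat [:0, 1:] A = A"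
proof -
  have "poly_mat (pCons 0 1) A = 0 \<cdot>\<^sub>m 1\<^sub>m n + A"
    using A by (simp only: poly_mat_pCons[OF A] poly_mat_1[OF A] right_mult_one_mat[OF A])
  also have "\<dots> = A" using A by (auto intro!: eq_matI)
  finally show ?thesis by (simp add: one_pCons)
qed

lemma poly_mat_mult:
  assumes A: "A \<in> carrier_mat n n"
  shows "poly_mat (f * g) A = poly_mat f A * poly_mat g A"
proof (induction f)
  case 0
  show ?case using A by (simp add: poly_mat_carrier[OF A, THEN carrier_matD(1)] poly_mat_carrier[OF A, THEN carrier_matD(2)])
next
  case (pCons a f)
  note c = A poly_mat_carrier[OF A, of f] poly_mat_carrier[OF A, of g]
  have "poly_mat (pCons a f * g) A = a \<cdot>\<^sub>m poly_mat g A + (0 \<cdot>\<^sub>m 1\<^sub>m n + A * poly_mat (f * g) A)"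
    by (simp add: poly_mat_add[OF A] poly_mat_smult[OF A] poly_mat_pCons[OF A])
  also have "0 \<cdot>\<^sub>m 1\<^sub>m n + A * poly_mat (f * g) A = A * poly_mat f A * poly_mat g A"
    using c unfolding pCons.IH by (auto simp: mat_assoc[of _ n] intro!: eq_matI simp del: index_mult_mat(1))
  also have "a \<cdot>\<^sub>m poly_mat g A = (a \<cdot>\<^sub>m 1\<^sub>m n) * poly_mat g A"
    using c by (simp add: mult_smult_assoc_mat[of _ n n _ n])
  also have "(a \<cdot>\<^sub>m 1\<^sub>m n) * poly_mat g A + A * poly_mat f A * poly_mat g A = poly_mat (pCons a f) A * poly_mat g A"
    unfolding poly_mat_pCons[OF A] using c by (intro add_mult_distrib_mat[symmetric, of _ n n]) auto
  finally show ?case .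
qed

lemma poly_mat_commute:
  assumes A: "A \<in> carrier_mat n n"
  shows "poly_mat f A * A = A * poly_mat f A"
  by (rule poly_mat_intertwine[OF A A A refl])

lemma poly_mat_transpose:
  assumes A: "A \<in> carrier_mat n n"
  shows "transpose_mat (poly_mat f A) = poly_mat f (transpose_mat A)"
proof (induction f)
  case 0
  show ?case using A by auto
next
  case (pCons a f)
  have "transpose_mat (A * poly_mat f A) = transpose_mat (poly_mat f A * A)"
    by (simp add: poly_mat_commute[OF A])
  also have "\<dots> = transpose_mat A * poly_mat f (transpose_mat A)"
    using A pCons.IH by (simp add: transpose_mult[of _ n n])
  finally have "transpose_mat (A * poly_mat f A) = transpose_mat A * poly_mat f (transpose_mat A)" .
  moreover have "transpose_mat (a \<cdot>\<^sub>m 1\<^sub>m n + A * poly_mat f A) =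
     a \<cdot>\<^sub>m 1\<^sub>m n + transpose_mat (A * poly_mat f A)"
    using A by (auto intro!: eq_matI simp del: index_mult_mat(1))
  ultimately show ?case
    using A by (simp add: poly_mat_pCons[of _ n])
qed

lemma poly_mat_four_block:
  assumes A: "A \<in> carrier_mat n n" and B: "B \<in> carrier_mat k k"
  shows "poly_mat f (four_block_mat A (0\<^sub>m n k) (0\<^sub>m k n) B) =
    four_block_mat (poly_mat f A) (0\<^sub>m n k) (0\<^sub>m k n) (poly_mat f B)"
proof (induction f)
  case 0
  show ?case using A B by auto
next
  case (pCons a f)
  note c = A B poly_mat_carrier[OF A, of f] poly_mat_carrier[OF B, of f]
  have AB: "four_block_mat A (0\<^sub>m n k) (0\<^sub>m k n) B \<in> carrier_mat (n + k) (n + k)"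
    using A B by auto
  have "four_block_mat A (0\<^sub>m n k) (0\<^sub>m k n) B * four_block_mat (poly_mat f A) (0\<^sub>m n k) (0\<^sub>m k n) (poly_mat f B)
      = four_block_mat (A * poly_mat f A) (0\<^sub>m n k) (0\<^sub>m k n) (B * poly_mat f B)"
    by (subst mult_four_block_mat[of _ n n _ k _ k]) (use c in auto)
  with pCons.IH show ?case
    using c by (auto simp: poly_mat_pCons[OF A] poly_mat_pCons[OF B] poly_mat_pCons[OF AB]
        intro!: eq_matI simp del: index_mult_mat(1))
qed

lemma poly_mat_map:
  fixes \<phi> :: "'k::comm_ring_1 \<Rightarrow> 'l::comm_ring_1"
  assumes A: "A \<in> carrier_mat n n"
    and \<phi>: "\<phi> 0 = 0" "\<phi> 1 = 1" "\<And>x y. \<phi> (x + y) = \<phi> x + \<phi> y" "\<And>x y. \<phi> (x * y) = \<phi> x * \<phi> y"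
  shows "map_mat \<phi> (poly_mat f A) = poly_mat (map_poly \<phi> f) (map_mat \<phi> A)"
proof (induction f)
  case 0
  show ?case using A \<phi> by auto
next
  case (pCons a f)
  have A': "map_mat \<phi> A \<in> carrier_mat n n" using A by auto
  interpret semiring_hom \<phi> by unfold_locales (auto simp: \<phi>)
  have "map_mat \<phi> (A * poly_mat f A) = map_mat \<phi> A * map_mat \<phi> (poly_mat f A)"
    using A by (intro mat_hom_mult[of _ n n _ n]) auto
  hence "\<phi> ((A * poly_mat f A) $$ (i, j)) = (map_mat \<phi> A * poly_mat (map_poly \<phi> f) (map_mat \<phi> A)) $$ (i, j)"
    if "i < n" "j < n" for i j
    using that A pCons.IH index_map_mat(1)[of i "A * poly_mat f A" j \<phi>] by simp
  with pCons.IH show ?case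
    using A by (auto simp: poly_mat_pCons[OF A] poly_mat_pCons[OF A'] Polynomial.map_poly_pCons[of \<phi>, OF \<phi>(1)] \<phi>
        intro!: eq_matI simp del: index_mult_mat(1))
qed

lemma card_carrier_vec: "card (carrier_vec n :: 'k::finite vec set) = card (UNIV :: 'k set) ^ n"
proof -
  have "bij_betw vec_of_list {xs :: 'k list. length xs = n} (carrier_vec n)"
  proof (rule bij_betwI[of _ _ _ list_of_vec])
    show "vec_of_list \<in> {xs. length xs = n} \<rightarrow> carrier_vec n"
      by (intro funcsetI carrier_vecI) simp
    show "list_of_vec \<in> carrier_vec n \<rightarrow> {xs :: 'k list. length xs = n}" by auto
  qed (simp_all add: list_vec vec_list)
  thus ?thesis
    using card_lists_length_eq[of "UNIV :: 'k set" n] by (simp add: bij_betw_same_card[symmetric])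
qed

lemma finite_carrier_vec [simp]: "finite (carrier_vec n :: 'k::finite vec set)"
  by (rule card_ge_0_finite) (simp add: card_carrier_vec card_gt_0_iff)

lemma inj_mat_append_col:
  fixes M :: "'k::field mat"
  assumes M: "M \<in> carrier_mat n k" and s: "s \<in> carrier_vec n" "s \<notin> (\<lambda>v. M *\<^sub>v v) ` carrier_vec k"
    and inj: "\<And>v. v \<in> carrier_vec k \<Longrightarrow> M *\<^sub>v v = 0\<^sub>v n \<Longrightarrow> v = 0\<^sub>v k"
    and v: "v \<in> carrier_vec (Suc k)"
      "mat n (Suc k) (\<lambda>(i, j). if j < k then M $$ (i, j) else s $ i) *\<^sub>v v = 0\<^sub>v n"
  shows "v = 0\<^sub>v (Suc k)"
proof -
  define w where "w = vec k (\<lambda>i. v $ i)"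
  have w: "w \<in> carrier_vec k" by (simp add: w_def)
  have eq: "M *\<^sub>v w + v $ k \<cdot>\<^sub>v s = 0\<^sub>v n"
  proof (rule eq_vecI)
    fix i assume "i < dim_vec (0\<^sub>v n)"
    hence i: "i < n" by simp
    have "(\<Sum>j<Suc k. (if j < k then M $$ (i, j) else s $ i) * v $ j) = 0"
      using arg_cong[OF v(2), of "\<lambda>u. u $ i"] v(1) i
      by (auto simp: scalar_prod_def atLeast0LessThan cong: if_cong intro: sum.cong)
    thus "(M *\<^sub>v w + v $ k \<cdot>\<^sub>v s) $ i = 0\<^sub>v n $ i"
      using i M s(1) by (simp add: scalar_prod_def atLeast0LessThan w_def mult.commute)
  qed (use M s in auto)
  have vk: "v $ k = 0"
  proof (rule ccontr)
    assume nz: "v $ k \<noteq> 0"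
    have "s = M *\<^sub>v ((- inverse (v $ k)) \<cdot>\<^sub>v w)"
    proof (rule eq_vecI)
      fix i assume "i < dim_vec (M *\<^sub>v ((- inverse (v $ k)) \<cdot>\<^sub>v w))"
      hence i: "i < n" using M by simp
      have "(M *\<^sub>v w) $ i + v $ k * s $ i = 0"
        using arg_cong[OF eq, of "\<lambda>u. u $ i"] i M s(1) by simp
      hence "s $ i = - inverse (v $ k) * (M *\<^sub>v w) $ i"
        using nz by (simp add: field_simps eq_neg_iff_add_eq_0)
      also have "\<dots> = (M *\<^sub>v ((- inverse (v $ k)) \<cdot>\<^sub>v w)) $ i"
        using i by (simp add: mult_mat_vec[OF M w] M[THEN carrier_matD(1)] del: index_mult_mat_vec)
      finally show "s $ i = (M *\<^sub>v ((- inverse (v $ k)) \<cdot>\<^sub>v w)) $ i" .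
    qed (use M s in auto)
    moreover have "M *\<^sub>v ((- inverse (v $ k)) \<cdot>\<^sub>v w) \<in> (\<lambda>v. M *\<^sub>v v) ` carrier_vec k"
      using w by (intro imageI) simp
    ultimately show False using s(2) by metis
  qed
  have "M *\<^sub>v w = 0\<^sub>v n"
  proof -
    have "0 \<cdot>\<^sub>v s = 0\<^sub>v n" using s(1) by (auto intro!: eq_vecI)
    moreover have "M *\<^sub>v w \<in> carrier_vec n" using M by (intro carrier_vecI) simp
    ultimately show ?thesis using eq unfolding vk by (simp del: index_mult_mat_vec)
  qed
  from inj[OF w this] have "w = 0\<^sub>v k" .
  show ?thesis
  proof (rule eq_vecI)
    fix i assume "i < dim_vec (0\<^sub>v (Suc k))"
    moreover have "v $ i = w $ i" if "i < k" using that by (simp add: w_def)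
    ultimately show "v $ i = 0\<^sub>v (Suc k) $ i"
      using vk \<open>w = 0\<^sub>v k\<close> by (cases "i = k") auto
  qed (use v in auto)
qed

text \<open>
  Columns from \<open>S\<close> are appended one at a time; \<open>S\<close> need not be a subspace, it only must not lie in the
  range of any matrix with fewer than \<open>n\<close> columns. With all vectors as \<open>S\<close> this completes a basis; with
  the fixed vectors of a semilinear map as \<open>S\<close> it gives Hilbert's Theorem 90.
\<close>

lemma extend_injective_mat:
  fixes M :: "'k::field mat"
  assumes "M \<in> carrier_mat n k" "k \<le> n"
    and "\<And>v. v \<in> carrier_vec k \<Longrightarrow> M *\<^sub>v v = 0\<^sub>v n \<Longrightarrow> v = 0\<^sub>v k"
    and S: "S \<subseteq> carrier_vec n"
    and span: "\<And>j M. j < n \<Longrightarrow> M \<in> carrier_mat n j \<Longrightarrow> \<exists>s\<in>S. s \<notin> (\<lambda>v. M *\<^sub>v v) ` carrier_vec j"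
  obtains P where "P \<in> carrier_mat n n" "det P \<noteq> 0" "\<And>j. j < k \<Longrightarrow> col P j = col M j"
    "\<And>j. k \<le> j \<Longrightarrow> j < n \<Longrightarrow> col P j \<in> S"
proof -
  have "\<exists>P. P \<in> carrier_mat n n \<and> det P \<noteq> 0 \<and> (\<forall>j<k. col P j = col M j) \<and>
    (\<forall>j. k \<le> j \<longrightarrow> j < n \<longrightarrow> col P j \<in> S)"
    using assms(1-3)
  proof (induction "n - k" arbitrary: k M)
    case 0
    hence k: "k = n" by simp
    have M: "M \<in> carrier_mat n n" using "0.prems"(1) unfolding k .
    have "det M \<noteq> 0"
    proof
      assume "det M = 0"
      then obtain v where "v \<in> carrier_vec n" "v \<noteq> 0\<^sub>v n" "M *\<^sub>v v = 0\<^sub>v n"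
        using det_0_iff_vec_prod_zero_field[OF M] by blast
      thus False using "0.prems"(3) unfolding k by blast
    qed
    thus ?case using M unfolding k by (intro exI[of _ M] conjI) auto
  next
    case (Suc d)
    hence k: "k < n" by simp
    from span[OF this Suc.prems(1)] obtain s where
      s: "s \<in> S" "s \<notin> (\<lambda>v. M *\<^sub>v v) ` carrier_vec k" by blast
    with S have sc: "s \<in> carrier_vec n" by blast
    let ?M = "mat n (Suc k) (\<lambda>(i, j). if j < k then M $$ (i, j) else s $ i)"
    have "\<exists>P. P \<in> carrier_mat n n \<and> det P \<noteq> 0 \<and> (\<forall>j<Suc k. col P j = col ?M j) \<and>
      (\<forall>j. Suc k \<le> j \<longrightarrow> j < n \<longrightarrow> col P j \<in> S)"
    proof (rule Suc.hyps(1))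
      show "d = n - Suc k" using Suc.hyps(2) by simp
      show "v = 0\<^sub>v (Suc k)" if "v \<in> carrier_vec (Suc k)" "?M *\<^sub>v v = 0\<^sub>v n" for v
        using inj_mat_append_col[OF Suc.prems(1) sc s(2) Suc.prems(3) that] .
    qed (use k in auto)
    then obtain P where P: "P \<in> carrier_mat n n" "det P \<noteq> 0" "\<forall>j<Suc k. col P j = col ?M j"
      "\<forall>j. Suc k \<le> j \<longrightarrow> j < n \<longrightarrow> col P j \<in> S" by blast
    have "col ?M j = col M j" if "j < k" for j
      using that Suc.prems(1) by (intro eq_vecI) auto
    moreover have "col ?M k = s"
      using sc by (intro eq_vecI) auto
    ultimately show ?case
      using P s(1) by (intro exI[of _ P] conjI allI impI)
        (auto simp: less_Suc_eq Suc_le_eq, metis le_neq_implies_less)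
  qed
  with that show thesis by blast
qed

lemma mat_range_not_full:
  fixes M :: "'k::finite_field mat"
  assumes "j < n" "M \<in> carrier_mat n j"
  shows "\<exists>s\<in>carrier_vec n. s \<notin> (\<lambda>v. M *\<^sub>v v) ` carrier_vec j"
proof (rule ccontr)
  assume "\<not> ?thesis"
  hence "carrier_vec n \<subseteq> (\<lambda>v. M *\<^sub>v v) ` carrier_vec j" by blast
  hence "card (carrier_vec n :: 'k vec set) \<le> card (carrier_vec j :: 'k vec set)"
    by (meson card_image_le card_mono finite_carrier_vec finite_imageI le_trans)
  moreover have "card (UNIV :: 'k set) > 1"
    using card_mono[of "UNIV :: 'k set" "{0, 1}"] by simp
  ultimately show False using assms by (simp add: card_carrier_vec)
qed

text \<open>
  Over a finite field, the number of solutions replaces the rank: it is multiplicative for block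
  diagonal matrices and is squared under a quadratic field extension.
\<close>

definition kernel_card :: "'k::comm_ring_1 mat \<Rightarrow> nat" where
  "kernel_card A = card {v \<in> carrier_vec (dim_col A). A *\<^sub>v v = 0\<^sub>v (dim_row A)}"

lemma kernel_card_similar:
  assumes "similar_mat A B"
  shows "kernel_card (poly_mat f A) = kernel_card (poly_mat f B)"
proof -
  obtain P Q where wit: "similar_mat_wit A B P Q"
    using assms unfolding similar_mat_def by blast
  define n where "n = dim_row A"
  note w = similar_mat_witD[OF n_def wit]
  have AB: "A \<in> carrier_mat n n" "B \<in> carrier_mat n n" "P \<in> carrier_mat n n" "Q \<in> carrier_mat n n"
    and PQ: "P * Q = 1\<^sub>m n" "Q * P = 1\<^sub>m n" by (fact w)+
  have "A * P = P * B * (Q * P)" "Q * A = Q * P * (B * Q)"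
    unfolding w(3) using AB by (simp_all add: mat_assoc[of _ n])
  hence i: "A * P = P * B" "B * Q = Q * A"
    using AB by (simp_all add: PQ)
  note int = poly_mat_intertwine[OF AB(1,2,3) i(1), of f] poly_mat_intertwine[OF AB(2,1,4) i(2), of f]
  note c = AB poly_mat_carrier[OF AB(1), of f] poly_mat_carrier[OF AB(2), of f]
  have PQv: "P *\<^sub>v (Q *\<^sub>v v) = v" "Q *\<^sub>v (P *\<^sub>v v) = v" if "v \<in> carrier_vec n" for v
    using AB that PQ by (simp_all flip: assoc_mult_mat_vec[of _ n n _ n])
  have ker: "poly_mat f A *\<^sub>v (P *\<^sub>v v) = P *\<^sub>v (poly_mat f B *\<^sub>v v)"
    "poly_mat f B *\<^sub>v (Q *\<^sub>v v) = Q *\<^sub>v (poly_mat f A *\<^sub>v v)" if "v \<in> carrier_vec n" for v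
    using c that int by (simp_all flip: assoc_mult_mat_vec[of _ n n _ n])
  have "bij_betw (\<lambda>v. Q *\<^sub>v v) {v \<in> carrier_vec n. poly_mat f A *\<^sub>v v = 0\<^sub>v n}
     {v \<in> carrier_vec n. poly_mat f B *\<^sub>v v = 0\<^sub>v n}"
    by (rule bij_betwI[of _ _ _ "\<lambda>v. P *\<^sub>v v"]) (use c PQv ker in auto)
  thus ?thesis
    unfolding kernel_card_def using c by (simp add: bij_betw_same_card)
qed

lemma kernel_card_four_block:
  assumes A: "A \<in> carrier_mat n n" and B: "B \<in> carrier_mat k k"
  shows "kernel_card (four_block_mat A (0\<^sub>m n k) (0\<^sub>m k n) B) = kernel_card A * kernel_card B"
proof -
  let ?K = "\<lambda>n A. {v \<in> carrier_vec n. A *\<^sub>v v = 0\<^sub>v n}"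
  let ?F = "four_block_mat A (0\<^sub>m n k) (0\<^sub>m k n) B"
  have z: "0\<^sub>v (n + k) = 0\<^sub>v n @\<^sub>v 0\<^sub>v k" by (auto intro!: eq_vecI)
  have F: "?F *\<^sub>v (a @\<^sub>v b) = 0\<^sub>v (n + k) \<longleftrightarrow> A *\<^sub>v a = 0\<^sub>v n \<and> B *\<^sub>v b = 0\<^sub>v k"
    if "a \<in> carrier_vec n" "b \<in> carrier_vec k" for a b
    using that A B unfolding z mult_mat_vec_split[OF A B that] by (subst append_vec_eq[of _ n]) auto
  have "bij_betw (\<lambda>(a, b). a @\<^sub>v b) (?K n A \<times> ?K k B) (?K (n + k) ?F)"
  proof (rule bij_betw_imageI)
    show "inj_on (\<lambda>(a, b). a @\<^sub>v b) (?K n A \<times> ?K k B)"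
      by (auto simp: inj_on_def append_vec_eq[of _ n])
    show "(\<lambda>(a, b). a @\<^sub>v b) ` (?K n A \<times> ?K k B) = ?K (n + k) ?F"
    proof
      show "?K (n + k) ?F \<subseteq> (\<lambda>(a, b). a @\<^sub>v b) ` (?K n A \<times> ?K k B)"
      proof
        fix v assume v: "v \<in> ?K (n + k) ?F"
        have "v = vec_first v n @\<^sub>v vec_last v k" using v by (simp add: vec_first_last_append)
        moreover have "vec_first v n \<in> carrier_vec n" "vec_last v k \<in> carrier_vec k" by auto
        ultimately show "v \<in> (\<lambda>(a, b). a @\<^sub>v b) ` (?K n A \<times> ?K k B)"
          using v F[of "vec_first v n" "vec_last v k"] by force
      qed
    qed (auto simp: F)
  qed
  hence "card (?K (n + k) ?F) = card (?K n A) * card (?K k B)"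
    by (simp add: bij_betw_same_card[symmetric] card_cartesian_product)
  thus ?thesis unfolding kernel_card_def using A B by simp
qed

lemma kernel_card_pos:
  fixes A :: "'k::finite_field mat"
  assumes "A \<in> carrier_mat n n"
  shows "kernel_card A > 0"
proof -
  have "0\<^sub>v n \<in> {v \<in> carrier_vec n. A *\<^sub>v v = 0\<^sub>v n}" using assms by auto
  moreover have "finite {v \<in> carrier_vec n. A *\<^sub>v v = 0\<^sub>v n}"
    by (rule finite_subset[OF _ finite_carrier_vec]) auto
  ultimately have "card {v \<in> carrier_vec n. A *\<^sub>v v = 0\<^sub>v n} > 0"
    by (subst card_gt_0_iff) blast
  thus ?thesis unfolding kernel_card_def using assms by simp
qed

lemma kernel_card_full_iff:
  fixes A :: "'k::finite_field mat"
  assumes A: "A \<in> carrier_mat n n"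
  shows "kernel_card A = card (UNIV :: 'k set) ^ n \<longleftrightarrow> A = 0\<^sub>m n n"
proof
  assume "kernel_card A = card (UNIV :: 'k set) ^ n"
  hence "card {v \<in> carrier_vec n. A *\<^sub>v v = 0\<^sub>v n} = card (carrier_vec n :: 'k vec set)"
    using A by (simp add: kernel_card_def card_carrier_vec)
  hence eq: "{v \<in> carrier_vec n. A *\<^sub>v v = 0\<^sub>v n} = carrier_vec n"
    by (intro card_subset_eq) auto
  show "A = 0\<^sub>m n n"
  proof (rule eq_matI)
    fix i j assume ij: "i < dim_row (0\<^sub>m n n)" "j < dim_col (0\<^sub>m n n)"
    have "unit_vec n j \<in> {v \<in> carrier_vec n. A *\<^sub>v v = 0\<^sub>v n}" unfolding eq by simp
    hence "A *\<^sub>v unit_vec n j = 0\<^sub>v n" by simp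
    moreover have "(A *\<^sub>v unit_vec n j) $ i = A $$ (i, j)" using A ij by simp
    ultimately show "A $$ (i, j) = 0\<^sub>m n n $$ (i, j)" using ij by simp
  qed (use A in auto)
next
  assume "A = 0\<^sub>m n n"
  moreover have "{v :: 'k vec. v \<in> carrier_vec n \<and> 0\<^sub>m n n *\<^sub>v v = 0\<^sub>v n} = carrier_vec n"
    by auto
  ultimately show "kernel_card A = card (UNIV :: 'k set) ^ n"
    using card_carrier_vec[of n, where 'k='k] by (simp add: kernel_card_def)
qed

section \<open>Splitting off an invariant block\<close>

lemma poly_coprime_mult_left:
  fixes f g h :: "'k::field poly"
  assumes "coprime f h" "coprime g h"
  shows "coprime (f * g) h"
proof -
  obtain a b where 1: "a * f + b * h = 1" using assms(1) by (rule poly_coprime_bezout)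
  obtain c d where 2: "c * g + d * h = 1" using assms(2) by (rule poly_coprime_bezout)
  have "(a * c) * (f * g) + (a * f * d + b * (c * g + d * h)) * h = (a * f + b * h) * (c * g + d * h)"
    by (simp add: algebra_simps)
  also have "\<dots> = 1" by (simp add: 1 2)
  finally show ?thesis by (rule poly_coprimeI_bezout)
qed

lemma poly_coprime_power_left:
  fixes f h :: "'k::field poly"
  assumes "coprime f h"
  shows "coprime (f ^ k) h"
  by (induction k) (auto intro: poly_coprime_mult_left assms)

lemma poly_prime_coprime:
  fixes p f :: "'k::field poly"
  assumes p: "prime_elem p" and "\<not> p dvd f"
  shows "coprime f p"
proof (rule coprimeI)
  fix c assume c: "c dvd f" "c dvd p"
  from c(2) obtain e where e: "p = c * e" by (rule dvdE)
  hence "p dvd c \<or> p dvd e" using prime_elem_dvd_multD[OF p, of c e] by simp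
  moreover have "\<not> p dvd c" using c(1) assms(2) dvd_trans by blast
  ultimately have "p dvd e" by blast
  then obtain e' where "e = p * e'" by (rule dvdE)
  hence "p * (c * e') = p * 1" using e by (simp add: ac_simps)
  hence "c * e' = 1" using p by (subst (asm) mult_left_cancel) (auto simp: prime_elem_def)
  thus "is_unit c" by (metis dvd_triv_left)
qed

text \<open>
  A greatest common divisor of \<open>f\<close> and the power \<open>p\<^sup>k\<^sup>+\<^sup>1\<close>, unless it is the whole power, divides
  \<open>p\<^sup>k\<close>.
\<close>

lemma prime_elem_power_combination:
  fixes p f :: "'k::field poly"
  assumes p: "prime_elem p" and "\<not> p ^ Suc k dvd f"
  shows "\<exists>w b. p ^ k = w * f + b * p ^ Suc k"
  using assms(2)
proof (induction k)
  case 0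
  hence "coprime f p" using poly_prime_coprime[OF p] by simp
  then obtain a b where "a * f + b * p = 1" by (rule poly_coprime_bezout)
  thus ?case by (intro exI[of _ a] exI[of _ b]) simp
next
  case (Suc k)
  show ?case
  proof (cases "p ^ Suc k dvd f")
    case False
    from Suc.IH[OF this] obtain w b where "p ^ k = w * f + b * p ^ Suc k" by blast
    hence "p ^ Suc k = p * (w * f + b * p ^ Suc k)" by simp
    also have "\<dots> = (p * w) * f + b * p ^ Suc (Suc k)" by (simp add: algebra_simps)
    finally show ?thesis by blast
  next
    case True
    then obtain f' where f': "f = p ^ Suc k * f'" by (rule dvdE)
    have "\<not> p dvd f'"
    proof
      assume "p dvd f'"
      hence "p ^ Suc k * p dvd f" unfolding f' by (rule mult_dvd_mono[OF dvd_refl])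
      thus False using Suc.prems by (simp add: mult.commute)
    qed
    hence "coprime f' p" by (rule poly_prime_coprime[OF p])
    then obtain a b where ab: "a * f' + b * p = 1" by (rule poly_coprime_bezout)
    have "a * f + b * p ^ Suc (Suc k) = p ^ Suc k * (a * f' + b * p)"
      unfolding f' power_Suc[of p "Suc k"] by (simp only: distrib_left mult_ac)
    also have "\<dots> = p ^ Suc k" by (simp only: ab mult_1_right)
    finally show ?thesis by (intro exI[of _ a] exI[of _ b]) (rule sym)
  qed
qed

lemma poly_prime_divisor_exists:
  fixes f :: "'k::field poly"
  assumes "f \<noteq> 0" "\<not> is_unit f"
  shows "\<exists>p. prime_elem p \<and> p dvd f"
  using assms
proof (induction "degree f" arbitrary: f rule: less_induct)
  case less
  show ?case
  proof (cases "irreducible f")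
    case True
    thus ?thesis by (intro exI[of _ f] conjI dvd_refl field_poly_irreducible_imp_prime)
  next
    case False
    then obtain g h where gh: "f = g * h" "\<not> is_unit g" "\<not> is_unit h"
      using less.prems by (auto simp: irreducible_def)
    have nz: "g \<noteq> 0" "h \<noteq> 0" using less.prems gh by auto
    hence "degree g < degree f" using gh by (auto simp: degree_mult_eq is_unit_iff_degree)
    from less.hyps[OF this nz(1) gh(2)] show ?thesis unfolding gh(1) by (meson dvd_mult2)
  qed
qed

lemma poly_prime_power_decompose:
  fixes f :: "'k::field poly"
  assumes p: "prime_elem p" and "f \<noteq> 0"
  shows "\<exists>k h. f = p ^ k * h \<and> \<not> p dvd h"
  using assms(2)
proof (induction "degree f" arbitrary: f rule: less_induct)
  case less
  show ?case
  proof (cases "p dvd f")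
    case False
    thus ?thesis by (intro exI[of _ 0] exI[of _ f]) simp
  next
    case True
    then obtain g where g: "f = p * g" by (rule dvdE)
    have nz: "g \<noteq> 0" "p \<noteq> 0" using less.prems g by auto
    hence "degree g < degree f"
      using p unfolding g by (auto simp: degree_mult_eq prime_elem_def is_unit_iff_degree)
    from less.hyps[OF this nz(1)] obtain k h where "g = p ^ k * h" "\<not> p dvd h" by blast
    thus ?thesis unfolding g by (intro exI[of _ "Suc k"] exI[of _ h]) simp
  qed
qed

lemma poly_functional_expand:
  fixes L :: "'k::comm_ring_1 poly \<Rightarrow> 'k"
  assumes add: "\<And>f g. L (f + g) = L f + L g" and smult: "\<And>c f. L (smult c f) = c * L f"
    and deg: "degree f < d"
  shows "L f = (\<Sum>j<d. coeff f j * L (monom 1 j))"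
proof -
  have L0: "L 0 = 0" using smult[of 0 0] by simp
  have sum: "L (\<Sum>j\<in>J. g j) = (\<Sum>j\<in>J. L (g j))" if "finite J" for J :: "nat set" and g
    using that by (induction J rule: finite_induct) (auto simp: L0 add)
  have "{..d - 1} = {..<d}" using deg by auto
  hence "f = (\<Sum>j<d. monom (coeff f j) j)"
    using poly_as_sum_of_monoms'[of f "d - 1"] deg by simp
  hence "L f = (\<Sum>j<d. L (monom (coeff f j) j))" by (metis sum finite_lessThan)
  also have "\<dots> = (\<Sum>j<d. coeff f j * L (monom 1 j))"
    by (intro sum.cong refl) (metis mult.right_neutral smult smult_monom)
  finally show ?thesis .
qed

text \<open>
  The matrix of multiplication by \<open>x\<close> on polynomials modulo \<open>m\<close>: the companion matrix of \<open>m\<close>, also when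
  \<open>m\<close> is not monic.
\<close>

definition mult_x_mat :: "'k::field poly \<Rightarrow> 'k mat" where
  "mult_x_mat m = mat (degree m) (degree m) (\<lambda>(i, j). coeff (monom 1 (Suc j) mod m) i)"

lemma mult_x_mat_carrier [simp]: "mult_x_mat m \<in> carrier_mat (degree m) (degree m)"
  by (simp add: mult_x_mat_def)

definition krylov_mat :: "'k::comm_ring_1 mat \<Rightarrow> 'k vec \<Rightarrow> nat \<Rightarrow> 'k mat" where
  "krylov_mat A v d = mat (dim_row A) d (\<lambda>(i, j). (poly_mat (monom 1 j) A *\<^sub>v v) $ i)"

lemma krylov_mat_carrier [simp]: "A \<in> carrier_mat n n \<Longrightarrow> krylov_mat A v d \<in> carrier_mat n d"
  by (simp add: krylov_mat_def)

lemma poly_mat_mult_vec: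
  assumes "A \<in> carrier_mat n n" "v \<in> carrier_vec n"
  shows "poly_mat (f * g) A *\<^sub>v v = poly_mat f A *\<^sub>v (poly_mat g A *\<^sub>v v)"
    and "poly_mat (f + g) A *\<^sub>v v = poly_mat f A *\<^sub>v v + poly_mat g A *\<^sub>v v"
    and "poly_mat (smult c f) A *\<^sub>v v = c \<cdot>\<^sub>v (poly_mat f A *\<^sub>v v)"
proof -
  note c = poly_mat_carrier[OF assms(1)]
  show "poly_mat (f * g) A *\<^sub>v v = poly_mat f A *\<^sub>v (poly_mat g A *\<^sub>v v)"
    using assms c by (simp add: poly_mat_mult[of _ n] assoc_mult_mat_vec[of _ n n _ n])
  show "poly_mat (f + g) A *\<^sub>v v = poly_mat f A *\<^sub>v v + poly_mat g A *\<^sub>v v"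
    using assms c by (simp add: poly_mat_add[of _ n] add_mult_distrib_mat_vec[of _ n n])
  show "poly_mat (smult c f) A *\<^sub>v v = c \<cdot>\<^sub>v (poly_mat f A *\<^sub>v v)"
    using assms c[of f] by (auto simp: poly_mat_smult[OF assms(1)] intro!: eq_vecI)
qed

lemma poly_mat_vec_carrier [simp]:
  assumes "A \<in> carrier_mat n n"
  shows "poly_mat f A *\<^sub>v v \<in> carrier_vec n"
  using assms by (intro carrier_vecI) simp

lemma poly_mat_vec_mod:
  fixes m f :: "'k::field poly"
  assumes A: "A \<in> carrier_mat n n" and v: "v \<in> carrier_vec n" and m: "poly_mat m A *\<^sub>v v = 0\<^sub>v n"
  shows "poly_mat (f mod m) A *\<^sub>v v = poly_mat f A *\<^sub>v v"
proof -
  have "poly_mat f A *\<^sub>v v = poly_mat ((f div m) * m + f mod m) A *\<^sub>v v" by simp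
  also have "\<dots> = poly_mat (f div m) A *\<^sub>v 0\<^sub>v n + poly_mat (f mod m) A *\<^sub>v v"
    by (simp only: poly_mat_mult_vec[OF A v] m)
  also have "poly_mat (f div m) A *\<^sub>v 0\<^sub>v n = 0\<^sub>v n"
    using A by (intro eq_vecI) (auto simp: scalar_prod_def)
  finally show ?thesis using A by (simp add: left_zero_vec[of _ n])
qed

lemma krylov_mat_mult_vec:
  assumes A: "A \<in> carrier_mat n n" and v: "v \<in> carrier_vec n" and f: "degree f < d"
  shows "krylov_mat A v d *\<^sub>v vec d (coeff f) = poly_mat f A *\<^sub>v v"
proof (rule eq_vecI)
  fix i assume "i < dim_vec (poly_mat f A *\<^sub>v v)"
  hence i: "i < n" using A by simp
  define L where "L = (\<lambda>f. (poly_mat f A *\<^sub>v v) $ i)"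
  have "L f = (\<Sum>j<d. coeff f j * L (monom 1 j))"
    unfolding L_def using i A v
    by (intro poly_functional_expand[OF _ _ f]) (simp_all add: poly_mat_mult_vec[of _ n] del: index_mult_mat_vec)
  thus "(krylov_mat A v d *\<^sub>v vec d (coeff f)) $ i = (poly_mat f A *\<^sub>v v) $ i"
    using i A by (simp add: krylov_mat_def scalar_prod_def atLeast0LessThan L_def mult.commute)
qed (use A in \<open>simp add: krylov_mat_def\<close>)

text \<open>
  The map \<open>f \<mapsto> f(A) v\<close> factors through polynomials modulo \<open>m\<close> and turns multiplication by \<open>x\<close> into
  \<open>A\<close>.
\<close>

lemma krylov_mat_intertwine:
  assumes A: "A \<in> carrier_mat n n" and v: "v \<in> carrier_vec n"
    and m: "poly_mat m A *\<^sub>v v = 0\<^sub>v n" and d: "degree m > 0"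
  shows "A * krylov_mat A v (degree m) = krylov_mat A v (degree m) * mult_x_mat m"
proof (rule mat_col_eqI)
  let ?d = "degree m"
  fix j assume "j < dim_col (krylov_mat A v ?d * mult_x_mat m)"
  hence j: "j < ?d" by (simp add: mult_x_mat_def)
  have "col (krylov_mat A v ?d) j = poly_mat (monom 1 j) A *\<^sub>v v"
    using A j by (intro eq_vecI) (simp_all add: krylov_mat_def)
  hence "col (A * krylov_mat A v ?d) j = A *\<^sub>v (poly_mat (monom 1 j) A *\<^sub>v v)"
    using A j by (subst col_mult2[of _ n n _ ?d]) auto
  also have "\<dots> = poly_mat ([:0, 1:] * monom 1 j) A *\<^sub>v v"
    by (simp only: poly_mat_mult_vec[OF A v] poly_mat_x[OF A])
  also have "[:0, 1:] * monom 1 j = (monom 1 (Suc j) :: 'a poly)"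
    by (simp add: monom_Suc)
  also have "poly_mat (monom 1 (Suc j)) A *\<^sub>v v = poly_mat (monom 1 (Suc j) mod m) A *\<^sub>v v"
    by (rule poly_mat_vec_mod[OF A v m, symmetric])
  also have "\<dots> = krylov_mat A v ?d *\<^sub>v vec ?d (coeff (monom 1 (Suc j) mod m))"
  proof (rule krylov_mat_mult_vec[OF A v, symmetric])
    show "degree (monom 1 (Suc j) mod m) < ?d"
      using degree_mod_less[of m "monom 1 (Suc j)"] d by fastforce
  qed
  also have "vec ?d (coeff (monom 1 (Suc j) mod m)) = col (mult_x_mat m) j"
    using j by (intro eq_vecI) (simp_all add: mult_x_mat_def)
  also have "krylov_mat A v ?d *\<^sub>v col (mult_x_mat m) j = col (krylov_mat A v ?d * mult_x_mat m) j"
    using A j by (intro col_mult2[of _ n ?d _ ?d, symmetric]) auto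
  finally show "col (A * krylov_mat A v ?d) j = col (krylov_mat A v ?d * mult_x_mat m) j" .
qed (use A in \<open>simp_all add: krylov_mat_def mult_x_mat_def\<close>)

text \<open>
  The range of \<open>X\<close> and the kernel of \<open>W\<close> are complementary and invariant under \<open>A\<close>. The proof completes
  \<open>X\<close> to an invertible matrix \<open>M\<close> and corrects the new columns so that they lie in the kernel of \<open>W\<close>.
\<close>

lemma split_off_block:
  fixes A :: "'k::finite_field mat"
  assumes A: "A \<in> carrier_mat n n" and X: "X \<in> carrier_mat n d" and W: "W \<in> carrier_mat d n"
    and C: "C \<in> carrier_mat d d"
    and AX: "A * X = X * C" and WA: "W * A = C * W" and WX: "W * X = 1\<^sub>m d"
  obtains A' where "d \<le> n" "A' \<in> carrier_mat (n - d) (n - d)"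
    "similar_mat A (four_block_mat C (0\<^sub>m d (n - d)) (0\<^sub>m (n - d) d) A')"
proof -
  have inj: "v = 0\<^sub>v d" if "v \<in> carrier_vec d" "X *\<^sub>v v = 0\<^sub>v n" for v
  proof -
    have "v = W *\<^sub>v (X *\<^sub>v v)" using assoc_mult_mat_vec[OF W X that(1)] that(1) by (simp add: WX)
    also have "\<dots> = 0\<^sub>v d" unfolding that(2) using W by (intro eq_vecI) (auto simp: scalar_prod_def)
    finally show ?thesis .
  qed
  have q1: "card (UNIV :: 'k set) > 1"
    using card_mono[of "UNIV :: 'k set" "{0, 1}"] by simp
  have dn: "d \<le> n"
  proof -
    have "inj_on (\<lambda>v. X *\<^sub>v v) (carrier_vec d)"
    proof (rule inj_on_inverseI[of _ "\<lambda>v. W *\<^sub>v v"])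
      fix v :: "'k vec" assume "v \<in> carrier_vec d"
      thus "W *\<^sub>v (X *\<^sub>v v) = v" using assoc_mult_mat_vec[OF W X, of v] by (simp add: WX)
    qed
    moreover have "(\<lambda>v. X *\<^sub>v v) ` carrier_vec d \<subseteq> carrier_vec n" using X by (auto intro!: carrier_vecI)
    ultimately have "card (carrier_vec d :: 'k vec set) \<le> card (carrier_vec n :: 'k vec set)"
      by (intro card_inj_on_le) auto
    thus ?thesis using q1 by (simp add: card_carrier_vec)
  qed
  obtain M where M: "M \<in> carrier_mat n n" "det M \<noteq> 0" and colM: "\<And>j. j < d \<Longrightarrow> col M j = col X j"
    by (rule extend_injective_mat[OF X dn inj subset_refl mat_range_not_full]) auto
  define E1 where "E1 = (mat n d (\<lambda>(i, j). if i = j then 1 else 0) :: 'k mat)"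
  define E2 where "E2 = (mat d n (\<lambda>(i, j). if i = j then 1 else 0) :: 'k mat)"
  have E: "E1 \<in> carrier_mat n d" "E2 \<in> carrier_mat d n" by (simp_all add: E1_def E2_def)
  have BE1: "(B * E1) $$ (i, j) = B $$ (i, j)" if "B \<in> carrier_mat n n" "i < n" "j < d" for B i j
    using that dn by (simp add: E1_def scalar_prod_def if_distrib if_distribR sum.delta cong: if_cong)
  have E2B: "(E2 * B) $$ (i, j) = B $$ (i, j)" if "B \<in> carrier_mat n k" "i < d" "j < k" for B i j k
    using that dn by (simp add: E2_def scalar_prod_def if_distrib if_distribR sum.delta cong: if_cong)
  have E1C: "(E1 * C) $$ (i, j) = (if i < d then C $$ (i, j) else 0)" if "i < n" "j < d" for i j
    using that dn C by (simp add: E1_def scalar_prod_def if_distrib if_distribR sum.delta cong: if_cong)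
  have CE2: "(C * E2) $$ (i, j) = (if j < d then C $$ (i, j) else 0)" if "i < d" "j < n" for i j
    using that dn C by (simp add: E2_def scalar_prod_def if_distrib if_distribR sum.delta cong: if_cong)
  have ME1: "M * E1 = X"
  proof (rule eq_matI)
    fix i j assume ij: "i < dim_row X" "j < dim_col X"
    hence "(M * E1) $$ (i, j) = M $$ (i, j)" using BE1[OF M(1)] X by simp
    also have "\<dots> = col M j $ i" using ij M X dn by simp
    also have "\<dots> = X $$ (i, j)" using ij X colM[of j] by simp
    finally show "(M * E1) $$ (i, j) = X $$ (i, j)" .
  qed (use M X E in auto)
  have E2E1: "E2 * E1 = 1\<^sub>m d"
  proof (rule eq_matI)
    fix i j assume "i < dim_row (1\<^sub>m d)" "j < dim_col (1\<^sub>m d)"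
    thus "(E2 * E1) $$ (i, j) = 1\<^sub>m d $$ (i, j)"
      using E2B[OF E(1), of i j] dn by (simp add: E1_def del: index_mult_mat(1))
  qed (use E in auto)
  \<comment> \<open>\<open>R\<close> measures how far the columns appended to \<open>X\<close> are from the kernel of \<open>W\<close>. As \<open>R * E1 = 0\<close>, the
    correction \<open>N = 1 + E1 * R\<close> is unipotent, and \<open>P = M * N\<close> has \<open>W * P = E2\<close>.\<close>
  define R where "R = E2 - W * M"
  have WMc: "W * M \<in> carrier_mat d n" using W M by simp
  hence R: "R \<in> carrier_mat d n" unfolding R_def by (rule minus_carrier_mat)
  have RE1: "R * E1 = 0\<^sub>m d d"
  proof -
    have "R * E1 = E2 * E1 - W * M * E1" unfolding R_def
      using E WMc by (intro minus_mult_distrib_mat) auto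
    also have "W * M * E1 = W * (M * E1)" using W M E by (intro assoc_mult_mat) auto
    finally show ?thesis unfolding ME1 E2E1 WX by auto
  qed
  define N where "N = 1\<^sub>m n + E1 * R"
  define P where "P = M * N"
  have cER: "E1 * R \<in> carrier_mat n n" using E R by simp
  have N: "N \<in> carrier_mat n n" unfolding N_def using cER by simp
  have P: "P \<in> carrier_mat n n" unfolding P_def using M N by simp
  have ERER: "E1 * R * (E1 * R) = 0\<^sub>m n n"
  proof -
    have "E1 * R * (E1 * R) = E1 * (R * E1) * R"
      using E R by (simp add: assoc_mult_mat[of _ n d _ n _ n] assoc_mult_mat[of _ n d _ d _ n] assoc_mult_mat[of _ d n _ d _ n])
    thus ?thesis unfolding RE1 using E R by simp
  qed
  have "N * (1\<^sub>m n - E1 * R) = 1\<^sub>m n"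
  proof -
    have "N * (1\<^sub>m n - E1 * R) = N * 1\<^sub>m n - N * (E1 * R)"
      using N cER by (intro mult_minus_distrib_mat) auto
    also have "N * (E1 * R) = 1\<^sub>m n * (E1 * R) + E1 * R * (E1 * R)"
      unfolding N_def using cER by (intro add_mult_distrib_mat) auto
    also have "N * 1\<^sub>m n - (1\<^sub>m n * (E1 * R) + E1 * R * (E1 * R)) = 1\<^sub>m n"
      unfolding ERER left_mult_one_mat[OF cER] right_mult_one_mat[OF N] using E R
      by (auto simp: N_def intro!: eq_matI simp del: index_mult_mat(1))
    finally show ?thesis .
  qed
  hence "det N \<noteq> 0" by (rule mat_right_inverse_det_nonzero(1)[OF N minus_carrier_mat[OF cER]])
  hence "det P \<noteq> 0" unfolding P_def using M N by (simp add: det_mult[of _ n])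
  then obtain Q where Q: "Q \<in> carrier_mat n n" "P * Q = 1\<^sub>m n" "Q * P = 1\<^sub>m n"
    by (rule mat_det_nonzero_inverse[OF P])
  have PE1: "P * E1 = X"
  proof -
    have "N * E1 = 1\<^sub>m n * E1 + E1 * R * E1"
      unfolding N_def using cER E by (intro add_mult_distrib_mat) auto
    also have "E1 * R * E1 = E1 * (R * E1)" using E R by (intro assoc_mult_mat) auto
    finally have "N * E1 = E1" unfolding RE1 using E by simp
    thus ?thesis unfolding P_def using M N E by (simp add: assoc_mult_mat[of _ n n _ n _ d] ME1)
  qed
  have WP: "W * P = E2"
  proof -
    have "W * P = W * M * N" unfolding P_def using W M N by (simp add: assoc_mult_mat[of _ d n _ n _ n])
    also have "\<dots> = W * M * 1\<^sub>m n + W * M * (E1 * R)"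
      unfolding N_def using WMc cER by (intro mult_add_distrib_mat) auto
    also have "W * M * (E1 * R) = W * (M * E1) * R"
      using W M E R by (simp add: assoc_mult_mat[of _ d n _ n _ n] assoc_mult_mat[of _ n n _ d _ n] assoc_mult_mat[of _ d n _ d _ n])
    also have "\<dots> = R" unfolding ME1 WX using R by simp
    finally have "W * P = W * M + (E2 - W * M)" unfolding R_def right_mult_one_mat[OF WMc] .
    also have "\<dots> = E2" using W M E by (intro eq_matI) (auto simp del: index_mult_mat(1))
    finally show ?thesis .
  qed
  define B where "B = Q * A * P"
  have B: "B \<in> carrier_mat n n" unfolding B_def using Q A P by simp
  have "A = P * B * Q"
  proof -
    have "P * B * Q = (P * Q) * A * (P * Q)" unfolding B_def
      using P Q(1) A by (simp add: mat_assoc[of _ n])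
    thus ?thesis using A unfolding Q by simp
  qed
  hence sim: "similar_mat A B"
    unfolding similar_mat_def using similar_mat_witI[OF Q(2,3) _ A B P Q(1)] by blast
  have BE: "B * E1 = E1 * C"
  proof -
    have "B * E1 = Q * (A * (P * E1))" unfolding B_def
      using Q A P E by (simp add: assoc_mult_mat[of _ n n _ n _ d] mat_assoc[of _ n])
    also have "\<dots> = Q * P * E1 * C" unfolding PE1 AX unfolding PE1[symmetric]
      using Q(1) P E C by (simp add: assoc_mult_mat[of _ n n _ n _ d] assoc_mult_mat[of _ n n _ d _ d])
    finally show ?thesis unfolding Q using E by simp
  qed
  have EB: "E2 * B = C * E2"
  proof -
    have "E2 * B = W * ((P * Q) * A * P)" unfolding B_def WP[symmetric]
      using Q(1) A P W by (simp add: assoc_mult_mat[of _ d n _ n _ n] mat_assoc[of _ n])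
    also have "\<dots> = W * A * P" unfolding Q using A P W by (simp add: assoc_mult_mat[of _ d n _ n _ n])
    also have "\<dots> = C * (W * P)" unfolding WA using C P W by (simp add: assoc_mult_mat[of _ d d _ n _ n])
    finally show ?thesis unfolding WP .
  qed
  define A' where "A' = mat (n - d) (n - d) (\<lambda>(i, j). B $$ (i + d, j + d))"
  let ?blk = "four_block_mat C (0\<^sub>m d (n - d)) (0\<^sub>m (n - d) d) A'"
  have "B = ?blk"
  proof (rule eq_matI)
    fix i j
    assume "i < dim_row (?blk)"
      "j < dim_col (?blk)"
    hence ij: "i < n" "j < n" using C dn by (auto simp: A'_def)
    consider "j < d" | "i < d" "\<not> j < d" | "\<not> i < d" "\<not> j < d" by blast
    thus "B $$ (i, j) = ?blk $$ (i, j)"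
    proof cases
      case 1
      hence "B $$ (i, j) = (if i < d then C $$ (i, j) else 0)"
        using BE1[OF B ij(1)] E1C[OF ij(1)] BE by simp
      thus ?thesis using 1 ij C dn by (simp add: A'_def)
    next
      case 2
      hence "B $$ (i, j) = 0"
        using E2B[OF B _ ij(2)] CE2[OF _ ij(2)] EB by simp
      thus ?thesis using 2 ij C dn by (simp add: A'_def)
    next
      case 3
      thus ?thesis using ij C dn by (simp add: A'_def)
    qed
  qed (use B C dn in \<open>auto simp: A'_def\<close>)
  with sim have "similar_mat A ?blk" by simp
  thus thesis by (rule that[OF dn, rotated]) (simp add: A'_def)
qed

section \<open>Similarity of matrices over a finite field\<close>

lemma finite_carrier_mat: "finite (carrier_mat n k :: 'k::finite mat set)"
proof (rule finite_subset)
  show "finite ((mat n k :: _ \<Rightarrow> 'k mat) ` (({..<n} \<times> {..<k}) \<rightarrow>\<^sub>E UNIV))"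
    by (intro finite_imageI finite_PiE) auto
  show "carrier_mat n k \<subseteq> (mat n k :: _ \<Rightarrow> 'k mat) ` (({..<n} \<times> {..<k}) \<rightarrow>\<^sub>E UNIV)"
  proof
    fix A :: "'k mat" assume "A \<in> carrier_mat n k"
    hence "A = mat n k (restrict (\<lambda>ij. A $$ ij) ({..<n} \<times> {..<k}))"
      by (intro eq_matI) auto
    thus "A \<in> mat n k ` (({..<n} \<times> {..<k}) \<rightarrow>\<^sub>E UNIV)"
      by (rule image_eqI[where x = "restrict (\<lambda>ij. A $$ ij) ({..<n} \<times> {..<k})"]) auto
  qed
qed

text \<open>
  There are only finitely many matrices.
\<close>

lemma matrix_powers_repeat:
  fixes A :: "'k::finite_field mat"
  assumes A: "A \<in> carrier_mat n n"
  obtains i j :: nat where "i < j" "poly_mat (monom 1 i) A = poly_mat (monom 1 j) A"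
proof -
  have "\<not> inj (\<lambda>i::nat. poly_mat (monom 1 i) A)"
  proof
    assume "inj (\<lambda>i::nat. poly_mat (monom 1 i) A)"
    moreover have "range (\<lambda>i::nat. poly_mat (monom 1 i) A) \<subseteq> carrier_mat n n" using A by auto
    ultimately have "finite (UNIV :: nat set)"
      by (metis finite_carrier_mat finite_imageD finite_subset)
    thus False by simp
  qed
  then obtain a b :: nat where "a \<noteq> b" "poly_mat (monom 1 a) A = poly_mat (monom 1 b) A"
    by (auto simp: inj_def)
  thus thesis using that by (metis nat_neq_iff)
qed

lemma annihilating_poly_exists:
  fixes A :: "'k::finite_field mat"
  assumes A: "A \<in> carrier_mat n n"
  shows "\<exists>f. f \<noteq> 0 \<and> poly_mat f A = 0\<^sub>m n n"
proof -
  obtain i j :: nat where ij: "i < j" "poly_mat (monom 1 i) A = poly_mat (monom 1 j) A"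
    by (rule matrix_powers_repeat[OF A])
  let ?f = "monom 1 i + smult (- 1) (monom 1 j) :: 'k poly"
  have "coeff ?f i \<noteq> 0" using ij(1) by simp
  hence "?f \<noteq> 0" by (metis coeff_0)
  moreover have "poly_mat ?f A = 0\<^sub>m n n"
    unfolding poly_mat_add[OF A] poly_mat_smult[OF A] ij(2) using A by (intro eq_matI) auto
  ultimately show ?thesis by blast
qed

text \<open>
  Take a prime factor of a polynomial of least degree that annihilates \<open>A\<close>, together with its full
  multiplicity.
\<close>

lemma primary_part_exists:
  fixes A :: "'k::finite_field mat"
  assumes A: "A \<in> carrier_mat n n" and n: "n > 0"
  obtains p k h where "prime_elem p" "\<not> p dvd h" "poly_mat (p ^ Suc k * h) A = 0\<^sub>m n n"
    "poly_mat (p ^ k * h) A \<noteq> 0\<^sub>m n n"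
proof -
  let ?P = "\<lambda>f. f \<noteq> 0 \<and> poly_mat f A = 0\<^sub>m n n"
  obtain f0 where "?P f0" using annihilating_poly_exists[OF A] by blast
  from ex_has_least_nat[of ?P, OF this, of degree]
  obtain f where f: "?P f" and least: "\<And>g. ?P g \<Longrightarrow> degree f \<le> degree g" by blast
  have "\<not> is_unit f"
  proof
    assume "is_unit f"
    then obtain g where "1 = f * g" by (rule dvdE)
    hence "1\<^sub>m n = poly_mat f A * poly_mat g A"
      using poly_mat_mult[OF A, of f g] poly_mat_1[OF A] by simp
    also have "\<dots> = 0\<^sub>m n n"
      using f left_mult_zero_mat[OF poly_mat_carrier[OF A, of g]] by simp
    finally have "(1\<^sub>m n :: 'k mat) $$ (0, 0) = 0\<^sub>m n n $$ (0, 0)" by simp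
    thus False using n by simp
  qed
  with f obtain p where p: "prime_elem p" "p dvd f" using poly_prime_divisor_exists by blast
  obtain k h where kh: "f = p ^ k * h" "\<not> p dvd h"
    using poly_prime_power_decompose[OF p(1), of f] f by blast
  with p(2) obtain j where j: "k = Suc j" by (cases k) auto
  have nz: "p \<noteq> 0" "h \<noteq> 0" using f kh j by auto
  have "degree p > 0" using p(1) nz by (auto simp: prime_elem_def is_unit_iff_degree)
  hence "degree (p ^ j * h) < degree f"
    unfolding kh(1) j using nz by (simp add: degree_mult_eq)
  hence "\<not> ?P (p ^ j * h)" using least[of "p ^ j * h"] by linarith
  hence "poly_mat (p ^ j * h) A \<noteq> 0\<^sub>m n n" using nz by simp
  with p kh f j show thesis by (intro that[of p h j]) auto
qed

text \<open>
  Choose \<open>v\<close> annihilated by \<open>p\<^sup>k\<^sup>+\<^sup>1\<close> but not by \<open>p\<^sup>k\<close>, and a linear form \<open>l\<close> with the same property for the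
  transpose of \<open>A\<close> and with \<open>l(p\<^sup>k(A) v) \<noteq> 0\<close>. The Hankel matrix \<open>G\<close> with entries \<open>l(A\<^sup>i\<^sup>+\<^sup>j v)\<close> is
  symmetric. It is invertible: a kernel vector is a polynomial \<open>f\<close> of degree less than \<open>d\<close> with
  \<open>l(g(A) f(A) v) = 0\<close> for all \<open>g\<close>, and \<open>p\<^sup>k\<close> is a combination of \<open>f\<close> and \<open>p\<^sup>k\<^sup>+\<^sup>1\<close>. Hence the cyclic
  subspace of \<open>v\<close> is complemented by the common kernel of the forms \<open>l A\<^sup>i\<close>.
\<close>

lemma split_off_primary_block:
  fixes A :: "'k::finite_field mat"
  assumes A: "A \<in> carrier_mat n n" and p: "prime_elem p" and h: "\<not> p dvd h"
    and ann: "poly_mat (p ^ Suc k * h) A = 0\<^sub>m n n" and nann: "poly_mat (p ^ k * h) A \<noteq> 0\<^sub>m n n"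
  defines "m \<equiv> p ^ Suc k"
  defines "C \<equiv> mult_x_mat m" and "d \<equiv> degree m"
  obtains A' G where "0 < d" "d \<le> n" "A' \<in> carrier_mat (n - d) (n - d)"
    "similar_mat A (four_block_mat C (0\<^sub>m d (n - d)) (0\<^sub>m (n - d) d) A')"
    "G \<in> carrier_mat d d" "det G \<noteq> 0" "transpose_mat G = G" "G * C = transpose_mat C * G"
proof -
  have At: "transpose_mat A \<in> carrier_mat n n" using A by simp
  have p0: "p \<noteq> 0" "degree p > 0" using p by (auto simp: prime_elem_def is_unit_iff_degree)
  hence d0: "degree m > 0" by (simp add: m_def degree_mult_eq degree_power_eq)
  have C: "C \<in> carrier_mat d d" unfolding C_def d_def by simp
  have F0: "poly_mat f B *\<^sub>v 0\<^sub>v n = 0\<^sub>v n" if "B \<in> carrier_mat n n" for f and B :: "'k mat"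
    using that by (intro eq_vecI) (auto simp: scalar_prod_def)
  have Z: "0\<^sub>m n n *\<^sub>v u = 0\<^sub>v n" if "u \<in> carrier_vec n" for u :: "'k vec"
    using that by (intro eq_vecI) (auto simp: scalar_prod_def)
  have "\<exists>u\<in>carrier_vec n. poly_mat (p ^ k * h) A *\<^sub>v u \<noteq> 0\<^sub>v n"
  proof (rule ccontr)
    assume "\<not> ?thesis"
    hence "{u \<in> carrier_vec n. poly_mat (p ^ k * h) A *\<^sub>v u = 0\<^sub>v n} = carrier_vec n" by blast
    hence "kernel_card (poly_mat (p ^ k * h) A) = card (UNIV :: 'k set) ^ n"
      using A by (simp add: kernel_card_def card_carrier_vec)
    thus False using nann kernel_card_full_iff[of "poly_mat (p ^ k * h) A" n] A by simp
  qed
  then obtain u where u: "u \<in> carrier_vec n" "poly_mat (p ^ k * h) A *\<^sub>v u \<noteq> 0\<^sub>v n" by blast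
  define v where "v = poly_mat h A *\<^sub>v u"
  have v: "v \<in> carrier_vec n" using A by (simp add: v_def)
  have mv: "poly_mat m A *\<^sub>v v = 0\<^sub>v n"
  proof -
    have "poly_mat m A *\<^sub>v v = poly_mat (m * h) A *\<^sub>v u"
      unfolding v_def by (simp only: poly_mat_mult_vec[OF A u(1)])
    thus ?thesis using ann Z[OF u(1)] unfolding m_def by simp
  qed
  have pv: "poly_mat (p ^ k) A *\<^sub>v v \<noteq> 0\<^sub>v n"
    using u(2) unfolding v_def poly_mat_mult_vec(1)[OF A u(1)] .
  have "\<exists>i<n. (poly_mat (p ^ k) A *\<^sub>v v) $ i \<noteq> 0"
  proof (rule ccontr)
    assume "\<not> ?thesis"
    hence "poly_mat (p ^ k) A *\<^sub>v v = 0\<^sub>v n"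
      using A by (intro eq_vecI) (auto simp del: index_mult_mat_vec)
    with pv show False by contradiction
  qed
  then obtain i0 where i0: "i0 < n" "(poly_mat (p ^ k) A *\<^sub>v v) $ i0 \<noteq> 0" by blast
  have "coprime m h"
    unfolding m_def using poly_prime_coprime[OF p h] by (intro poly_coprime_power_left) (simp add: coprime_commute)
  then obtain b a where ab: "b * m + a * h = 1" by (rule poly_coprime_bezout)
  \<comment> \<open>\<open>e(A)\<close> is the projection to the generalized kernel of \<open>p(A)\<close>. Composing a coordinate form with it
    makes the form vanish under \<open>m\<close> without changing its values on that kernel.\<close>
  define e where "e = a * h"
  define l where "l = poly_mat e (transpose_mat A) *\<^sub>v unit_vec n i0"
  have l: "l \<in> carrier_vec n" using At by (simp add: l_def)
  have lF: "(poly_mat f (transpose_mat A) *\<^sub>v y) \<bullet> w = y \<bullet> (poly_mat f A *\<^sub>v w)"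
    if "y \<in> carrier_vec n" "w \<in> carrier_vec n" for f y w
    using transpose_vec_mult_scalar[OF poly_mat_carrier[OF A, of f] that(2,1)]
    by (simp add: poly_mat_transpose[OF A])
  have ml: "poly_mat m (transpose_mat A) *\<^sub>v l = 0\<^sub>v n"
  proof -
    have "poly_mat m (transpose_mat A) *\<^sub>v l = poly_mat (m * e) (transpose_mat A) *\<^sub>v unit_vec n i0"
      unfolding l_def by (simp only: poly_mat_mult_vec[OF At unit_vec_carrier])
    also have "m * e = a * (m * h)" unfolding e_def by (simp add: ac_simps)
    also have "poly_mat (a * (m * h)) (transpose_mat A) = transpose_mat (poly_mat a A * poly_mat (m * h) A)"
      by (simp only: poly_mat_transpose[OF A, symmetric] poly_mat_mult[OF A])
    also have "\<dots> = 0\<^sub>m n n"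
      using ann right_mult_zero_mat[OF poly_mat_carrier[OF A, of a], of n]
      unfolding m_def by (simp add: zero_transpose_mat)
    finally show ?thesis using Z[OF unit_vec_carrier] by simp
  qed
  have lpv: "l \<bullet> (poly_mat (p ^ k) A *\<^sub>v v) \<noteq> 0"
  proof -
    have "e = 1 + smult (- 1) (b * m)" using ab unfolding e_def by (simp add: algebra_simps)
    hence "poly_mat e A *\<^sub>v (poly_mat (p ^ k) A *\<^sub>v v) =
        poly_mat ((1 + smult (- 1) (b * m)) * p ^ k) A *\<^sub>v v"
      by (simp only: poly_mat_mult_vec[OF A v])
    also have "(1 + smult (- 1) (b * m)) * p ^ k = p ^ k + smult (- 1) (b * p ^ k) * m"
      by (simp add: algebra_simps)
    also have "poly_mat (p ^ k + smult (- 1) (b * p ^ k) * m) A *\<^sub>v v = poly_mat (p ^ k) A *\<^sub>v v + 0\<^sub>v n"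
      by (simp only: poly_mat_mult_vec[OF A v] mv F0[OF A])
    also have "\<dots> = poly_mat (p ^ k) A *\<^sub>v v" using A by (intro right_zero_vec) simp
    finally have "l \<bullet> (poly_mat (p ^ k) A *\<^sub>v v) = unit_vec n i0 \<bullet> (poly_mat (p ^ k) A *\<^sub>v v)"
      unfolding l_def using A by (subst lF) auto
    also have "\<dots> = (poly_mat (p ^ k) A *\<^sub>v v) $ i0"
      using i0(1) A by (intro scalar_prod_left_unit) auto
    finally show ?thesis using i0(2) by simp
  qed
  define X where "X = krylov_mat A v d"
  define Y where "Y = transpose_mat (krylov_mat (transpose_mat A) l d)"
  define G where "G = Y * X"
  have X: "X \<in> carrier_mat n d" and Y: "Y \<in> carrier_mat d n" using A At by (simp_all add: X_def Y_def)
  have G: "G \<in> carrier_mat d d" using X Y by (simp add: G_def)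
  have AX: "A * X = X * C"
    unfolding X_def C_def d_def by (rule krylov_mat_intertwine[OF A v mv d0])
  have YA: "Y * A = transpose_mat C * Y"
  proof -
    have "transpose_mat (transpose_mat A * krylov_mat (transpose_mat A) l d) =
        transpose_mat (krylov_mat (transpose_mat A) l d * C)"
      unfolding C_def d_def by (simp only: krylov_mat_intertwine[OF At l ml d0])
    thus ?thesis
      using A At C by (simp add: Y_def transpose_mult[of _ n n _ d] transpose_mult[of _ n d _ d])
  qed
  have GC: "G * C = transpose_mat C * G"
  proof -
    have "G * C = Y * A * X" unfolding G_def using A X Y C
      by (simp add: AX assoc_mult_mat[of _ d n _ d _ d] assoc_mult_mat[of _ d n _ n _ d])
    also have "\<dots> = transpose_mat C * G" unfolding YA G_def using X Y C
      by (simp add: assoc_mult_mat[of _ d d _ n _ d])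
    finally show ?thesis .
  qed
  have rowY: "row Y i = poly_mat (monom 1 i) (transpose_mat A) *\<^sub>v l" if "i < d" for i
    using that A At by (intro eq_vecI) (simp_all add: Y_def krylov_mat_def)
  have colX: "col X j = poly_mat (monom 1 j) A *\<^sub>v v" if "j < d" for j
    using that A by (intro eq_vecI) (simp_all add: X_def krylov_mat_def)
  have Gij: "G $$ (i, j) = l \<bullet> (poly_mat (monom 1 (i + j)) A *\<^sub>v v)" if "i < d" "j < d" for i j
  proof -
    have "G $$ (i, j) = row Y i \<bullet> col X j" using that X Y by (simp add: G_def)
    also have "\<dots> = l \<bullet> (poly_mat (monom 1 i * monom 1 j) A *\<^sub>v v)"
      using that A l by (simp add: rowY colX lF poly_mat_mult_vec(1)[OF A v])
    finally show ?thesis by (simp add: mult_monom)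
  qed
  have Gsym: "transpose_mat G = G"
    using G by (intro eq_matI) (auto simp: Gij add.commute)
  have "det G \<noteq> 0"
  proof
    assume "det G = 0"
    then obtain c where c: "c \<in> carrier_vec d" "c \<noteq> 0\<^sub>v d" "G *\<^sub>v c = 0\<^sub>v d"
      using det_0_iff_vec_prod_zero_field[OF G] by blast
    define f where "f = (\<Sum>j<d. monom (c $ j) j)"
    have cf: "coeff f j = (if j < d then c $ j else 0)" for j
      by (simp add: f_def coeff_sum)
    have degf: "degree f < d"
      using d0 by (intro degree_lessI) (auto simp: cf d_def)
    have cvec: "vec d (coeff f) = c" using c(1) by (intro eq_vecI) (auto simp: cf)
    have "f \<noteq> 0"
    proof
      assume "f = 0"
      hence "c = 0\<^sub>v d" unfolding cvec[symmetric] by (intro eq_vecI) auto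
      thus False using c(2) by simp
    qed
    hence "\<not> m dvd f" using degf dvd_imp_degree_le[of m f] by (auto simp: d_def)
    then obtain w b where wb: "p ^ k = w * f + b * m"
      using prime_elem_power_combination[OF p, of k f] unfolding m_def by blast
    define y where "y = poly_mat f A *\<^sub>v v"
    have y: "y \<in> carrier_vec n" using A by (simp add: y_def)
    have Xc: "X *\<^sub>v c = y"
      unfolding X_def y_def cvec[symmetric] by (rule krylov_mat_mult_vec[OF A v degf])
    have my: "poly_mat m A *\<^sub>v y = 0\<^sub>v n"
    proof -
      have "poly_mat m A *\<^sub>v y = poly_mat (f * m) A *\<^sub>v v"
        unfolding y_def by (simp only: poly_mat_mult_vec(1)[OF A v, symmetric] mult.commute)
      thus ?thesis by (simp only: poly_mat_mult_vec[OF A v] mv F0[OF A])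
    qed
    define L where "L g = l \<bullet> (poly_mat g A *\<^sub>v y)" for g
    have Lx: "L (monom 1 i) = 0" if "i < d" for i
    proof -
      have "L (monom 1 i) = row Y i \<bullet> (X *\<^sub>v c)"
        unfolding L_def Xc using that y l by (simp add: rowY lF)
      also have "\<dots> = (Y *\<^sub>v (X *\<^sub>v c)) $ i" using that Y by simp
      also have "Y *\<^sub>v (X *\<^sub>v c) = G *\<^sub>v c"
        unfolding G_def by (rule assoc_mult_mat_vec[OF Y X c(1), symmetric])
      finally show ?thesis using c(3) that by simp
    qed
    have L: "L g = 0" for g
    proof -
      have "L g = L (g mod m)" unfolding L_def poly_mat_vec_mod[OF A y my] ..
      also have "\<dots> = (\<Sum>j<d. coeff (g mod m) j * L (monom 1 j))"
      proof (rule poly_functional_expand)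
        show "degree (g mod m) < d"
          using degree_mod_less[of m g] d0 by (fastforce simp: d_def)
        show "L (f + g) = L f + L g" for f g
          unfolding L_def poly_mat_mult_vec[OF A y]
          using l A by (intro scalar_prod_add_distrib[of _ n]) auto
        show "L (smult c f) = c * L f" for c f
          unfolding L_def poly_mat_mult_vec[OF A y]
          using l A by (intro scalar_prod_smult_distrib[of _ n]) auto
      qed
      also have "\<dots> = 0" by (simp add: Lx)
      finally show ?thesis .
    qed
    have "poly_mat (p ^ k) A *\<^sub>v v = poly_mat w A *\<^sub>v y + 0\<^sub>v n"
      unfolding wb y_def by (simp only: poly_mat_mult_vec[OF A v] mv F0[OF A])
    also have "\<dots> = poly_mat w A *\<^sub>v y" using A by (intro right_zero_vec) simp
    finally show False using L[of w] lpv unfolding L_def by simp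
  qed
  then obtain H where H: "H \<in> carrier_mat d d" "G * H = 1\<^sub>m d" "H * G = 1\<^sub>m d"
    by (rule mat_det_nonzero_inverse[OF G])
  \<comment> \<open>Normalizing the left Krylov matrix by the inverse of \<open>G\<close> yields a left inverse of \<open>X\<close> that intertwines
    \<open>A\<close> with the same block \<open>C\<close>.\<close>
  have CH: "H * transpose_mat C = C * H"
    by (rule mat_inverse_intertwine[OF G H(1) C _ H(2,3) GC]) (use C in simp)
  define W where "W = H * Y"
  have W: "W \<in> carrier_mat d n" using H Y by (simp add: W_def)
  have WX: "W * X = 1\<^sub>m d"
    using H X Y by (simp add: W_def assoc_mult_mat[of _ d d _ n _ d] G_def)
  have WA: "W * A = C * W"
  proof -
    have "W * A = H * transpose_mat C * Y"
      unfolding W_def using H(1) Y A C by (simp add: YA assoc_mult_mat[of _ d d _ n _ n] assoc_mult_mat[of _ d d _ d _ n])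
    thus ?thesis unfolding CH W_def using H(1) C Y by (simp add: assoc_mult_mat[of _ d d _ d _ n])
  qed
  obtain A' where A': "d \<le> n" "A' \<in> carrier_mat (n - d) (n - d)"
    "similar_mat A (four_block_mat C (0\<^sub>m d (n - d)) (0\<^sub>m (n - d) d) A')"
    by (rule split_off_block[OF A X W C AX WA WX])
  show thesis
    by (rule that[OF _ A' G \<open>det G \<noteq> 0\<close> Gsym GC]) (use d0 in \<open>simp add: d_def\<close>)
qed

text \<open>
  Both matrices have the same annihilating polynomials, so the same cyclic block splits off both. Its
  contribution to the sizes of kernels cancels, and induction applies to the complements.
\<close>

lemma similar_mat_if_kernel_cards_eq:
  fixes A B :: "'k::finite_field mat"
  assumes "A \<in> carrier_mat n n" "B \<in> carrier_mat n n"
    and "\<And>f. kernel_card (poly_mat f A) = kernel_card (poly_mat f B)"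
  shows "similar_mat A B"
  using assms
proof (induction n arbitrary: A B rule: less_induct)
  case (less n)
  note A = less.prems(1) and B = less.prems(2) and ker = less.prems(3)
  show ?case
  proof (cases "n = 0")
    case True
    hence "A = B" using A B by (intro eq_matI) auto
    thus ?thesis using A by (auto intro: similar_mat_refl)
  next
    case False
    hence "n > 0" by simp
    then obtain p k h where p: "prime_elem p" "\<not> p dvd h"
      and Aann: "poly_mat (p ^ Suc k * h) A = 0\<^sub>m n n" "poly_mat (p ^ k * h) A \<noteq> 0\<^sub>m n n"
      by (rule primary_part_exists[OF A])
    have iff: "poly_mat f A = 0\<^sub>m n n \<longleftrightarrow> poly_mat f B = 0\<^sub>m n n" for f
      using kernel_card_full_iff[of "poly_mat f A" n] kernel_card_full_iff[of "poly_mat f B" n]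
        ker[of f] A B by simp
    define C where "C = mult_x_mat (p ^ Suc k)"
    define d where "d = degree (p ^ Suc k)"
    have C: "C \<in> carrier_mat d d" unfolding C_def d_def by simp
    let ?blk = "\<lambda>M. four_block_mat C (0\<^sub>m d (n - d)) (0\<^sub>m (n - d) d) M"
    obtain A' where d: "0 < d" "d \<le> n" and A': "A' \<in> carrier_mat (n - d) (n - d)"
      and simA: "similar_mat A (?blk A')"
      using split_off_primary_block[OF A p Aann, folded C_def d_def] by blast
    obtain B' where B': "B' \<in> carrier_mat (n - d) (n - d)" and simB: "similar_mat B (?blk B')"
      using split_off_primary_block[OF B p Aann[unfolded iff], folded C_def d_def] by blast
    have "kernel_card (poly_mat f A') = kernel_card (poly_mat f B')" for f
    proof -
      have blk: "kernel_card (poly_mat f (?blk M)) = kernel_card (poly_mat f C) * kernel_card (poly_mat f M)"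
        if "M \<in> carrier_mat (n - d) (n - d)" for M
        unfolding poly_mat_four_block[OF C that] using C that by (intro kernel_card_four_block) auto
      have "kernel_card (poly_mat f (?blk A')) = kernel_card (poly_mat f (?blk B'))"
        using kernel_card_similar[OF simA, of f] kernel_card_similar[OF simB, of f] ker[of f] by simp
      moreover have "kernel_card (poly_mat f C) > 0"
        using C by (intro kernel_card_pos[of _ d]) auto
      ultimately show ?thesis unfolding blk[OF A'] blk[OF B'] by simp
    qed
    hence "similar_mat A' B'" using less.IH[OF _ A' B'] d by simp
    hence "similar_mat (?blk A') (?blk B')"
      by (rule similar_mat_four_block_0_0[OF similar_mat_refl[OF C] _ C A'])
    thus ?thesis using simA simB similar_mat_sym similar_mat_trans by blast
  qed
qed

text \<open>
  A theorem of Taussky and Zassenhaus, here for finite fields. The inverse of the Hankel matrix is such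
  an intertwiner for a cyclic block, and block sums and congruences preserve the property.
\<close>

lemma symmetric_intertwiner_transpose:
  fixes A :: "'k::finite_field mat"
  assumes "A \<in> carrier_mat n n"
  shows "\<exists>S\<in>carrier_mat n n. det S \<noteq> 0 \<and> transpose_mat S = S \<and> A * S = S * transpose_mat A"
  using assms
proof (induction n arbitrary: A rule: less_induct)
  case (less n)
  note A = less.prems
  show ?case
  proof (cases "n = 0")
    case True
    thus ?thesis using A by (intro bexI[of _ "1\<^sub>m n"]) auto
  next
    case False
    hence "n > 0" by simp
    then obtain p k h where p: "prime_elem p" "\<not> p dvd h"
      and Aann: "poly_mat (p ^ Suc k * h) A = 0\<^sub>m n n" "poly_mat (p ^ k * h) A \<noteq> 0\<^sub>m n n"
      by (rule primary_part_exists[OF A])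
    define C where "C = mult_x_mat (p ^ Suc k)"
    define d where "d = degree (p ^ Suc k)"
    have C: "C \<in> carrier_mat d d" unfolding C_def d_def by simp
    obtain A' G where d: "0 < d" "d \<le> n" and A': "A' \<in> carrier_mat (n - d) (n - d)"
      and simA: "similar_mat A (four_block_mat C (0\<^sub>m d (n - d)) (0\<^sub>m (n - d) d) A')"
      and G: "G \<in> carrier_mat d d" "det G \<noteq> 0" "transpose_mat G = G" "G * C = transpose_mat C * G"
      using split_off_primary_block[OF A p Aann, folded C_def d_def] by blast
    obtain S' where S': "S' \<in> carrier_mat (n - d) (n - d)" "det S' \<noteq> 0" "transpose_mat S' = S'"
      "A' * S' = S' * transpose_mat A'"
      using less.IH[OF _ A'] d by auto
    obtain H where H: "H \<in> carrier_mat d d" "G * H = 1\<^sub>m d" "H * G = 1\<^sub>m d"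
      using mat_det_nonzero_inverse[OF G(1,2)] .
    have Hsym: "transpose_mat H = H"
    proof -
      have "transpose_mat H * G = 1\<^sub>m d"
        using arg_cong[OF H(2), of transpose_mat] G H(1) by (simp add: transpose_mult[of _ d d])
      hence "transpose_mat H * G * H = H" using H by simp
      thus ?thesis using H G by (simp add: mat_assoc[of _ d])
    qed
    have CH: "C * H = H * transpose_mat C"
      by (rule mat_inverse_intertwine[OF G(1) H(1) C _ H(2,3) G(4), symmetric]) (use C in simp)
    define n' where "n' = n - d"
    have nd: "n = d + n'" using d by (simp add: n'_def)
    define B where "B = four_block_mat C (0\<^sub>m d n') (0\<^sub>m n' d) A'"
    define T where "T = four_block_mat H (0\<^sub>m d n') (0\<^sub>m n' d) S'"
    note A' = A'[folded n'_def] and S' = S'[folded n'_def]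
    have BT: "B \<in> carrier_mat n n" "T \<in> carrier_mat n n"
      using A' C H S' by (auto simp: B_def T_def nd)
    have Bt: "transpose_mat B = four_block_mat (transpose_mat C) (0\<^sub>m d n') (0\<^sub>m n' d) (transpose_mat A')"
      unfolding B_def using A' C by (subst transpose_four_block_mat[of _ d d _ n' _ n']) auto
    have Tt: "transpose_mat T = T"
      unfolding T_def using S' H Hsym by (subst transpose_four_block_mat[of _ d d _ n' _ n']) auto
    have "B * T = four_block_mat (C * H) (0\<^sub>m d n') (0\<^sub>m n' d) (A' * S')"
      unfolding B_def T_def using A' C H S' by (subst mult_four_block_mat[of _ d d _ n' _ n' _ _ d _ n']) auto
    moreover have "T * transpose_mat B = four_block_mat (H * transpose_mat C) (0\<^sub>m d n') (0\<^sub>m n' d) (S' * transpose_mat A')"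
      unfolding Bt T_def using A' C H S' by (subst mult_four_block_mat[of _ d d _ n' _ n' _ _ d _ n']) auto
    ultimately have TB: "B * T = T * transpose_mat B" by (simp add: CH S'(4))
    have "det H \<noteq> 0" using H G by (intro mat_right_inverse_det_nonzero(1)[of _ d G]) auto
    hence detT: "det T \<noteq> 0"
      unfolding T_def using S' H by (subst det_four_block_mat_lower_left_zero[of _ d _ n']) auto
    from simA obtain P Q where wit: "similar_mat_wit A B P Q"
      unfolding similar_mat_def B_def n'_def by blast
    note w = similar_mat_witD2[OF A wit]
    have Pt: "transpose_mat P \<in> carrier_mat n n" and Qt: "transpose_mat Q \<in> carrier_mat n n"
      using w by simp_all
    have QPt: "transpose_mat P * transpose_mat Q = 1\<^sub>m n"
      using arg_cong[OF w(2), of transpose_mat] w(6,7) by (simp add: transpose_mult[of _ n n])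
    \<comment> \<open>For \<open>A = P B P\<^sup>-\<^sup>1\<close>, an intertwiner \<open>T\<close> of \<open>B\<close> is transported by congruence, which keeps it symmetric.\<close>
    define S where "S = P * T * transpose_mat P"
    have S: "S \<in> carrier_mat n n" using w BT by (simp add: S_def)
    have dP: "det P \<noteq> 0" using w by (intro mat_right_inverse_det_nonzero(1)[of _ n Q]) auto
    hence "det S \<noteq> 0"
      unfolding S_def using w(6) BT(2) detT Pt by (simp add: det_mult[of _ n] det_transpose)
    moreover have "transpose_mat S = S"
      unfolding S_def using w(6) BT(2) Pt
      by (simp add: transpose_mult[of _ n n _ n] Tt mat_assoc[of _ n])
    moreover have "A * S = S * transpose_mat A"
    proof -
      have "A * S = P * B * (Q * P) * T * transpose_mat P"
        unfolding S_def w(3) using w(6,7) BT Pt by (simp add: mat_assoc[of _ n])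
      also have "\<dots> = P * (B * T) * transpose_mat P"
        unfolding w(2) using w(6) BT Pt by (simp add: mat_assoc[of _ n])
      also have "\<dots> = P * T * (transpose_mat P * transpose_mat Q) * transpose_mat B * transpose_mat P"
        unfolding QPt TB using w(6) BT Pt by (simp add: mat_assoc[of _ n])
      also have "\<dots> = S * (transpose_mat Q * (transpose_mat B * transpose_mat P))"
        unfolding S_def using w(6) BT Pt Qt by (simp add: mat_assoc[of _ n])
      also have "transpose_mat Q * (transpose_mat B * transpose_mat P) = transpose_mat A"
        unfolding w(3) using w(6,7) BT by (simp add: transpose_mult[of _ n n _ n])
      finally show ?thesis .
    qed
    ultimately show ?thesis using S by blast
  qed
qed

section \<open>The subfield of order q and the norm equation\<close>

text \<open>
  A type for the subfield makes the theory of similarity apply to it. As every finite field needs a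
  value here, the whole field stands in when its order is not the square of a prime power.
\<close>

definition quadratic_subfield :: "'a::finite_field set" where
  "quadratic_subfield =
    (if \<exists>q. primepow q \<and> card (UNIV :: 'a set) = q\<^sup>2 then Fq (THE q. card (UNIV :: 'a set) = q\<^sup>2) else UNIV)"

lemma quadratic_subfield_eq_Fq:
  assumes "primepow q" "card (UNIV :: 'a::finite_field set) = q\<^sup>2"
  shows "(quadratic_subfield :: 'a set) = Fq q"
proof -
  have "(THE r. card (UNIV :: 'a set) = r\<^sup>2) = q"
    using assms(2) by (intro the_equality) (auto simp: power2_eq_iff_nonneg)
  thus ?thesis using assms unfolding quadratic_subfield_def by auto
qed

lemma quadratic_subfield_cases:
  obtains q where "primepow q" "card (UNIV :: 'a::finite_field set) = q\<^sup>2" "(quadratic_subfield :: 'a set) = Fq q"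
  | "(quadratic_subfield :: 'a set) = UNIV"
proof (cases "\<exists>q. primepow q \<and> card (UNIV :: 'a set) = q\<^sup>2")
  case True
  thus thesis using that(1) quadratic_subfield_eq_Fq by blast
next
  case False
  hence "(quadratic_subfield :: 'a set) = UNIV" by (auto simp: quadratic_subfield_def)
  thus thesis by (rule that(2))
qed

lemma quadratic_subfield_closed:
  fixes x y :: "'a::finite_field"
  shows "0 \<in> (quadratic_subfield :: 'a set)" "1 \<in> (quadratic_subfield :: 'a set)"
    and "x \<in> quadratic_subfield \<Longrightarrow> y \<in> quadratic_subfield \<Longrightarrow> x + y \<in> quadratic_subfield"
    and "x \<in> quadratic_subfield \<Longrightarrow> - x \<in> quadratic_subfield"
    and "x \<in> quadratic_subfield \<Longrightarrow> y \<in> quadratic_subfield \<Longrightarrow> x * y \<in> quadratic_subfield"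
    and "x \<in> quadratic_subfield \<Longrightarrow> inverse x \<in> quadratic_subfield"
  by (rule quadratic_subfield_cases[where 'a = 'a]; auto intro: Fq_subfield)+

typedef (overloaded) 'a fq = "quadratic_subfield :: 'a::finite_field set"
  morphisms of_fq to_fq
  using quadratic_subfield_closed(1) by blast

setup_lifting type_definition_fq

instantiation fq :: (finite_field) field
begin

lift_definition zero_fq :: "'a fq" is 0 by (rule quadratic_subfield_closed)
lift_definition one_fq :: "'a fq" is 1 by (rule quadratic_subfield_closed)
lift_definition plus_fq :: "'a fq \<Rightarrow> 'a fq \<Rightarrow> 'a fq" is "(+)" by (rule quadratic_subfield_closed)
lift_definition times_fq :: "'a fq \<Rightarrow> 'a fq \<Rightarrow> 'a fq" is "(*)" by (rule quadratic_subfield_closed)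
lift_definition uminus_fq :: "'a fq \<Rightarrow> 'a fq" is uminus by (rule quadratic_subfield_closed)
lift_definition inverse_fq :: "'a fq \<Rightarrow> 'a fq" is inverse by (rule quadratic_subfield_closed)
definition minus_fq :: "'a fq \<Rightarrow> 'a fq \<Rightarrow> 'a fq" where "minus_fq x y = x + - y"
definition divide_fq :: "'a fq \<Rightarrow> 'a fq \<Rightarrow> 'a fq" where "divide_fq x y = x * inverse y"

instance
proof
  fix x y z :: "'a fq"
  show "x + y + z = x + (y + z)" "x + y = y + x" "0 + x = x" "- x + x = 0"
    "x * y * z = x * (y * z)" "x * y = y * x" "1 * x = x" "(x + y) * z = x * z + y * z"
    "(0 :: 'a fq) \<noteq> 1" "inverse (0 :: 'a fq) = 0"
    by (transfer; simp add: algebra_simps)+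
  show "x \<noteq> 0 \<Longrightarrow> inverse x * x = 1" by transfer simp
qed (simp_all add: minus_fq_def divide_fq_def)

end

instance fq :: (finite_field) finite_field
proof (rule finite_fieldI)
  have "inj (of_fq :: 'a fq \<Rightarrow> 'a)" by (simp add: inj_def of_fq_inject)
  thus "finite (UNIV :: 'a fq set)" by (rule finite_imageD[rotated]) simp
qed

interpretation of_fq: field_hom "of_fq :: 'a::finite_field fq \<Rightarrow> 'a"
  by unfold_locales
    (simp_all add: zero_fq.rep_eq one_fq.rep_eq plus_fq.rep_eq times_fq.rep_eq)

interpretation of_fq_poly: map_poly_comm_ring_hom "of_fq :: 'a::finite_field fq \<Rightarrow> 'a" ..

text \<open>
  The field \<open>'a\<close> is the quadratic extension of its subfield \<open>'a fq\<close>, with conjugation \<open>x \<mapsto> x\<^sup>q\<close>.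
\<close>

locale quadratic_extension =
  fixes q :: nat and ty :: "'a::finite_field itself"
  assumes primepow_q: "primepow q" and card_UNIV: "card (UNIV :: 'a set) = q\<^sup>2"
begin

abbreviation frob :: "'a \<Rightarrow> 'a" where "frob x \<equiv> x ^ q"
abbreviation bar :: "'a mat \<Rightarrow> 'a mat" where "bar \<equiv> map_mat frob"

lemma q_gt_1: "q > 1" using primepow_gt_Suc_0[OF primepow_q] by simp

sublocale frob: field_hom frob
  using q_gt_1
  by unfold_locales
    (auto simp: frobenius_add[OF primepow_q card_UNIV] power_mult_distrib power_0_left)

sublocale frob_poly: map_poly_comm_ring_hom frob ..

lemma frob_frob [simp]: "frob (frob x) = x"
  using finite_field_power_card_eq_same[of x] card_UNIV
  by (simp add: power2_eq_square flip: power_mult)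

lemma frob_of_fq [simp]: "frob (of_fq x) = (of_fq x :: 'a)"
  using of_fq[of x] quadratic_subfield_eq_Fq[OF primepow_q card_UNIV] unfolding Fq_def by blast

lemma of_fq_to_fq: "frob x = x \<Longrightarrow> of_fq (to_fq x) = x"
  using quadratic_subfield_eq_Fq[OF primepow_q card_UNIV] unfolding Fq_def
  by (intro to_fq_inverse) blast

text \<open>
  Some element has nonzero trace, and dividing by the trace gives an element of trace \<open>1\<close>. Should it lie in
  the subfield, adding an element \<open>\<delta>\<close> of trace \<open>0\<close> moves it out of the subfield.
\<close>

lemma trace_one_generator_exists: "\<exists>\<theta> :: 'a. \<theta> + frob \<theta> = 1 \<and> frob \<theta> \<noteq> \<theta>"
proof -
  have "card (Fq q :: 'a set) \<noteq> card (UNIV :: 'a set)"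
    using q_gt_1 card_Fq[OF primepow_q card_UNIV] card_UNIV by (simp add: power2_eq_square)
  hence "(Fq q :: 'a set) \<noteq> UNIV" by auto
  then obtain y :: 'a where y: "frob y \<noteq> y" by (auto simp: Fq_def)
  define \<delta> where "\<delta> = y - frob y"
  have \<delta>: "\<delta> \<noteq> 0" "frob \<delta> = - \<delta>" using y by (simp_all add: \<delta>_def frob.hom_minus)
  have "\<exists>x :: 'a. x + frob x \<noteq> 0"
  proof (rule ccontr)
    assume "\<not> ?thesis"
    hence *: "x + frob x = 0" for x :: 'a by blast
    hence "frob x = - x" for x :: 'a by (simp add: eq_neg_iff_add_eq_0 add.commute)
    moreover from this[of 1] have "(1 :: 'a) = - 1" by simp
    hence "- x = x" for x :: 'a by (metis mult_1 mult_minus_left)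
    ultimately show False using y by metis
  qed
  then obtain x :: 'a where x: "x + frob x \<noteq> 0" by blast
  define \<theta> where "\<theta> = x / (x + frob x)"
  have fr: "frob (x + frob x) = x + frob x" by (simp only: frob.hom_add frob_frob add.commute)
  have tr: "\<theta> + frob \<theta> = 1"
  proof -
    have "frob \<theta> = frob x / (x + frob x)" unfolding \<theta>_def frob.hom_div fr ..
    thus ?thesis using x by (simp add: \<theta>_def flip: add_divide_distrib)
  qed
  show ?thesis
  proof (cases "frob \<theta> = \<theta>")
    case False
    thus ?thesis using tr by blast
  next
    case True
    hence two: "(2 :: 'a) \<noteq> 0" using tr by (auto simp flip: mult_2)
    have "(\<theta> + \<delta>) + frob (\<theta> + \<delta>) = 1" using tr \<delta>(2) by (simp add: frob.hom_add)
    moreover have "frob (\<theta> + \<delta>) \<noteq> \<theta> + \<delta>"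
    proof
      assume "frob (\<theta> + \<delta>) = \<theta> + \<delta>"
      hence "- \<delta> = \<delta>" using True \<delta>(2) by (simp add: frob.hom_add)
      hence "2 * \<delta> = 0" by (metis add.right_inverse mult_2)
      thus False using two \<delta>(1) by simp
    qed
    ultimately show ?thesis by blast
  qed
qed

definition \<theta> :: 'a where "\<theta> = (SOME \<theta>. \<theta> + frob \<theta> = 1 \<and> frob \<theta> \<noteq> \<theta>)"

lemma \<theta>: "\<theta> + frob \<theta> = 1" "frob \<theta> \<noteq> \<theta>"
  using someI_ex[OF trace_one_generator_exists] unfolding \<theta>_def by blast+

lemma fq_decomposition: "\<exists>a b. x = of_fq a + \<theta> * of_fq b"
proof -
  define b where "b = (x - frob x) / (\<theta> - frob \<theta>)"
  define a where "a = x - \<theta> * b"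
  have nz: "\<theta> - frob \<theta> \<noteq> 0" using \<theta> by simp
  have b: "frob b = b"
  proof -
    have "frob b = (frob x - x) / (frob \<theta> - \<theta>)"
      unfolding b_def frob.hom_div frob.hom_minus frob_frob ..
    also have "\<dots> = b" unfolding b_def by (metis minus_diff_eq minus_divide_divide)
    finally show ?thesis .
  qed
  have "x - frob x = (\<theta> - frob \<theta>) * b" using nz by (simp add: b_def)
  hence "frob a = a"
    unfolding a_def frob.hom_minus frob.hom_mult b by (simp add: algebra_simps)
  hence "x = of_fq (to_fq a) + \<theta> * of_fq (to_fq b)"
    using b by (simp add: of_fq_to_fq) (simp add: a_def)
  thus ?thesis by blast
qed

lemma fq_decomposition_unique:
  assumes "of_fq a + \<theta> * of_fq b = of_fq a' + \<theta> * of_fq b'"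
  shows "a = a' \<and> b = b'"
proof -
  have "frob (of_fq a + \<theta> * of_fq b) = frob (of_fq a' + \<theta> * of_fq b')" using assms by simp
  hence "of_fq a + frob \<theta> * of_fq b = of_fq a' + frob \<theta> * of_fq b'"
    by (simp add: frob.hom_add frob.hom_mult)
  with assms have "(\<theta> - frob \<theta>) * of_fq b = (\<theta> - frob \<theta>) * of_fq b'"
    by (simp add: left_diff_distrib) (metis add_diff_cancel_left)
  hence "of_fq b = of_fq b'" using \<theta>(2) by auto
  with assms show ?thesis by (auto simp: of_fq_inject)
qed

text \<open>
  If \<open>f = u + \<theta> v\<close> with \<open>u\<close>, \<open>v\<close> over the subfield, then \<open>f\<close> times its conjugate is the norm form at
  \<open>(u, v)\<close>, which can be made congruent to \<open>x\<close> modulo \<open>x\<^sup>N - 1\<close>, where \<open>N\<close> is a period of the powers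
  of \<open>Q\<close>.
\<close>

lemma poly_norm_equation:
  assumes Q: "Q \<in> carrier_mat n n" and det: "det Q \<noteq> 0"
  obtains f where "poly_mat f Q * poly_mat (map_poly frob f) Q = Q"
proof -
  obtain i j :: nat where ij: "i < j" "poly_mat (monom 1 i) Q = poly_mat (monom 1 j) Q"
    by (rule matrix_powers_repeat[OF Q])
  define N where "N = j - i"
  have N: "N > 0" "j = i + N" using ij by (auto simp: N_def)
  have detx: "det (poly_mat (monom 1 i) Q) \<noteq> 0" for i
  proof (induction i)
    case 0
    have "poly_mat (monom 1 0) Q = 1\<^sub>m n" using poly_mat_1[OF Q] by (simp add: monom_0 one_pCons)
    thus ?case by simp
  next
    case (Suc i)
    have "monom 1 (Suc i) = [:0, 1:] * monom (1 :: 'a) i" by (simp add: monom_Suc)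
    hence "poly_mat (monom 1 (Suc i)) Q = Q * poly_mat (monom 1 i) Q"
      by (simp only: poly_mat_mult[OF Q] poly_mat_x[OF Q])
    thus ?case using Suc det det_mult[OF Q, of "poly_mat (monom 1 i) Q"] Q by simp
  qed
  have QN: "poly_mat (monom 1 N) Q = 1\<^sub>m n"
  proof -
    note c = poly_mat_carrier[OF Q]
    obtain P where P: "P \<in> carrier_mat n n" "P * poly_mat (monom 1 i) Q = 1\<^sub>m n"
      by (rule mat_det_nonzero_inverse[OF c detx])
    have "monom 1 j = monom 1 i * monom (1 :: 'a) N" by (simp add: mult_monom N)
    hence "poly_mat (monom 1 i) Q = poly_mat (monom 1 i) Q * poly_mat (monom 1 N) Q"
      using ij(2) by (simp only: poly_mat_mult[OF Q])
    hence "P * poly_mat (monom 1 i) Q = P * poly_mat (monom 1 i) Q * poly_mat (monom 1 N) Q"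
      using assoc_mult_mat[OF P(1) c c] by metis
    thus ?thesis using left_mult_one_mat[OF c] unfolding P(2) by metis
  qed
  define c where "c = to_fq (\<theta> * frob \<theta>)"
  have "frob (\<theta> * frob \<theta>) = \<theta> * frob \<theta>" by (simp only: frob.hom_mult frob_frob mult.commute)
  hence c: "of_fq c = \<theta> * frob \<theta>" unfolding c_def by (rule of_fq_to_fq)
  \<comment> \<open>\<open>1 - 4 c\<close> is the discriminant, the square of the difference of \<open>\<theta>\<close> and its conjugate.\<close>
  have c4: "4 * c \<noteq> 1"
  proof
    assume "4 * c = 1"
    hence "of_fq (4 * c) = 1" by simp
    moreover have "of_fq (4 * c) = 4 * (\<theta> * frob \<theta>)"
    proof -
      have "4 * c = (1 + 1 + 1 + 1) * c" by simp
      hence "of_fq (4 * c) = (1 + 1 + 1 + 1) * of_fq c"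
        by (simp only: of_fq.hom_mult of_fq.hom_add of_fq.hom_one)
      thus ?thesis unfolding c by simp
    qed
    moreover have "4 * (\<theta> * frob \<theta>) = (\<theta> + frob \<theta>)\<^sup>2 - (\<theta> - frob \<theta>)\<^sup>2"
      by (simp add: power2_eq_square algebra_simps)
    ultimately have "(\<theta> - frob \<theta>)\<^sup>2 = 0" unfolding \<theta>(1) by simp
    thus False using \<theta>(2) by simp
  qed
  define m :: "'a fq poly" where "m = monom 1 N - 1"
  have "poly m 0 \<noteq> 0" using N(1) by (simp add: m_def poly_monom power_0_left)
  from qnorm_surj_mod[OF c4 this] obtain u v where "m dvd qnorm c u v - [:0, 1:]" by blast
  then obtain r where r: "qnorm c u v = [:0, 1:] + m * r" by (metis dvdE add_diff_cancel_left' diff_add_cancel add.commute)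
  let ?i = "map_poly (of_fq :: 'a fq \<Rightarrow> 'a)"
  define f where "f = ?i u + [:\<theta>:] * ?i v"
  have frob_i: "map_poly frob (?i w) = ?i w" for w
    by (subst map_poly_map_poly) (auto simp: o_def)
  have "map_poly frob [:\<theta>:] = [:frob \<theta>:]"
    using q_gt_1 by (intro poly_eqI) (auto simp: coeff_map_poly coeff_pCons split: nat.split)
  hence fb: "map_poly frob f = ?i u + [:frob \<theta>:] * ?i v"
    unfolding f_def frob_poly.hom_add frob_poly.hom_mult frob_i by simp
  have "f * map_poly frob f = (?i u)\<^sup>2 + [:\<theta> + frob \<theta>:] * (?i u * ?i v) + [:\<theta> * frob \<theta>:] * (?i v)\<^sup>2"
  proof -
    have *: "[:\<theta> + frob \<theta>:] = [:\<theta>:] + [:frob \<theta>:]" "[:\<theta> * frob \<theta>:] = [:\<theta>:] * [:frob \<theta>:]"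
      by simp_all
    have "(x + s * y) * (x + t * y) = x\<^sup>2 + (s + t) * (x * y) + s * t * y\<^sup>2" for x y s t :: "'a poly"
      by (simp add: power2_eq_square algebra_simps)
    thus ?thesis unfolding fb * unfolding f_def .
  qed
  also have "\<dots> = ?i (qnorm c u v)"
  proof -
    have "?i [:c:] = [:\<theta> * frob \<theta>:]"
      by (intro poly_eqI) (auto simp: coeff_map_poly coeff_pCons c split: nat.split)
    hence "?i (smult c w) = [:\<theta> * frob \<theta>:] * ?i w" for w
      by (simp only: smult_conv_mult[of c] of_fq_poly.hom_mult)
    moreover have "[:\<theta> + frob \<theta>:] = 1" unfolding \<theta>(1) by (simp add: one_pCons)
    ultimately show ?thesis
      unfolding qnorm_def by (simp add: of_fq_poly.hom_add of_fq_poly.hom_mult power2_eq_square)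
  qed
  also have "?i (qnorm c u v) = [:0, 1:] + ?i m * ?i r"
    unfolding r of_fq_poly.hom_add of_fq_poly.hom_mult by simp
  finally have ff: "f * map_poly frob f = [:0, 1:] + ?i m * ?i r" .
  have "?i m = monom 1 N + smult (- 1) 1"
    unfolding m_def by (simp add: of_fq_poly.hom_minus map_poly_monom one_pCons)
  hence "poly_mat (?i m) Q = poly_mat (monom 1 N) Q + (- 1) \<cdot>\<^sub>m poly_mat 1 Q"
    by (simp only: poly_mat_add[OF Q] poly_mat_smult[OF Q])
  also have "\<dots> = 0\<^sub>m n n" unfolding QN poly_mat_1[OF Q] by (intro eq_matI) auto
  finally have "poly_mat (f * map_poly frob f) Q = Q + 0\<^sub>m n n * poly_mat (?i r) Q"
    unfolding ff by (simp only: poly_mat_add[OF Q] poly_mat_mult[OF Q] poly_mat_x[OF Q])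
  also have "\<dots> = Q" using Q by (simp add: left_mult_zero_mat[OF poly_mat_carrier[OF Q]])
  finally show thesis using that unfolding poly_mat_mult[OF Q] by blast
qed

lemma bar_bar [simp]: "bar (bar A) = A"
  by (intro eq_matI) auto

lemma bar_mult:
  "A \<in> carrier_mat n k \<Longrightarrow> B \<in> carrier_mat k m \<Longrightarrow> bar (A * B) = bar A * bar B"
  by (rule frob.mat_hom_mult)

lemma bar_one [simp]: "bar (1\<^sub>m n) = 1\<^sub>m n"
  by (rule frob.mat_hom_one)

lemma det_bar_nonzero: "A \<in> carrier_mat n n \<Longrightarrow> det (bar A) \<noteq> 0 \<longleftrightarrow> det A \<noteq> 0"
  using q_gt_1 by (simp add: frob.hom_det)

lemma bar_poly_mat:
  "A \<in> carrier_mat n n \<Longrightarrow> bar (poly_mat f A) = poly_mat (map_poly frob f) (bar A)"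
  by (rule poly_mat_map) (auto simp: frob.hom_add frob.hom_mult)

lemma conj_trans_eq: "conj_trans q (A :: 'a mat) = transpose_mat (bar A)"
  by (simp add: conj_trans_def)

lemma conj_trans_carrier [simp]:
  "conj_trans q (A :: 'a mat) \<in> carrier_mat k n \<longleftrightarrow> A \<in> carrier_mat n k"
  by (simp add: conj_trans_eq)

lemma conj_trans_conj_trans [simp]: "conj_trans q (conj_trans q A) = (A :: 'a mat)"
  by (intro eq_matI) (auto simp: conj_trans_eq)

lemma conj_trans_one [simp]: "conj_trans q (1\<^sub>m n) = (1\<^sub>m n :: 'a mat)"
  by (simp add: conj_trans_eq)

lemma conj_trans_mult:
  "A \<in> carrier_mat n k \<Longrightarrow> B \<in> carrier_mat k m \<Longrightarrow>
    conj_trans q (A * B) = conj_trans q B * conj_trans q (A :: 'a mat)"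
  by (simp add: conj_trans_eq bar_mult transpose_mult[of _ n k _ m])

lemma det_conj_trans_nonzero:
  "A \<in> carrier_mat n n \<Longrightarrow> det (conj_trans q A) \<noteq> 0 \<longleftrightarrow> det (A :: 'a mat) \<noteq> 0"
  using det_bar_nonzero[of A n] by (simp add: conj_trans_eq det_transpose[of _ n])

lemma conj_trans_poly_mat:
  assumes "A \<in> carrier_mat n n"
  shows "conj_trans q (poly_mat f (A :: 'a mat)) = poly_mat (map_poly frob f) (conj_trans q A)"
  using assms by (simp add: conj_trans_eq bar_poly_mat[OF assms] poly_mat_transpose[of _ n])

end

section \<open>Hermitian matrices and matrices over the subfield\<close>

context quadratic_extension
begin

text \<open>
  For Hermitian \<open>H\<close>, the adjoint of \<open>f(H)\<close> is the conjugate polynomial evaluated at \<open>H\<close>. The factor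
  is a polynomial in \<open>H\<close>, so it commutes with everything that commutes with \<open>H\<close>.
\<close>

lemma hermitian_factorization:
  fixes H :: "'a mat"
  assumes H: "H \<in> carrier_mat n n" "det H \<noteq> 0" "conj_trans q H = H"
  obtains f where "det (poly_mat f H) \<noteq> 0" "conj_trans q (poly_mat f H) * poly_mat f H = H"
    "poly_mat f H * conj_trans q (poly_mat f H) = H"
proof -
  obtain f where f: "poly_mat f H * poly_mat (map_poly frob f) H = H"
    using poly_norm_equation[OF H(1,2)] .
  have ct: "conj_trans q (poly_mat f H) = poly_mat (map_poly frob f) H"
    by (simp add: conj_trans_poly_mat[OF H(1)] H(3))
  have f': "poly_mat (map_poly frob f) H * poly_mat f H = H"
    using f by (metis poly_mat_mult[OF H(1)] mult.commute)
  have "det (poly_mat f H) * det (poly_mat (map_poly frob f) H) = det H"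
    using det_mult[OF poly_mat_carrier[OF H(1)] poly_mat_carrier[OF H(1)], of f "map_poly frob f"] f by simp
  hence "det (poly_mat f H) \<noteq> 0" using H(2) by auto
  thus thesis by (rule that) (simp_all add: ct f f')
qed

text \<open>
  The matrix \<open>P = g\<^sup>* g\<close> commutes with \<open>H1\<close>. Writing it as \<open>T\<^sup>* T\<close> with \<open>T\<close> a polynomial in \<open>P\<close> makes
  \<open>g T\<^sup>-\<^sup>1\<close> unitary without changing its effect on \<open>H1\<close>.
\<close>

lemma hermitian_similar_imp_unitary:
  fixes H1 H2 g :: "'a mat"
  assumes H1: "H1 \<in> carrier_mat n n" "conj_trans q H1 = H1"
    and H2: "H2 \<in> carrier_mat n n" "conj_trans q H2 = H2"
    and g: "g \<in> carrier_mat n n" "det g \<noteq> 0" and gH: "H2 * g = g * H1"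
  obtains X where "X \<in> carrier_mat n n" "X * conj_trans q X = 1\<^sub>m n" "H2 * X = X * H1"
proof -
  let ?g = "conj_trans q g"
  have gc: "?g \<in> carrier_mat n n" using g by simp
  define P where "P = ?g * g"
  have P: "P \<in> carrier_mat n n" using g by (simp add: P_def)
  have "det P \<noteq> 0"
    using g det_conj_trans_nonzero[OF g(1)] unfolding P_def by (simp add: det_mult[of _ n])
  moreover have "conj_trans q P = P"
    unfolding P_def by (simp add: conj_trans_mult[OF gc g(1)])
  ultimately obtain f where f: "det (poly_mat f P) \<noteq> 0"
    "conj_trans q (poly_mat f P) * poly_mat f P = P"
    using hermitian_factorization[OF P] by metis
  define T where "T = poly_mat f P"
  have T: "T \<in> carrier_mat n n" using P by (simp add: T_def)
  have TT: "conj_trans q T * T = P" using f(2) by (simp add: T_def)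
  have "H1 * P = conj_trans q (g * H1) * g"
    unfolding P_def conj_trans_mult[OF g(1) H1(1)] H1(2) using H1 g gc by (simp add: mat_assoc[of _ n])
  also have "\<dots> = ?g * (H2 * g)"
    unfolding gH[symmetric] conj_trans_mult[OF H2(1) g(1)] H2(2) using H2 g gc by (simp add: mat_assoc[of _ n])
  also have "\<dots> = P * H1" unfolding gH P_def using H1 g gc by (simp add: mat_assoc[of _ n])
  finally have "P * H1 = H1 * P" ..
  from poly_mat_intertwine[OF P P H1(1) this, of f] have TH: "T * H1 = H1 * T" by (simp add: T_def)
  obtain C where C: "C \<in> carrier_mat n n" "T * C = 1\<^sub>m n" "C * T = 1\<^sub>m n"
    using mat_det_nonzero_inverse[OF T] f(1) unfolding T_def by blast
  have CH: "C * H1 = H1 * C" by (rule mat_inverse_intertwine[OF T C(1) H1(1) H1(1) C(2,3) TH])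
  define X where "X = g * C"
  have X: "X \<in> carrier_mat n n" using g C by (simp add: X_def)
  have Cc: "conj_trans q C \<in> carrier_mat n n" and Tc: "conj_trans q T \<in> carrier_mat n n" using C T by simp_all
  have "conj_trans q X * X = conj_trans q C * P * C"
    unfolding X_def conj_trans_mult[OF g(1) C(1)] P_def using Cc gc g C(1) by (simp add: mat_assoc[of _ n])
  also have "\<dots> = conj_trans q C * conj_trans q T * (T * C)"
    unfolding TT[symmetric] using Cc Tc T C(1) by (simp add: mat_assoc[of _ n])
  also have "\<dots> = conj_trans q (T * C)"
    unfolding conj_trans_mult[OF T C(1)] unfolding C(2) using Cc Tc by simp
  finally have "conj_trans q X * X = 1\<^sub>m n" unfolding C(2) by simp
  hence "X * conj_trans q X = 1\<^sub>m n" by (rule mat_mult_left_right_inverse[rotated 2]) (use X in simp_all)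
  moreover have "H2 * X = X * H1"
  proof -
    have "H2 * X = H2 * g * C" unfolding X_def using H2 g C(1) by (simp add: mat_assoc[of _ n])
    also have "\<dots> = g * (H1 * C)" unfolding gH using H1 g C(1) by (simp add: mat_assoc[of _ n])
    also have "\<dots> = X * H1" unfolding CH[symmetric] X_def using H1 g C(1) by (simp add: mat_assoc[of _ n])
    finally show ?thesis .
  qed
  ultimately show thesis using that X by blast
qed

text \<open>
  The map sending \<open>v\<close> to \<open>S\<close> times the conjugate of \<open>v\<close> is a semilinear involution. For every \<open>w\<close> the
  vectors \<open>a w\<close> plus the image of \<open>a w\<close> are fixed, and those for \<open>a = 1\<close> and \<open>a = \<theta>\<close> span \<open>w\<close>. So the
  fixed vectors span the whole space, and \<open>X\<close> is a basis of fixed vectors.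
\<close>

lemma matrix_hilbert_90:
  fixes S :: "'a mat"
  assumes S: "S \<in> carrier_mat n n" and SS: "S * bar S = 1\<^sub>m n"
  obtains X where "X \<in> carrier_mat n n" "det X \<noteq> 0" "S * bar X = X"
proof -
  define F where "F = {v \<in> carrier_vec n. S *\<^sub>v map_vec frob v = v}"
  have span: "\<exists>s\<in>F. s \<notin> (\<lambda>v. M *\<^sub>v v) ` carrier_vec j" if j: "j < n" and M: "M \<in> carrier_mat n j" for j M
  proof (rule ccontr)
    assume contra: "\<not> ?thesis"
    obtain w where w: "w \<in> carrier_vec n" "w \<notin> (\<lambda>v. M *\<^sub>v v) ` carrier_vec j"
      using mat_range_not_full[OF j M] by blast
    define t where "t = S *\<^sub>v map_vec frob w"
    have t: "t \<in> carrier_vec n" using S by (intro carrier_vecI) (simp add: t_def)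
    have bt: "S *\<^sub>v map_vec frob t = w"
    proof -
      have "map_vec frob (map_vec frob w) = w" by (intro eq_vecI) auto
      hence "map_vec frob t = bar S *\<^sub>v w"
        unfolding t_def using frob.mult_mat_vec_hom[OF S, of "map_vec frob w"] w by simp
      hence "S *\<^sub>v map_vec frob t = (S * bar S) *\<^sub>v w"
        using S w(1) by (simp add: assoc_mult_mat_vec[of _ n n _ n])
      thus ?thesis using w(1) unfolding SS by simp
    qed
    have fix_mem: "a \<cdot>\<^sub>v w + frob a \<cdot>\<^sub>v t \<in> F" for a
    proof -
      have "map_vec frob (a \<cdot>\<^sub>v w + frob a \<cdot>\<^sub>v t) = frob a \<cdot>\<^sub>v map_vec frob w + a \<cdot>\<^sub>v map_vec frob t"
        using w t by (intro eq_vecI) (auto simp: frob.hom_add frob.hom_mult)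
      hence "S *\<^sub>v map_vec frob (a \<cdot>\<^sub>v w + frob a \<cdot>\<^sub>v t) = frob a \<cdot>\<^sub>v t + a \<cdot>\<^sub>v w"
        using w t S by (simp add: mult_add_distrib_mat_vec[of _ n n] mult_mat_vec[of _ n n] bt t_def[symmetric])
      also have "\<dots> = a \<cdot>\<^sub>v w + frob a \<cdot>\<^sub>v t" using w t by (intro comm_add_vec[of _ n]) auto
      finally show ?thesis using w t by (simp add: F_def)
    qed
    have "\<exists>x\<in>carrier_vec j. a \<cdot>\<^sub>v w + frob a \<cdot>\<^sub>v t = M *\<^sub>v x" for a
      using contra fix_mem[of a] by auto
    then obtain x where x: "\<And>a. x a \<in> carrier_vec j" "\<And>a. a \<cdot>\<^sub>v w + frob a \<cdot>\<^sub>v t = M *\<^sub>v x a" by metis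
    \<comment> \<open>Eliminating \<open>t\<close> from the fixed vectors for \<open>a = \<theta>\<close> and \<open>a = 1\<close> leaves a nonzero multiple of \<open>w\<close>.\<close>
    define y where "y = inverse (\<theta> - frob \<theta>) \<cdot>\<^sub>v (x \<theta> + (- frob \<theta>) \<cdot>\<^sub>v x 1)"
    have y: "y \<in> carrier_vec j" using x(1) by (simp add: y_def)
    have "M *\<^sub>v y = inverse (\<theta> - frob \<theta>) \<cdot>\<^sub>v ((\<theta> \<cdot>\<^sub>v w + frob \<theta> \<cdot>\<^sub>v t) + (- frob \<theta>) \<cdot>\<^sub>v (1 \<cdot>\<^sub>v w + frob 1 \<cdot>\<^sub>v t))"
      unfolding y_def x(2) using M x(1)
      by (simp add: mult_mat_vec[of _ n j] mult_add_distrib_mat_vec[of _ n j])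
    also have "\<dots> = w"
    proof (rule eq_vecI)
      fix i assume "i < dim_vec w"
      hence i: "i < n" using w by simp
      have nz: "\<theta> - frob \<theta> \<noteq> 0" using \<theta>(2) by simp
      have "\<theta> * w $ i + (frob \<theta> * t $ i - frob \<theta> * (w $ i + t $ i)) = (\<theta> - frob \<theta>) * w $ i"
        by (simp add: algebra_simps)
      moreover have "inverse (\<theta> - frob \<theta>) * ((\<theta> - frob \<theta>) * w $ i) = w $ i"
        using nz by (simp add: mult.assoc[symmetric])
      ultimately have "inverse (\<theta> - frob \<theta>) *
          (\<theta> * w $ i + (frob \<theta> * t $ i - frob \<theta> * (w $ i + t $ i))) = w $ i" by (simp only:)
      thus "(inverse (\<theta> - frob \<theta>) \<cdot>\<^sub>v ((\<theta> \<cdot>\<^sub>v w + frob \<theta> \<cdot>\<^sub>v t) + (- frob \<theta>) \<cdot>\<^sub>v (1 \<cdot>\<^sub>v w + frob 1 \<cdot>\<^sub>v t))) $ i = w $ i"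
        using i w t by simp
    qed (use w t in simp)
    finally show False using w(2) y by (metis image_eqI)
  qed
  obtain X where X: "X \<in> carrier_mat n n" "det X \<noteq> 0" "\<And>j. 0 \<le> j \<Longrightarrow> j < n \<Longrightarrow> col X j \<in> F"
  proof (rule extend_injective_mat[of "0\<^sub>m n 0" n 0 F])
    show "F \<subseteq> carrier_vec n" by (auto simp: F_def)
    show "v = 0\<^sub>v 0" if "v \<in> carrier_vec 0" for v :: "'a vec" using that by (intro eq_vecI) auto
  qed (use span in auto)
  have "S * bar X = X"
  proof (rule mat_col_eqI)
    fix j assume "j < dim_col X"
    hence j: "j < n" using X by simp
    have "col (S * bar X) j = S *\<^sub>v col (bar X) j" using S X j by (intro col_mult2[of _ n n _ n]) auto
    also have "col (bar X) j = map_vec frob (col X j)" using X j by (intro eq_vecI) auto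
    also have "S *\<^sub>v map_vec frob (col X j) = col X j" using X(3)[of j] j by (simp add: F_def)
    finally show "col (S * bar X) j = col X j" .
  qed (use S X in auto)
  with X that show thesis by blast
qed

text \<open>
  Let \<open>S\<close> intertwine \<open>H\<close> with its conjugate, and let \<open>Q\<close> be \<open>S\<close> times its conjugate. Then \<open>Q\<close> commutes
  with \<open>H\<close>, and moving a polynomial in \<open>Q\<close> past \<open>S\<close> conjugates its coefficients. With \<open>f\<close> from the norm
  equation for \<open>Q\<close>, the matrix \<open>R = f(Q)\<^sup>-\<^sup>1 S\<close> still intertwines \<open>H\<close> with its conjugate and is inverse
  to its own conjugate, and a solution \<open>X\<close> of Hilbert's Theorem 90 for \<open>R\<close> conjugates \<open>H\<close> into the
  subfield.
\<close>

lemma hermitian_similar_to_real: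
  fixes H :: "'a mat"
  assumes H: "H \<in> carrier_mat n n" "conj_trans q H = H"
  obtains X B where "X \<in> carrier_mat n n" "det X \<noteq> 0" "B \<in> carrier_mat n n" "bar B = B" "H * X = X * B"
proof -
  obtain S where S: "S \<in> carrier_mat n n" "det S \<noteq> 0" "H * S = S * transpose_mat H"
    using symmetric_intertwiner_transpose[OF H(1)] by blast
  have Ht: "transpose_mat H = bar H"
    using arg_cong[OF H(2), of transpose_mat] by (simp add: conj_trans_eq)
  have bc: "bar H \<in> carrier_mat n n" "bar S \<in> carrier_mat n n" using H S by simp_all
  have HS: "H * S = S * bar H" using S(3) unfolding Ht .
  have bHS: "bar H * bar S = bar S * H"
    using arg_cong[OF HS, of bar] bar_mult[OF H(1) S(1)] bar_mult[OF S(1) bc(1)] by simp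
  define Q where "Q = S * bar S"
  have Q: "Q \<in> carrier_mat n n" using S bc by (simp add: Q_def)
  have "det Q \<noteq> 0"
    using S det_bar_nonzero[OF S(1)] bc unfolding Q_def by (simp add: det_mult[of _ n])
  then obtain f where f: "poly_mat f Q * poly_mat (map_poly frob f) Q = Q"
    using poly_norm_equation[OF Q] by blast
  define F where "F = poly_mat f Q"
  define F' where "F' = poly_mat (map_poly frob f) Q"
  have F: "F \<in> carrier_mat n n" "F' \<in> carrier_mat n n" using Q by (simp_all add: F_def F'_def)
  have FF': "F * F' = Q" using f by (simp add: F_def F'_def)
  have "det F * det F' = det Q" using det_mult[OF F] FF' by simp
  hence detF: "det F \<noteq> 0" "det F' \<noteq> 0" using \<open>det Q \<noteq> 0\<close> by auto
  have SQ: "S * bar Q = Q * S"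
    unfolding Q_def bar_mult[OF S(1) bc(2)] using S bc by (simp add: mat_assoc[of _ n])
  have QH: "Q * H = H * Q"
  proof -
    have "Q * H = S * (bar S * H)" unfolding Q_def using S bc H by (simp add: mat_assoc[of _ n])
    also have "\<dots> = (S * bar H) * bar S" unfolding bHS[symmetric] using S bc H by (simp add: mat_assoc[of _ n])
    also have "\<dots> = H * Q" unfolding HS[symmetric] Q_def using S(1) bc H(1) by (simp add: mat_assoc[of _ n])
    finally show ?thesis .
  qed
  have FH: "F * H = H * F" unfolding F_def by (rule poly_mat_intertwine[OF Q Q H(1) QH])
  have bQc: "bar Q \<in> carrier_mat n n" using Q by simp
  have bF: "bar F = poly_mat (map_poly frob f) (bar Q)"
    unfolding F_def by (rule bar_poly_mat[OF Q])
  have bFc: "bar F \<in> carrier_mat n n" using F by simp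
  have SbF: "S * bar F = F' * S"
    unfolding bF F'_def by (rule poly_mat_intertwine[OF Q bQc S(1) SQ[symmetric], symmetric])
  obtain C where C: "C \<in> carrier_mat n n" "F * C = 1\<^sub>m n" "C * F = 1\<^sub>m n"
    using mat_det_nonzero_inverse[OF F(1) detF(1)] .
  have bC: "bar C \<in> carrier_mat n n" using C by simp
  have bFC: "bar F * bar C = 1\<^sub>m n"
    using arg_cong[OF C(2), of bar] bar_mult[OF F(1) C(1)] by simp
  have CH: "C * H = H * C" by (rule mat_inverse_intertwine[OF F(1) C(1) H(1) H(1) C(2,3) FH])
  define R where "R = C * S"
  have R: "R \<in> carrier_mat n n" using C S by (simp add: R_def)
  have bR: "bar R = bar C * bar S" unfolding R_def by (rule bar_mult[OF C(1) S(1)])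
  have bRc: "bar R \<in> carrier_mat n n" using R by simp
  have RR: "R * bar R = 1\<^sub>m n"
  proof -
    \<comment> \<open>The product of \<open>R\<close> and its conjugate becomes \<open>1\<close> after cancelling \<open>F' * F = Q\<close> on the left.\<close>
    have "F' * (S * bar C) = S * bar F * bar C"
      unfolding SbF using F S bC by (simp add: mat_assoc[of _ n])
    also have "\<dots> = S" using S bFc bC bFC by (simp add: mat_assoc[of _ n])
    finally have *: "F' * (S * bar C) = S" .
    have "F' * (F * (R * bar R)) = F' * (F * C * (S * bar C * bar S))"
      unfolding bR unfolding R_def using F C(1) S bC bc by (simp add: mat_assoc[of _ n])
    also have "\<dots> = F' * (S * bar C) * bar S" unfolding C(2) using F C(1) S bC bc by (simp add: mat_assoc[of _ n])
    also have "\<dots> = Q" unfolding * Q_def ..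
    also have "\<dots> = F' * F" unfolding F_def F'_def
      using FF' by (metis F_def F'_def poly_mat_mult[OF Q] mult.commute)
    finally have eq: "F' * F * (R * bar R) = F' * F" using F R bRc by (simp add: mat_assoc[of _ n])
    have FFc: "F' * F \<in> carrier_mat n n" using F by simp
    have "det (F' * F) \<noteq> 0" using detF by (simp add: det_mult[OF F(2,1)])
    then obtain E where E: "E \<in> carrier_mat n n" "E * (F' * F) = 1\<^sub>m n"
      using mat_det_nonzero_inverse[OF FFc] by blast
    have "E * (F' * F * (R * bar R)) = E * (F' * F) * (R * bar R)"
      using E(1) FFc R bRc by (simp add: mat_assoc[of _ n])
    thus ?thesis unfolding eq E(2) using R bRc by simp
  qed
  have HR: "H * R = R * bar H"
  proof -
    have "H * R = (H * C) * S" unfolding R_def using C(1) S(1) H(1) by (simp add: mat_assoc[of _ n])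
    also have "\<dots> = C * (H * S)" unfolding CH[symmetric] using C(1) S(1) H(1) by (simp add: mat_assoc[of _ n])
    also have "\<dots> = R * bar H" unfolding HS R_def using C(1) S(1) bc by (simp add: mat_assoc[of _ n])
    finally show ?thesis .
  qed
  obtain X where X: "X \<in> carrier_mat n n" "det X \<noteq> 0" "R * bar X = X"
    using matrix_hilbert_90[OF R RR] .
  obtain Y where Y: "Y \<in> carrier_mat n n" "X * Y = 1\<^sub>m n" "Y * X = 1\<^sub>m n"
    using mat_det_nonzero_inverse[OF X(1,2)] .
  have bX: "bar X \<in> carrier_mat n n" and bY: "bar Y \<in> carrier_mat n n" using X Y by simp_all
  define B where "B = Y * H * X"
  have B: "B \<in> carrier_mat n n" using X Y H by (simp add: B_def)
  have HX: "H * X = X * B"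
  proof -
    have "X * B = X * Y * H * X" unfolding B_def using X Y(1) H by (simp add: mat_assoc[of _ n])
    thus ?thesis unfolding Y(2) using H by simp
  qed
  have bB: "bar B \<in> carrier_mat n n" using B by simp
  have "X * bar B = X * B"
  proof -
    have "X * bar B = R * bar X * bar B" unfolding X(3) ..
    also have "\<dots> = R * (bar X * bar B)" using R bX bB by (simp add: mat_assoc[of _ n])
    also have "bar X * bar B = bar H * bar X"
      using arg_cong[OF HX, of bar] bar_mult[OF X(1) B] bar_mult[OF H(1) X(1)] by simp
    also have "R * (bar H * bar X) = R * bar H * bar X" using R bc bX by (simp add: mat_assoc[of _ n])
    also have "\<dots> = H * (R * bar X)" unfolding HR[symmetric] using H R bX by (simp add: mat_assoc[of _ n])
    finally show ?thesis unfolding X(3) HX .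
  qed
  hence "Y * X * bar B = Y * X * B" using X(1) Y(1) B bB by (simp add: mat_assoc[of _ n])
  hence "bar B = B" unfolding Y(3) using B bB by simp
  with X(1,2) B HX that show thesis by blast
qed

text \<open>
  Over \<open>F\<close> the solutions are the vectors \<open>v + \<theta> w\<close> with \<open>v\<close> and \<open>w\<close> solutions over the subfield.
\<close>

lemma kernel_card_of_fq:
  fixes M :: "'a fq mat"
  assumes M: "M \<in> carrier_mat n n"
  shows "kernel_card (map_mat of_fq M :: 'a mat) = (kernel_card M)\<^sup>2"
proof -
  let ?K = "{v \<in> carrier_vec n. M *\<^sub>v v = 0\<^sub>v n}"
  let ?L = "{v \<in> carrier_vec n. (map_mat of_fq M :: 'a mat) *\<^sub>v v = 0\<^sub>v n}"
  define h where "h v w = (map_vec of_fq v + \<theta> \<cdot>\<^sub>v map_vec of_fq w :: 'a vec)" for v w :: "'a fq vec"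
  have hc: "h v w \<in> carrier_vec n" if "v \<in> carrier_vec n" "w \<in> carrier_vec n" for v w
    using that by (simp add: h_def)
  have h_inj: "v = v' \<and> w = w'"
    if c: "v \<in> carrier_vec n" "w \<in> carrier_vec n" "v' \<in> carrier_vec n" "w' \<in> carrier_vec n"
      and eq: "h v w = h v' w'" for v w v' w'
  proof -
    have "v $ i = v' $ i \<and> w $ i = w' $ i" if "i < n" for i
      using arg_cong[OF eq, of "\<lambda>u. u $ i"] that c
      by (intro fq_decomposition_unique) (simp add: h_def)
    thus ?thesis using c by (auto intro!: eq_vecI)
  qed
  have hM: "(map_mat of_fq M :: 'a mat) *\<^sub>v h v w = h (M *\<^sub>v v) (M *\<^sub>v w)"
    if "v \<in> carrier_vec n" "w \<in> carrier_vec n" for v w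
    using that M unfolding h_def of_fq.mult_mat_vec_hom[OF M that(1)] of_fq.mult_mat_vec_hom[OF M that(2)]
    by (simp add: mult_add_distrib_mat_vec[of _ n n] mult_mat_vec[of _ n n])
  have h0: "h (0\<^sub>v n) (0\<^sub>v n) = 0\<^sub>v n" unfolding h_def by (intro eq_vecI) auto
  have "bij_betw (\<lambda>(v, w). h v w) (?K \<times> ?K) ?L"
  proof (rule bij_betw_imageI)
    show "inj_on (\<lambda>(v, w). h v w) (?K \<times> ?K)" using h_inj by (auto simp: inj_on_def)
    show "(\<lambda>(v, w). h v w) ` (?K \<times> ?K) = ?L"
    proof
      show "(\<lambda>(v, w). h v w) ` (?K \<times> ?K) \<subseteq> ?L" by (auto simp: hM h0 hc)
      show "?L \<subseteq> (\<lambda>(v, w). h v w) ` (?K \<times> ?K)"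
      proof
        fix u assume u: "u \<in> ?L"
        have "\<forall>i. \<exists>a b. u $ i = of_fq a + \<theta> * of_fq b" using fq_decomposition by blast
        then obtain a b where ab: "\<And>i. u $ i = of_fq (a i) + \<theta> * of_fq (b i)" by metis
        have vw: "vec n a \<in> carrier_vec n" "vec n b \<in> carrier_vec n" by simp_all
        have u_eq: "u = h (vec n a) (vec n b)" using u ab by (intro eq_vecI) (auto simp: h_def)
        have "h (M *\<^sub>v vec n a) (M *\<^sub>v vec n b) = h (0\<^sub>v n) (0\<^sub>v n)"
          using u hM[OF vw] u_eq h0 by simp
        from h_inj[OF _ _ _ _ this] have "M *\<^sub>v vec n a = 0\<^sub>v n" "M *\<^sub>v vec n b = 0\<^sub>v n"
          using M by (auto intro!: carrier_vecI simp del: index_mult_mat_vec)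
        thus "u \<in> (\<lambda>(v, w). h v w) ` (?K \<times> ?K)" using u_eq vw by force
      qed
    qed
  qed
  hence "card ?L = card ?K * card ?K"
    by (simp add: bij_betw_same_card[symmetric] card_cartesian_product)
  thus ?thesis using M by (simp add: kernel_card_def power2_eq_square)
qed

lemma real_matrix_obtain:
  assumes "B \<in> carrier_mat n n" "bar B = B"
  obtains B0 where "B0 \<in> carrier_mat n n" "B = map_mat of_fq B0"
proof
  show "map_mat to_fq B \<in> carrier_mat n n" using assms by simp
  have "frob (B $$ (i, j)) = B $$ (i, j)" if "i < n" "j < n" for i j
    using arg_cong[OF assms(2), of "\<lambda>M. M $$ (i, j)"] that assms(1) by simp
  thus "B = map_mat of_fq (map_mat to_fq B)"
    using assms(1) by (intro eq_matI) (auto simp: of_fq_to_fq)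
qed

lemma bar_of_fq [simp]: "bar (map_mat of_fq M) = map_mat of_fq M"
  by (intro eq_matI) auto

text \<open>
  Similarity over \<open>F\<close> forces equal kernel sizes for all polynomials over the subfield, first over \<open>F\<close> and,
  after taking square roots, over the subfield.
\<close>

lemma real_similar_descent:
  assumes B1: "B1 \<in> carrier_mat n n" "bar B1 = B1" and B2: "B2 \<in> carrier_mat n n" "bar B2 = B2"
    and g: "g \<in> carrier_mat n n" "det g \<noteq> 0" and gB: "B2 * g = g * B1"
  obtains P where "P \<in> carrier_mat n n" "det P \<noteq> 0" "bar P = P" "B2 * P = P * B1"
proof -
  obtain C1 where C1: "C1 \<in> carrier_mat n n" "B1 = map_mat of_fq C1" using real_matrix_obtain[OF B1] .
  obtain C2 where C2: "C2 \<in> carrier_mat n n" "B2 = map_mat of_fq C2" using real_matrix_obtain[OF B2] .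
  obtain g' where g': "g' \<in> carrier_mat n n" "g * g' = 1\<^sub>m n" "g' * g = 1\<^sub>m n"
    using mat_det_nonzero_inverse[OF g] .
  have "B2 = B2 * (g * g')" using B2 unfolding g'(2) by simp
  also have "\<dots> = g * B1 * g'"
    unfolding gB[symmetric] using B2(1) g(1) g'(1) by (simp add: mat_assoc[of _ n])
  finally have "B2 = g * B1 * g'" .
  hence "similar_mat B2 B1"
    unfolding similar_mat_def using similar_mat_witI[OF g'(2,3) _ B2(1) B1(1) g(1) g'(1)] by blast
  have "kernel_card (poly_mat f C2) = kernel_card (poly_mat f C1)" for f
  proof -
    have "(kernel_card (poly_mat f C))\<^sup>2 = kernel_card (poly_mat (map_poly of_fq f) (map_mat of_fq C :: 'a mat))"
      if "C \<in> carrier_mat n n" for C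
      using kernel_card_of_fq[OF poly_mat_carrier[OF that, of f]]
      by (simp add: poly_mat_map[OF that] of_fq.hom_add of_fq.hom_mult)
    hence "(kernel_card (poly_mat f C2))\<^sup>2 = (kernel_card (poly_mat f C1))\<^sup>2"
      using kernel_card_similar[OF \<open>similar_mat B2 B1\<close>, of "map_poly of_fq f"] C1 C2 by simp
    thus ?thesis by simp
  qed
  hence "similar_mat C2 C1" by (rule similar_mat_if_kernel_cards_eq[OF C2(1) C1(1)])
  then obtain P0 Q0 where wit: "similar_mat_wit C2 C1 P0 Q0" unfolding similar_mat_def by blast
  note w = similar_mat_witD2[OF C2(1) wit]
  define P where "P = (map_mat of_fq P0 :: 'a mat)"
  have "C2 * P0 = P0 * C1 * (Q0 * P0)"
    unfolding w(3) using w(6,7) C1 by (simp add: mat_assoc[of _ n])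
  hence CP: "C2 * P0 = P0 * C1" unfolding w(2) using w(6) C1 by simp
  show thesis
  proof
    show "P \<in> carrier_mat n n" using w(6) by (simp add: P_def)
    have "det P0 \<noteq> 0" by (rule mat_right_inverse_det_nonzero(1)[OF w(6,7,1)])
    thus "det P \<noteq> 0" by (simp add: P_def of_fq.hom_det)
    show "bar P = P" by (simp add: P_def)
    show "B2 * P = P * B1"
      using arg_cong[OF CP, of "map_mat (of_fq :: _ \<Rightarrow> 'a)"] of_fq.mat_hom_mult[OF C2(1) w(6)]
        of_fq.mat_hom_mult[OF w(6) C1(1)] C1 C2 by (simp add: P_def)
  qed
qed

text \<open>
  A symmetric \<open>S\<close> over the subfield with \<open>B S = S B\<^sup>T\<close> is Hermitian, so \<open>S = X X\<^sup>*\<close>. As \<open>B\<^sup>T = B\<^sup>*\<close>, this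
  says that \<open>X\<^sup>-\<^sup>1 B X\<close> is Hermitian, and it is then a Gram matrix itself.
\<close>

lemma real_similar_to_hermitian:
  assumes B: "B \<in> carrier_mat n n" "bar B = B" "det B \<noteq> 0"
  obtains T X where "T \<in> carrier_mat n n" "det T \<noteq> 0" "X \<in> carrier_mat n n" "det X \<noteq> 0"
    "B * X = X * (conj_trans q T * T)"
proof -
  obtain B0 where B0: "B0 \<in> carrier_mat n n" "B = map_mat of_fq B0" using real_matrix_obtain[OF B(1,2)] .
  obtain S0 where S0: "S0 \<in> carrier_mat n n" "det S0 \<noteq> 0" "transpose_mat S0 = S0"
    "B0 * S0 = S0 * transpose_mat B0"
    using symmetric_intertwiner_transpose[OF B0(1)] by blast
  define S where "S = (map_mat of_fq S0 :: 'a mat)"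
  have S: "S \<in> carrier_mat n n" using S0 by (simp add: S_def)
  have dS: "det S \<noteq> 0" using S0 by (simp add: S_def of_fq.hom_det)
  have tS: "transpose_mat S = S" using S0(3) by (simp add: S_def map_mat_transpose)
  have "conj_trans q S = S"
    unfolding conj_trans_eq using tS by (simp add: S_def)
  from hermitian_factorization[OF S dS this]
  obtain f where f: "det (poly_mat f S) \<noteq> 0" "poly_mat f S * conj_trans q (poly_mat f S) = S" by blast
  define X where "X = poly_mat f S"
  have X: "X \<in> carrier_mat n n" "det X \<noteq> 0" using S f by (simp_all add: X_def)
  let ?X = "conj_trans q X"
  have Xc: "?X \<in> carrier_mat n n" using X by simp
  have XX: "X * ?X = S" using f by (simp add: X_def)
  have cB: "conj_trans q B = transpose_mat B" using B by (simp add: conj_trans_eq)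
  have cBc: "conj_trans q B \<in> carrier_mat n n" using B by simp
  have BS: "B * S = S * conj_trans q B"
  proof -
    have tB0: "transpose_mat B0 \<in> carrier_mat n n" using B0 by simp
    have "map_mat of_fq (transpose_mat B0) = (transpose_mat B :: 'a mat)"
      using B0 by (simp add: map_mat_transpose)
    thus ?thesis unfolding cB
      using arg_cong[OF S0(4), of "map_mat (of_fq :: _ \<Rightarrow> 'a)"] of_fq.mat_hom_mult[OF B0(1) S0(1)]
        of_fq.mat_hom_mult[OF S0(1) tB0] B0(2) by (simp add: S_def)
  qed
  obtain Y where Y: "Y \<in> carrier_mat n n" "X * Y = 1\<^sub>m n" "Y * X = 1\<^sub>m n"
    using mat_det_nonzero_inverse[OF X] .
  let ?Y = "conj_trans q Y"
  have Yc: "?Y \<in> carrier_mat n n" using Y by simp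
  have XYc: "?X * ?Y = 1\<^sub>m n"
    using arg_cong[OF Y(3), of "conj_trans q"] conj_trans_mult[OF Y(1) X(1)] by simp
  define H where "H = Y * B * X"
  have H: "H \<in> carrier_mat n n" using X Y B by (simp add: H_def)
  have BX: "B * X = X * H"
  proof -
    have "X * H = X * Y * B * X" unfolding H_def using X Y(1) B by (simp add: mat_assoc[of _ n])
    thus ?thesis unfolding Y(2) using B by simp
  qed
  have "H = Y * (B * S) * ?Y"
  proof -
    have "Y * (B * S) * ?Y = H * (?X * ?Y)"
      unfolding H_def XX[symmetric] using X Y(1) B Xc Yc by (simp add: mat_assoc[of _ n])
    thus ?thesis unfolding XYc using H by simp
  qed
  also have "\<dots> = (Y * X) * (?X * conj_trans q B * ?Y)"
    unfolding BS unfolding XX[symmetric] using X Y(1) B Xc Yc cBc by (simp add: mat_assoc[of _ n])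
  also have "\<dots> = conj_trans q H"
  proof -
    have "conj_trans q H = ?X * (conj_trans q B * ?Y)"
      unfolding H_def using X Y(1) B by (simp add: conj_trans_mult[of _ n n _ n])
    thus ?thesis unfolding Y(3) using Xc Yc cBc by (simp add: mat_assoc[of _ n])
  qed
  finally have Hh: "conj_trans q H = H" ..
  have "det H \<noteq> 0"
  proof -
    have "det Y \<noteq> 0" by (rule mat_right_inverse_det_nonzero(1)[OF Y(1) X(1) Y(3)])
    thus ?thesis unfolding H_def using X Y(1) B by (simp add: det_mult[of _ n])
  qed
  from hermitian_factorization[OF H this Hh] obtain k where
    k: "det (poly_mat k H) \<noteq> 0" "conj_trans q (poly_mat k H) * poly_mat k H = H" by blast
  show thesis
    by (rule that[of "poly_mat k H" X]) (use k X H BX in auto)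
qed

end

section \<open>Orbits as similarity classes\<close>

lemma similar_mat_iff_intertwiner:
  fixes A B :: "'k::field mat"
  assumes A: "A \<in> carrier_mat n n" and B: "B \<in> carrier_mat n n"
  shows "similar_mat A B \<longleftrightarrow> (\<exists>g\<in>carrier_mat n n. det g \<noteq> 0 \<and> A * g = g * B)"
proof
  assume "similar_mat A B"
  then obtain P Q where "similar_mat_wit A B P Q" unfolding similar_mat_def by blast
  note w = similar_mat_witD2[OF A this]
  have "A * P = P * B * (Q * P)"
    unfolding w(3) using w(6,7) B by (simp add: mat_assoc[of _ n])
  hence "A * P = P * B" unfolding w(2) using w(6) B by simp
  thus "\<exists>g\<in>carrier_mat n n. det g \<noteq> 0 \<and> A * g = g * B"
    using w(6) mat_right_inverse_det_nonzero(1)[OF w(6,7,1)] by blast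
next
  assume "\<exists>g\<in>carrier_mat n n. det g \<noteq> 0 \<and> A * g = g * B"
  then obtain g where g: "g \<in> carrier_mat n n" "det g \<noteq> 0" "A * g = g * B" by blast
  obtain g' where g': "g' \<in> carrier_mat n n" "g * g' = 1\<^sub>m n" "g' * g = 1\<^sub>m n"
    using mat_det_nonzero_inverse[OF g(1,2)] .
  have "A = A * (g * g')" using A unfolding g'(2) by simp
  also have "\<dots> = g * B * g'"
    unfolding g(3)[symmetric] using A g(1) g'(1) by (simp add: mat_assoc[of _ n])
  finally show "similar_mat A B"
    unfolding similar_mat_def using similar_mat_witI[OF g'(2,3) _ A B g(1) g'(1)] by blast
qed

text \<open>
  The classes of \<open>E\<close>, pulled back along \<open>s\<close>, and those of \<open>F\<close> correspond to the same classes of \<open>R\<close> when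
  every element of either set is related to one of the other.
\<close>

lemma bij_betw_similarity_classes:
  assumes sym: "\<And>a b. R a b \<Longrightarrow> R b a" and trans: "\<And>a b c. R a b \<Longrightarrow> R b c \<Longrightarrow> R a c"
    and to_F: "\<And>x. x \<in> E \<Longrightarrow> \<exists>y\<in>F. R (s x) y" and to_E: "\<And>y. y \<in> F \<Longrightarrow> \<exists>x\<in>E. R (s x) y"
  shows "bij_betw (\<lambda>\<Omega>. {y \<in> F. \<exists>x\<in>\<Omega>. R (s x) y})
    ((\<lambda>x. {x' \<in> E. R (s x') (s x)}) ` E) ((\<lambda>y. {y' \<in> F. R y' y}) ` F)"
proof -
  define cl where "cl x = {x' \<in> E. R (s x') (s x)}" for x
  define K where "K \<Omega> = {y \<in> F. \<exists>x\<in>\<Omega>. R (s x) y}" for \<Omega>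
  have refl: "R (s x) (s x)" if "x \<in> E" for x using to_F[OF that] sym trans by blast
  have K: "K (cl x) = {y \<in> F. R (s x) y}" if "x \<in> E" for x
    using that refl sym trans unfolding K_def cl_def by blast
  have "inj_on K (cl ` E)"
  proof (rule inj_onI)
    fix \<Omega> \<Omega>' assume "\<Omega> \<in> cl ` E" "\<Omega>' \<in> cl ` E" and eq: "K \<Omega> = K \<Omega>'"
    then obtain x x' where x: "x \<in> E" "\<Omega> = cl x" "x' \<in> E" "\<Omega>' = cl x'" by blast
    obtain y where y: "y \<in> F" "R (s x) y" using to_F[OF x(1)] by blast
    hence "R (s x') y" using eq K[OF x(1)] K[OF x(3)] unfolding x by blast
    hence "R (s x) (s x')" using y sym trans by blast
    thus "\<Omega> = \<Omega>'" using sym trans unfolding x cl_def by blast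
  qed
  moreover have "K ` cl ` E = (\<lambda>y. {y' \<in> F. R y' y}) ` F"
  proof (intro equalityI subsetI)
    fix Z assume "Z \<in> K ` cl ` E"
    then obtain x where x: "x \<in> E" "Z = {y \<in> F. R (s x) y}" using K by auto
    obtain y where y: "y \<in> F" "R (s x) y" using to_F[OF x(1)] by blast
    hence "Z = {y' \<in> F. R y' y}" unfolding x(2) using sym trans by blast
    thus "Z \<in> (\<lambda>y. {y' \<in> F. R y' y}) ` F" using y(1) by blast
  next
    fix Z assume "Z \<in> (\<lambda>y. {y' \<in> F. R y' y}) ` F"
    then obtain y where y: "y \<in> F" "Z = {y' \<in> F. R y' y}" by blast
    obtain x where x: "x \<in> E" "R (s x) y" using to_E[OF y(1)] by blast
    hence "Z = K (cl x)" unfolding K[OF x(1)] y(2) using sym trans by blast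
    thus "Z \<in> K ` cl ` E" using x(1) by blast
  qed
  ultimately show ?thesis unfolding bij_betw_def K_def cl_def by blast
qed

lemma GL_simps [simp]: "mult (GL n K) = (*)" "one (GL n K) = 1\<^sub>m n"
  by (simp_all add: GL_def)

lemma mats_over_UNIV [simp]: "mats_over n UNIV = carrier_mat n n"
  by (simp add: mats_over_def)

lemma carrier_GL_UNIV: "carrier (GL n (UNIV :: 'k::field set)) = {A \<in> carrier_mat n n. det A \<noteq> 0}"
proof (intro equalityI subsetI)
  fix A :: "'k mat" assume "A \<in> carrier (GL n UNIV)"
  thus "A \<in> {A \<in> carrier_mat n n. det A \<noteq> 0}"
    using mat_right_inverse_det_nonzero(1)[of A n] by (auto simp: GL_def)
next
  fix A :: "'k mat" assume "A \<in> {A \<in> carrier_mat n n. det A \<noteq> 0}"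
  thus "A \<in> carrier (GL n UNIV)"
    using mat_det_nonzero_inverse[of A n] by (auto simp: GL_def)
qed

lemma group_GL:
  fixes K :: "'k::field set"
  assumes mult: "\<And>A B. A \<in> mats_over n K \<Longrightarrow> B \<in> mats_over n K \<Longrightarrow> A * B \<in> mats_over n K"
    and one: "1\<^sub>m n \<in> mats_over n K"
  shows "group (GL n K)"
proof (rule groupI)
  have c: "A \<in> carrier_mat n n" if "A \<in> mats_over n K" for A using that by (simp add: mats_over_def)
  show "x \<otimes>\<^bsub>GL n K\<^esub> y \<in> carrier (GL n K)" if xy: "x \<in> carrier (GL n K)" "y \<in> carrier (GL n K)" for x y
  proof -
    obtain x' where x: "x \<in> mats_over n K" "x' \<in> mats_over n K" "x * x' = 1\<^sub>m n" "x' * x = 1\<^sub>m n"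
      using xy(1) by (auto simp: GL_def)
    obtain y' where y: "y \<in> mats_over n K" "y' \<in> mats_over n K" "y * y' = 1\<^sub>m n" "y' * y = 1\<^sub>m n"
      using xy(2) by (auto simp: GL_def)
    note cs = c[OF x(1)] c[OF x(2)] c[OF y(1)] c[OF y(2)]
    have "x * y * (y' * x') = x * (y * y') * x'" "y' * x' * (x * y) = y' * (x' * x) * y"
      using cs by (simp_all add: mat_assoc[of _ n])
    hence "x * y * (y' * x') = 1\<^sub>m n" "y' * x' * (x * y) = 1\<^sub>m n"
      unfolding x(4) y(3) using cs x(3) y(4) by simp_all
    thus ?thesis using mult[OF x(1) y(1)] mult[OF y(2) x(2)] by (auto simp: GL_def)
  qed
  show "\<one>\<^bsub>GL n K\<^esub> \<in> carrier (GL n K)" 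
    using one by (auto simp: GL_def intro!: bexI[of _ "1\<^sub>m n"])
  show "x \<otimes>\<^bsub>GL n K\<^esub> y \<otimes>\<^bsub>GL n K\<^esub> z = x \<otimes>\<^bsub>GL n K\<^esub> (y \<otimes>\<^bsub>GL n K\<^esub> z)"
    if "x \<in> carrier (GL n K)" "y \<in> carrier (GL n K)" "z \<in> carrier (GL n K)" for x y z
    using that c by (simp add: GL_def mat_assoc[of _ n])
  show "\<one>\<^bsub>GL n K\<^esub> \<otimes>\<^bsub>GL n K\<^esub> x = x" if "x \<in> carrier (GL n K)" for x
    using that c[of x] by (auto simp: GL_def)
  show "\<exists>y\<in>carrier (GL n K). y \<otimes>\<^bsub>GL n K\<^esub> x = \<one>\<^bsub>GL n K\<^esub>" if "x \<in> carrier (GL n K)" for x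
    using that by (auto simp: GL_def)
qed

lemma GL_conjugation_iff:
  fixes K :: "'k::field set"
  assumes G: "group (GL n K)" and x: "x \<in> carrier_mat n n" and y: "y \<in> carrier_mat n n"
    and g: "g \<in> carrier (GL n K)"
  shows "y = g \<otimes>\<^bsub>GL n K\<^esub> x \<otimes>\<^bsub>GL n K\<^esub> inv\<^bsub>GL n K\<^esub> g \<longleftrightarrow> y * g = g * x"
proof -
  interpret group "GL n K" by (rule G)
  define g' where "g' = inv\<^bsub>GL n K\<^esub> g"
  have gc: "g \<in> carrier_mat n n" "g' \<in> carrier_mat n n"
    using g inv_closed[OF g] by (auto simp: GL_def mats_over_def g'_def)
  have gg: "g * g' = 1\<^sub>m n" "g' * g = 1\<^sub>m n"
    using r_inv[OF g] l_inv[OF g] by (simp_all add: g'_def)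
  have "y = g * x * g' \<longleftrightarrow> y * g = g * x"
  proof
    assume "y = g * x * g'"
    hence "y * g = g * x * (g' * g)" using gc x by (simp add: mat_assoc[of _ n])
    thus "y * g = g * x" unfolding gg using gc x by simp
  next
    assume eq: "y * g = g * x"
    have "g * x * g' = y * (g * g')" unfolding eq[symmetric] using gc y by (simp add: mat_assoc[of _ n])
    thus "y = g * x * g'" unfolding gg using y by simp
  qed
  thus ?thesis by (simp add: g'_def)
qed

context quadratic_extension
begin

lemma mats_over_Fq: "mats_over n (Fq q :: 'a set) = {A \<in> carrier_mat n n. bar A = A}"
proof (intro equalityI subsetI)
  fix A :: "'a mat" assume "A \<in> mats_over n (Fq q)"
  thus "A \<in> {A \<in> carrier_mat n n. bar A = A}"
    by (auto simp: mats_over_def Fq_def intro!: eq_matI)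
next
  fix A :: "'a mat" assume A: "A \<in> {A \<in> carrier_mat n n. bar A = A}"
  have "frob (A $$ (i, j)) = A $$ (i, j)" if "i < n" "j < n" for i j
    using A that index_map_mat(1)[of i A j frob] by auto
  thus "A \<in> mats_over n (Fq q)" using A by (auto simp: mats_over_def Fq_def)
qed

lemma carrier_GL_Fq:
  "carrier (GL n (Fq q :: 'a set)) = {B \<in> carrier_mat n n. bar B = B \<and> det B \<noteq> 0}"
proof (intro equalityI subsetI)
  fix A :: "'a mat" assume "A \<in> carrier (GL n (Fq q))"
  thus "A \<in> {B \<in> carrier_mat n n. bar B = B \<and> det B \<noteq> 0}"
    using mat_right_inverse_det_nonzero(1)[of A n] by (auto simp: GL_def mats_over_Fq)
next
  fix A :: "'a mat" assume A: "A \<in> {B \<in> carrier_mat n n. bar B = B \<and> det B \<noteq> 0}"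
  then obtain B where B: "B \<in> carrier_mat n n" "A * B = 1\<^sub>m n" "B * A = 1\<^sub>m n"
    using mat_det_nonzero_inverse[of A n] by blast
  have bB: "bar B \<in> carrier_mat n n" using B by simp
  have "A * bar B = 1\<^sub>m n" using arg_cong[OF B(2), of bar] bar_mult[of A n n B n] A B(1) by simp
  hence "B * A * bar B = B" using A B(1) bB by (simp add: mat_assoc[of _ n])
  hence "bar B = B" unfolding B(3) using bB by simp
  thus "A \<in> carrier (GL n (Fq q))" using A B by (auto simp: GL_def mats_over_Fq)
qed

lemma group_GL_UNIV: "group (GL n (UNIV :: 'a set))"
  by (rule group_GL) auto

lemma group_GL_Fq: "group (GL n (Fq q :: 'a set))"
  by (rule group_GL) (auto simp: mats_over_Fq bar_mult[of _ n n _ n])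

lemma conjugate_in_GL_UNIV:
  "conjugate_in (GL n (UNIV :: 'a set)) A B \<longleftrightarrow>
     A \<in> carrier (GL n UNIV) \<and> B \<in> carrier (GL n UNIV) \<and> similar_mat A B"
proof -
  have "(\<exists>g\<in>carrier (GL n (UNIV :: 'a set)). B = g \<otimes>\<^bsub>GL n UNIV\<^esub> A \<otimes>\<^bsub>GL n UNIV\<^esub> inv\<^bsub>GL n UNIV\<^esub> g) \<longleftrightarrow>
      similar_mat B A" if AB: "A \<in> carrier_mat n n" "B \<in> carrier_mat n n"
    unfolding similar_mat_iff_intertwiner[OF AB(2,1)]
    using GL_conjugation_iff[OF group_GL_UNIV AB] unfolding carrier_GL_UNIV by auto
  moreover have "similar_mat A B \<longleftrightarrow> similar_mat B A" using similar_mat_sym by blast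
  ultimately show ?thesis unfolding conjugate_in_def by (auto simp: carrier_GL_UNIV)
qed

lemma carrier_GU: "carrier (GU n q) = {X :: 'a mat. X \<in> carrier_mat n n \<and> X * conj_trans q X = 1\<^sub>m n}"
proof -
  have "det X \<noteq> 0" if "X \<in> carrier_mat n n" "X * conj_trans q X = 1\<^sub>m n" for X :: "'a mat"
    using mat_right_inverse_det_nonzero(1)[of X n "conj_trans q X"] that by simp
  thus ?thesis by (auto simp: GU_def carrier_GL_UNIV)
qed

lemma GU_left_inverse:
  "X \<in> carrier (GU n q) \<Longrightarrow> conj_trans q X * X = (1\<^sub>m n :: 'a mat)"
  by (rule mat_mult_left_right_inverse) (auto simp: carrier_GU)

lemma GU_det_nonzero:
  "X \<in> carrier (GU n q) \<Longrightarrow> det (X :: 'a mat) \<noteq> 0"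
  by (auto simp: GU_def carrier_GL_UNIV)

definition gram :: "'a mat \<Rightarrow> 'a mat" where "gram T = conj_trans q T * T"

lemma gram_props:
  assumes "T \<in> carrier_mat n n"
  shows "gram T \<in> carrier_mat n n" "conj_trans q (gram T) = gram T"
    and "det T \<noteq> 0 \<Longrightarrow> det (gram T) \<noteq> 0"
  using assms det_conj_trans_nonzero[OF assms]
  by (simp_all add: gram_def conj_trans_mult[of _ n n _ n] det_mult[of _ n] mult_carrier_mat[of _ n n])

text \<open>
  If the Gram matrices of \<open>T\<close> and \<open>A\<close> are similar, a unitary \<open>Y\<close> conjugates one to the other, and then
  \<open>X = T Y A\<^sup>-\<^sup>1\<close> is unitary and \<open>T = X A Y\<^sup>*\<close>.
\<close>

lemma GUGU_orbit_eq:
  fixes A :: "'a mat"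
  assumes A: "A \<in> carrier_mat n n" "det A \<noteq> 0"
  shows "orbit (GU n q \<times>\<times> GU n q) (\<lambda>(X, Y). \<lambda>A\<in>carrier (GL n UNIV). X * A * conj_trans q Y) A =
    {T \<in> carrier (GL n UNIV). similar_mat (gram T) (gram A)}" (is "?orb = ?cls")
proof -
  have orb: "?orb = {X * A * conj_trans q Y | X Y. X \<in> carrier (GU n q) \<and> Y \<in> carrier (GU n q)}"
    using A unfolding orbit_def DirProd_def by (auto simp: carrier_GL_UNIV)
  note gA = gram_props(1,2)[OF A(1)]
  show ?thesis
  proof (intro equalityI subsetI)
    fix T assume "T \<in> ?orb"
    then obtain X Y where XY: "X \<in> carrier (GU n q)" "Y \<in> carrier (GU n q)" and T_eq: "T = X * A * conj_trans q Y"
      unfolding orb by blast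
    have X: "X \<in> carrier_mat n n" "conj_trans q X * X = 1\<^sub>m n" and Y: "Y \<in> carrier_mat n n"
      using XY GU_left_inverse[OF XY(1)] by (auto simp: carrier_GU)
    have Yc: "conj_trans q Y \<in> carrier_mat n n" and Xc: "conj_trans q X \<in> carrier_mat n n"
      and Ac: "conj_trans q A \<in> carrier_mat n n" using X Y A by simp_all
    have T: "T \<in> carrier_mat n n" unfolding T_eq using X A Y by simp
    have TY: "T * Y = X * A"
    proof -
      have "T * Y = X * A * (conj_trans q Y * Y)" unfolding T_eq using X A Y Yc by (simp add: mat_assoc[of _ n])
      thus ?thesis unfolding GU_left_inverse[OF XY(2)] using X A by simp
    qed
    have cT: "conj_trans q T = Y * (conj_trans q A * conj_trans q X)"
    proof -
      have XA: "X * A \<in> carrier_mat n n" using X A by simp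
      show ?thesis unfolding T_eq conj_trans_mult[OF XA Yc] conj_trans_mult[OF X(1) A(1)] by simp
    qed
    have "gram T * Y = Y * (conj_trans q A * (conj_trans q X * X) * A)"
    proof -
      have "gram T * Y = conj_trans q T * (T * Y)" unfolding gram_def using T Y by (simp add: mat_assoc[of _ n])
      also have "\<dots> = Y * (conj_trans q A * (conj_trans q X * X) * A)"
        unfolding TY cT using X(1) A(1) Y Ac Xc by (simp add: mat_assoc[of _ n])
      finally show ?thesis .
    qed
    also have "\<dots> = Y * gram A" unfolding X(2) gram_def using Ac by simp
    finally have "gram T * Y = Y * gram A" .
    hence "similar_mat (gram T) (gram A)"
      using similar_mat_iff_intertwiner[OF gram_props(1)[OF T] gA(1)] Y GU_det_nonzero[OF XY(2)] by blast
    moreover have "det T \<noteq> 0"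
      unfolding T_eq using X A Y Yc GU_det_nonzero[OF XY(1)] GU_det_nonzero[OF XY(2)]
        det_conj_trans_nonzero[OF Y] by (simp add: det_mult[of _ n])
    ultimately show "T \<in> ?cls" using T by (simp add: carrier_GL_UNIV)
  next
    fix T assume "T \<in> ?cls"
    hence T: "T \<in> carrier_mat n n" "det T \<noteq> 0" and sim: "similar_mat (gram T) (gram A)"
      by (auto simp: carrier_GL_UNIV)
    note gT = gram_props(1,2)[OF T(1)]
    obtain g where g: "g \<in> carrier_mat n n" "det g \<noteq> 0" "gram T * g = g * gram A"
      using sim unfolding similar_mat_iff_intertwiner[OF gT(1) gA(1)] by blast
    obtain Y where Y: "Y \<in> carrier_mat n n" "Y * conj_trans q Y = 1\<^sub>m n" "gram T * Y = Y * gram A"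
      using hermitian_similar_imp_unitary[OF gA gT g] .
    have YU: "Y \<in> carrier (GU n q)" using Y by (simp add: carrier_GU)
    obtain C where C: "C \<in> carrier_mat n n" "A * C = 1\<^sub>m n" "C * A = 1\<^sub>m n"
      using mat_det_nonzero_inverse[OF A] .
    have Yc: "conj_trans q Y \<in> carrier_mat n n" and Tc: "conj_trans q T \<in> carrier_mat n n"
      and Ac: "conj_trans q A \<in> carrier_mat n n" and Cc: "conj_trans q C \<in> carrier_mat n n"
      using T Y A C by simp_all
    define X where "X = T * Y * C"
    have TY: "T * Y \<in> carrier_mat n n" using T Y by simp
    have X: "X \<in> carrier_mat n n" using TY C by (simp add: X_def)
    have "conj_trans q X = conj_trans q C * (conj_trans q Y * conj_trans q T)"
      unfolding X_def conj_trans_mult[OF TY C(1)] conj_trans_mult[OF T(1) Y(1)] ..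
    hence "conj_trans q X * X = conj_trans q C * (conj_trans q Y * (gram T * Y)) * C"
      unfolding X_def gram_def using T Y Yc Tc C(1) Cc by (simp add: mat_assoc[of _ n])
    also have "\<dots> = conj_trans q C * ((conj_trans q Y * Y) * (conj_trans q A * A)) * C"
      unfolding Y(3) unfolding gram_def using Y(1) Yc A Ac C(1) Cc by (simp add: mat_assoc[of _ n])
    also have "\<dots> = conj_trans q C * conj_trans q A * (A * C)"
      unfolding GU_left_inverse[OF YU] using A Ac C(1) Cc by (simp add: mat_assoc[of _ n])
    also have "\<dots> = conj_trans q (A * C)"
      unfolding conj_trans_mult[OF A(1) C(1)] unfolding C(2) using Ac Cc by simp
    finally have "conj_trans q X * X = 1\<^sub>m n" unfolding C(2) by simp
    hence "X * conj_trans q X = 1\<^sub>m n" by (rule mat_mult_left_right_inverse[rotated 2]) (use X in simp_all)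
    hence XU: "X \<in> carrier (GU n q)" using X by (simp add: carrier_GU)
    have "X * A * conj_trans q Y = T * Y * (C * A) * conj_trans q Y"
      unfolding X_def using TY A C(1) Yc by (simp add: mat_assoc[of _ n])
    also have "\<dots> = T * (Y * conj_trans q Y)" unfolding C(3) using T Y(1) Yc by (simp add: mat_assoc[of _ n])
    finally have "T = X * A * conj_trans q Y" unfolding Y(2) using T by simp
    thus "T \<in> ?orb" unfolding orb using XU YU by blast
  qed
qed

lemma GUGU_orbits_eq:
  "(GUGU_orbits n q :: 'a mat set set) =
    (\<lambda>A. {T \<in> carrier (GL n UNIV). similar_mat (gram T) (gram A)}) ` carrier (GL n UNIV)"
proof -
  let ?\<phi> = "\<lambda>(X, Y). \<lambda>A\<in>carrier (GL n UNIV). X * A * conj_trans q Y"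
  have "(GUGU_orbits n q :: 'a mat set set) =
      orbit (GU n q \<times>\<times> GU n q) ?\<phi> ` carrier (GL n UNIV)"
    unfolding GUGU_orbits_def orbits_def by blast
  also have "\<dots> = (\<lambda>A. {T \<in> carrier (GL n UNIV). similar_mat (gram T) (gram A)}) ` carrier (GL n UNIV)"
    by (rule image_cong[OF refl]) (rule GUGU_orbit_eq, auto simp: carrier_GL_UNIV)
  finally show ?thesis .
qed

text \<open>
  Similar Hermitian matrices are unitarily conjugate, so a unitary orbit is a full similarity class
  among the invertible Hermitian matrices.
\<close>

lemma hermitian_orbits_eq:
  "(hermitian_orbits n q :: 'a mat set set) =
    (\<lambda>H. {H' \<in> invertible_hermitian n q. similar_mat H' H}) ` invertible_hermitian n q"
proof -
  let ?I = "invertible_hermitian n q :: 'a mat set"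
  let ?\<phi> = "\<lambda>Y. \<lambda>H\<in>?I. Y * H * conj_trans q Y"
  have I: "H \<in> ?I \<longleftrightarrow> H \<in> carrier_mat n n \<and> det H \<noteq> 0 \<and> conj_trans q H = H" for H
    by (auto simp: invertible_hermitian_def carrier_GL_UNIV)
  have "orbit (GU n q) ?\<phi> H = {H' \<in> ?I. similar_mat H' H}" if "H \<in> ?I" for H
  proof -
    have H: "H \<in> carrier_mat n n" "det H \<noteq> 0" "conj_trans q H = H" using that by (simp_all add: I)
    have orb: "orbit (GU n q) ?\<phi> H = {Y * H * conj_trans q Y | Y. Y \<in> carrier (GU n q)}"
      unfolding orbit_def using that by simp
    show ?thesis unfolding orb
    proof (intro equalityI subsetI)
      fix M assume "M \<in> {Y * H * conj_trans q Y | Y. Y \<in> carrier (GU n q)}"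
      then obtain Y where YU: "Y \<in> carrier (GU n q)" and M: "M = Y * H * conj_trans q Y" by blast
      have Y: "Y \<in> carrier_mat n n" using YU by (simp add: carrier_GU)
      hence Yc: "conj_trans q Y \<in> carrier_mat n n" by simp
      have YH: "Y * H \<in> carrier_mat n n" using Y H by simp
      have Mc: "M \<in> carrier_mat n n" unfolding M using YH Yc by simp
      have "conj_trans q M = M"
        unfolding M conj_trans_mult[OF YH Yc] conj_trans_mult[OF Y H(1)] H(3)
        using Y Yc H(1) by (simp add: mat_assoc[of _ n])
      moreover have "det M \<noteq> 0"
        unfolding M using Y Yc H YH GU_det_nonzero[OF YU] det_conj_trans_nonzero[OF Y]
        by (simp add: det_mult[of _ n])
      moreover have "M * Y = Y * H"
      proof -
        have "M * Y = Y * H * (conj_trans q Y * Y)" unfolding M using Y Yc H(1) by (simp add: mat_assoc[of _ n])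
        thus ?thesis unfolding GU_left_inverse[OF YU] right_mult_one_mat[OF YH] .
      qed
      ultimately show "M \<in> {H' \<in> ?I. similar_mat H' H}"
        using Mc similar_mat_iff_intertwiner[OF Mc H(1)] Y GU_det_nonzero[OF YU] by (auto simp: I)
    next
      fix M assume "M \<in> {H' \<in> ?I. similar_mat H' H}"
      hence M: "M \<in> carrier_mat n n" "conj_trans q M = M" and sim: "similar_mat M H" by (auto simp: I)
      obtain g where g: "g \<in> carrier_mat n n" "det g \<noteq> 0" "M * g = g * H"
        using sim unfolding similar_mat_iff_intertwiner[OF M(1) H(1)] by blast
      obtain Y where Y: "Y \<in> carrier_mat n n" "Y * conj_trans q Y = 1\<^sub>m n" "M * Y = Y * H"
        using hermitian_similar_imp_unitary[OF H(1,3) M g] .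
      have Yc: "conj_trans q Y \<in> carrier_mat n n" using Y by simp
      have "Y * H * conj_trans q Y = M * (Y * conj_trans q Y)"
        unfolding Y(3)[symmetric] using M(1) Y(1) Yc by (simp add: mat_assoc[of _ n])
      hence "M = Y * H * conj_trans q Y" unfolding Y(2) using M(1) by simp
      thus "M \<in> {Y * H * conj_trans q Y | Y. Y \<in> carrier (GU n q)}"
        using Y by (auto simp: carrier_GU)
    qed
  qed
  thus ?thesis unfolding hermitian_orbits_def orbits_def by (auto simp: image_def)
qed

text \<open>
  By descent, similarity over the large field already determines the conjugacy classes over the
  subfield.
\<close>

lemma conj_classes_GL_Fq_eq:
  "conj_classes (GL n (Fq q :: 'a set)) =
    (\<lambda>B. {B' \<in> carrier (GL n (Fq q)). similar_mat B' B}) ` carrier (GL n (Fq q))"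
proof -
  let ?G = "GL n (Fq q :: 'a set)"
  let ?conj = "\<lambda>g h. g \<otimes>\<^bsub>?G\<^esub> h \<otimes>\<^bsub>?G\<^esub> inv\<^bsub>?G\<^esub> g"
  interpret group ?G by (rule group_GL_Fq)
  have "orbit ?G (\<lambda>g. \<lambda>h\<in>carrier ?G. ?conj g h) B = {B' \<in> carrier ?G. similar_mat B' B}"
    if B: "B \<in> carrier ?G" for B
  proof -
    have c: "M \<in> carrier_mat n n" "bar M = M" "det M \<noteq> 0" if "M \<in> carrier ?G" for M
      using that by (simp_all add: carrier_GL_Fq)
    have orb: "orbit ?G (\<lambda>g. \<lambda>h\<in>carrier ?G. ?conj g h) B =
        {B' \<in> carrier ?G. \<exists>g\<in>carrier ?G. B' = ?conj g B}"
      unfolding orbit_def using B by (auto intro!: m_closed simp del: GL_simps)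
    have "(\<exists>g\<in>carrier ?G. B' = ?conj g B) \<longleftrightarrow> similar_mat B' B" if B': "B' \<in> carrier ?G" for B'
    proof -
      have "(\<exists>g\<in>carrier ?G. B' = ?conj g B) \<longleftrightarrow> (\<exists>g\<in>carrier ?G. B' * g = g * B)"
        using GL_conjugation_iff[OF group_GL_Fq c(1)[OF B] c(1)[OF B']] by blast
      also have "\<dots> \<longleftrightarrow> similar_mat B' B"
      proof
        assume "\<exists>g\<in>carrier ?G. B' * g = g * B"
        thus "similar_mat B' B"
          unfolding similar_mat_iff_intertwiner[OF c(1)[OF B'] c(1)[OF B]] using c by blast
      next
        assume "similar_mat B' B"
        then obtain g where g: "g \<in> carrier_mat n n" "det g \<noteq> 0" "B' * g = g * B"
          unfolding similar_mat_iff_intertwiner[OF c(1)[OF B'] c(1)[OF B]] by blast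
        obtain P where "P \<in> carrier_mat n n" "det P \<noteq> 0" "bar P = P" "B' * P = P * B"
          using real_similar_descent[OF c(1,2)[OF B] c(1,2)[OF B'] g] .
        thus "\<exists>g\<in>carrier ?G. B' * g = g * B" by (auto simp: carrier_GL_Fq)
      qed
      finally show ?thesis .
    qed
    thus ?thesis unfolding orb by blast
  qed
  thus ?thesis unfolding conj_classes_def orbits_def by (auto simp: image_def)
qed

lemma gram_similar_to_Fq:
  assumes T: "T \<in> carrier (GL n (UNIV :: 'a set))"
  shows "\<exists>B\<in>carrier (GL n (Fq q)). similar_mat (gram T) B"
proof -
  have T: "T \<in> carrier_mat n n" "det T \<noteq> 0" using assms by (simp_all add: carrier_GL_UNIV)
  note gT = gram_props[OF T(1)]
  obtain X B where X: "X \<in> carrier_mat n n" "det X \<noteq> 0" and B: "B \<in> carrier_mat n n" "bar B = B"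
    and eq: "gram T * X = X * B"
    using hermitian_similar_to_real[OF gT(1,2)] .
  have "det X * det B = det (gram T) * det X"
    by (simp only: det_mult[OF X(1) B(1), symmetric] det_mult[OF gT(1) X(1), symmetric] eq)
  hence "det B \<noteq> 0" using X(2) gT(3)[OF T(2)] by auto
  hence "B \<in> carrier (GL n (Fq q))" using B by (simp add: carrier_GL_Fq)
  thus ?thesis using similar_mat_iff_intertwiner[OF gT(1) B(1)] X eq by blast
qed

lemma Fq_similar_to_gram:
  assumes B: "B \<in> carrier (GL n (Fq q :: 'a set))"
  shows "\<exists>T\<in>carrier (GL n UNIV). similar_mat (gram T) B"
proof -
  have B: "B \<in> carrier_mat n n" "bar B = B" "det B \<noteq> 0" using assms by (simp_all add: carrier_GL_Fq)
  obtain T X where T: "T \<in> carrier_mat n n" "det T \<noteq> 0" and X: "X \<in> carrier_mat n n" "det X \<noteq> 0"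
    and eq: "B * X = X * gram T"
    using real_similar_to_hermitian[OF B] unfolding gram_def .
  have "similar_mat B (gram T)"
    using similar_mat_iff_intertwiner[OF B(1) gram_props(1)[OF T(1)]] X eq by blast
  thus ?thesis using T similar_mat_sym by (auto simp: carrier_GL_UNIV)
qed

lemma hermitian_eq_gram:
  assumes H: "H \<in> (invertible_hermitian n q :: 'a mat set)"
  shows "\<exists>T\<in>carrier (GL n UNIV). gram T = H"
proof -
  have H: "H \<in> carrier_mat n n" "det H \<noteq> 0" "conj_trans q H = H"
    using assms by (auto simp: invertible_hermitian_def carrier_GL_UNIV)
  from hermitian_factorization[OF H] obtain f where
    "det (poly_mat f H) \<noteq> 0" "conj_trans q (poly_mat f H) * poly_mat f H = H" by blast
  thus ?thesis using H by (intro bexI[of _ "poly_mat f H"]) (auto simp: gram_def carrier_GL_UNIV)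
qed

lemma gram_hermitian:
  "T \<in> carrier (GL n UNIV) \<Longrightarrow> gram T \<in> invertible_hermitian n q"
  using gram_props[of T n] by (auto simp: invertible_hermitian_def carrier_GL_UNIV)

lemma bij_betw_GUGU_orbits_conj_classes:
  "bij_betw
     (\<lambda>\<Omega>. {B \<in> carrier (GL n (Fq q)). \<exists>T\<in>\<Omega>. conjugate_in (GL n UNIV) (conj_trans q T * T) B})
     (GUGU_orbits n q :: 'a mat set set) (conj_classes (GL n (Fq q)))"
proof -
  have "bij_betw (\<lambda>\<Omega>. {B \<in> carrier (GL n (Fq q)). \<exists>T\<in>\<Omega>. similar_mat (gram T) B})
     (GUGU_orbits n q :: 'a mat set set) (conj_classes (GL n (Fq q)))"
    unfolding GUGU_orbits_eq conj_classes_GL_Fq_eq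
    by (rule bij_betw_similarity_classes[where R = similar_mat])
      (fact similar_mat_sym similar_mat_trans gram_similar_to_Fq Fq_similar_to_gram)+
  moreover have "{B \<in> carrier (GL n (Fq q)). \<exists>T\<in>\<Omega>. similar_mat (gram T) B} =
      {B \<in> carrier (GL n (Fq q)). \<exists>T\<in>\<Omega>. conjugate_in (GL n UNIV) (conj_trans q T * T) B}"
    if "\<Omega> \<in> (GUGU_orbits n q :: 'a mat set set)" for \<Omega>
  proof -
    have "gram T \<in> carrier (GL n UNIV)" if "T \<in> \<Omega>" for T
      using that \<open>\<Omega> \<in> _\<close> gram_props[of T n] by (auto simp: GUGU_orbits_eq carrier_GL_UNIV)
    moreover have "B \<in> carrier (GL n UNIV)" if "B \<in> carrier (GL n (Fq q :: 'a set))" for B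
      using that by (simp add: carrier_GL_Fq carrier_GL_UNIV)
    ultimately show ?thesis unfolding conjugate_in_GL_UNIV gram_def[symmetric] by blast
  qed
  ultimately show ?thesis by (subst bij_betw_cong[symmetric]) auto
qed

text \<open>
  Since every invertible Hermitian matrix is a Gram matrix, the Hermitian matrices similar to a Gram
  matrix of an orbit are exactly the Gram matrices of that orbit.
\<close>

lemma bij_betw_GUGU_orbits_hermitian_orbits:
  "bij_betw (\<lambda>\<Omega>. (\<lambda>T. conj_trans q T * T) ` \<Omega>)
     (GUGU_orbits n q :: 'a mat set set) (hermitian_orbits n q)"
proof -
  let ?I = "invertible_hermitian n q :: 'a mat set"
  have refl: "similar_mat H H" if "H \<in> ?I" for H
    using that by (intro similar_mat_refl[of _ n]) (simp add: invertible_hermitian_def carrier_GL_UNIV)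
  have "bij_betw (\<lambda>\<Omega>. {H \<in> ?I. \<exists>T\<in>\<Omega>. similar_mat (gram T) H})
     (GUGU_orbits n q :: 'a mat set set) (hermitian_orbits n q)"
    unfolding GUGU_orbits_eq hermitian_orbits_eq
  proof (rule bij_betw_similarity_classes[where R = similar_mat])
    show "\<exists>H\<in>?I. similar_mat (gram T) H" if "T \<in> carrier (GL n UNIV)" for T
      using gram_hermitian[OF that] refl by blast
    show "\<exists>T\<in>carrier (GL n UNIV). similar_mat (gram T) H" if "H \<in> ?I" for H
      using hermitian_eq_gram[OF that] refl[OF that] by blast
  qed (fact similar_mat_sym similar_mat_trans)+
  moreover have "{H \<in> ?I. \<exists>T\<in>\<Omega>. similar_mat (gram T) H} = (\<lambda>T. conj_trans q T * T) ` \<Omega>"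
    if orbit: "\<Omega> \<in> (GUGU_orbits n q :: 'a mat set set)" for \<Omega>
  proof -
    obtain A where \<Omega>: "\<Omega> = {T \<in> carrier (GL n UNIV). similar_mat (gram T) (gram A)}"
      using orbit unfolding GUGU_orbits_eq by blast
    have "{H \<in> ?I. \<exists>T\<in>\<Omega>. similar_mat (gram T) H} = gram ` \<Omega>"
    proof (intro equalityI subsetI)
      fix H assume "H \<in> {H \<in> ?I. \<exists>T\<in>\<Omega>. similar_mat (gram T) H}"
      then obtain T where H: "H \<in> ?I" and T: "T \<in> \<Omega>" "similar_mat (gram T) H" by blast
      obtain T' where T': "T' \<in> carrier (GL n UNIV)" "gram T' = H" using hermitian_eq_gram[OF H] by blast
      have "similar_mat (gram T') (gram A)"
        using T T'(2) similar_mat_sym similar_mat_trans unfolding \<Omega> by blast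
      thus "H \<in> gram ` \<Omega>" using T' unfolding \<Omega> by blast
    next
      fix H assume "H \<in> gram ` \<Omega>"
      thus "H \<in> {H \<in> ?I. \<exists>T\<in>\<Omega>. similar_mat (gram T) H}"
        using gram_hermitian refl unfolding \<Omega> by blast
    qed
    thus ?thesis unfolding gram_def .
  qed
  ultimately show ?thesis by (subst bij_betw_cong[symmetric]) auto
qed

end

section \<open>Linear maps on a Hermitian space\<close>

locale unitary_space =
  hermitian_space scale V q h + quadratic_extension q "TYPE('a)"
  for scale :: "'a::finite_field \<Rightarrow> 'v::ab_group_add \<Rightarrow> 'v" and V q h +
  fixes n :: nat and e :: "nat \<Rightarrow> 'v"
  assumes onb: "orthonormal_basis scale V h n e"
begin

lemma e_in_V: "i < n \<Longrightarrow> e i \<in> V"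
  using onb span_base[of "e i" "e ` {..<n}"] by (auto simp: orthonormal_basis_def)

lemma form_e: "i < n \<Longrightarrow> j < n \<Longrightarrow> h (e i) (e j) = (if i = j then 1 else 0)"
  using onb by (simp add: orthonormal_basis_def)

lemma form_sum_left:
  assumes "finite I" "\<And>i. i \<in> I \<Longrightarrow> x i \<in> V" "y \<in> V"
  shows "h (\<Sum>i\<in>I. scale (c i) (x i)) y = (\<Sum>i\<in>I. c i * h (x i) y)"
  using assms(1,2)
proof (induction I rule: finite_induct)
  case empty
  have "h (scale 0 0) y = 0 * h 0 y" by (rule form_scale[OF subspace_0[OF subspace_V] assms(3)])
  thus ?case by simp
next
  case (insert i I)
  have "(\<Sum>i\<in>I. scale (c i) (x i)) \<in> V"
    using insert.prems by (intro subspace_sum[OF subspace_V] subspace_scale[OF subspace_V]) auto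
  moreover have "scale (c i) (x i) \<in> V"
    using insert.prems by (intro subspace_scale[OF subspace_V]) auto
  ultimately show ?case
    using insert assms(3) by (simp add: form_add form_scale)
qed

lemma linear_sum:
  assumes T: "linear_map_on scale V T" and "finite I" "\<And>i. i \<in> I \<Longrightarrow> x i \<in> V"
  shows "T (\<Sum>i\<in>I. scale (c i) (x i)) = (\<Sum>i\<in>I. scale (c i) (T (x i)))"
  using assms(2,3)
proof (induction I rule: finite_induct)
  case empty
  have "T (scale 0 0) = scale 0 (T 0)" using T subspace_0[OF subspace_V] unfolding linear_map_on_def by blast
  thus ?case by simp
next
  case (insert i I)
  have "(\<Sum>i\<in>I. scale (c i) (x i)) \<in> V" "scale (c i) (x i) \<in> V"
    using insert.prems by (auto intro!: subspace_sum[OF subspace_V] subspace_scale[OF subspace_V])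
  thus ?case using insert T unfolding linear_map_on_def by simp
qed

lemma representation_eq_form:
  assumes v: "v \<in> V" and i: "i < n"
  shows "representation (e ` {..<n}) v (e i) = h v (e i)"
proof -
  let ?r = "representation (e ` {..<n}) v"
  have ind: "independent (e ` {..<n})" and sp: "v \<in> span (e ` {..<n})" and inj: "inj_on e {..<n}"
    using onb v by (auto simp: orthonormal_basis_def)
  have "v = (\<Sum>b\<in>e ` {..<n}. scale (?r b) b)"
    using sum_representation_eq[OF ind sp] by simp
  also have "\<dots> = (\<Sum>j<n. scale (?r (e j)) (e j))" using inj by (simp add: sum.reindex)
  finally have "h v (e i) = h (\<Sum>j<n. scale (?r (e j)) (e j)) (e i)" by simp
  also have "\<dots> = (\<Sum>j<n. ?r (e j) * h (e j) (e i))"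
    using e_in_V i by (intro form_sum_left) auto
  also have "\<dots> = (\<Sum>j<n. if j = i then ?r (e j) else 0)"
    using i by (intro sum.cong) (auto simp: form_e)
  also have "\<dots> = ?r (e i)" using i by simp
  finally show ?thesis ..
qed

lemma orthonormal_expansion:
  assumes v: "v \<in> V"
  shows "v = (\<Sum>i<n. scale (h v (e i)) (e i))"
proof -
  have ind: "independent (e ` {..<n})" and sp: "v \<in> span (e ` {..<n})" and inj: "inj_on e {..<n}"
    using onb v by (auto simp: orthonormal_basis_def)
  have "v = (\<Sum>b\<in>e ` {..<n}. scale (representation (e ` {..<n}) v b) b)"
    using sum_representation_eq[OF ind sp] by simp
  also have "\<dots> = (\<Sum>i<n. scale (representation (e ` {..<n}) v (e i)) (e i))"
    using inj by (simp add: sum.reindex)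
  also have "\<dots> = (\<Sum>i<n. scale (h v (e i)) (e i))"
    using v by (intro sum.cong) (auto simp: representation_eq_form)
  finally show ?thesis .
qed

lemma lincomb_in_V: "(\<Sum>i<n. scale (c i) (e i)) \<in> V"
  using e_in_V by (intro subspace_sum[OF subspace_V] subspace_scale[OF subspace_V]) auto

lemma form_lincomb: "i < n \<Longrightarrow> h (\<Sum>j<n. scale (c j) (e j)) (e i) = c i"
  using e_in_V by (subst form_sum_left) (auto simp: form_e if_distrib sum.delta cong: if_cong)

lemma form_coordinates:
  assumes "v \<in> V" "w \<in> V"
  shows "h v w = (\<Sum>i<n. h v (e i) * frob (h w (e i)))"
proof -
  have "h v w = h (\<Sum>i<n. scale (h v (e i)) (e i)) w"
    using orthonormal_expansion[OF assms(1)] by simp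
  also have "\<dots> = (\<Sum>i<n. h v (e i) * h (e i) w)"
    using e_in_V assms by (intro form_sum_left) auto
  also have "\<dots> = (\<Sum>i<n. h v (e i) * frob (h w (e i)))"
    using e_in_V assms by (intro sum.cong) (auto simp: form_conj[of w])
  finally show ?thesis .
qed

text \<open>
  The vector with coordinates conjugate to \<open>h (T (e i)) y\<close> represents the form \<open>x \<mapsto> h (T x) y\<close>, and
  coordinates in an orthonormal basis are values of the form, which gives uniqueness.
\<close>

lemma adjoint_on_works:
  assumes T: "linear_map_on scale V T" and y: "y \<in> V"
  shows "adjoint_on V h T y \<in> V" and "\<And>x. x \<in> V \<Longrightarrow> h (T x) y = h x (adjoint_on V h T y)"
proof -
  have TV: "T x \<in> V" if "x \<in> V" for x using T that by (auto simp: linear_map_on_def)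
  let ?P = "\<lambda>z. z \<in> V \<and> (\<forall>x\<in>V. h (T x) y = h x z)"
  define z where "z = (\<Sum>i<n. scale (frob (h (T (e i)) y)) (e i))"
  have z: "z \<in> V" unfolding z_def by (rule lincomb_in_V)
  have "h (T x) y = h x z" if x: "x \<in> V" for x
  proof -
    have "T x = T (\<Sum>i<n. scale (h x (e i)) (e i))" using orthonormal_expansion[OF x] by simp
    also have "\<dots> = (\<Sum>i<n. scale (h x (e i)) (T (e i)))"
      using e_in_V by (intro linear_sum[OF T]) auto
    finally have "h (T x) y = h (\<Sum>i<n. scale (h x (e i)) (T (e i))) y" by simp
    also have "\<dots> = (\<Sum>i<n. h x (e i) * h (T (e i)) y)"
      using e_in_V TV y by (intro form_sum_left) auto
    also have "\<dots> = (\<Sum>i<n. h x (e i) * frob (h z (e i)))"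
      unfolding z_def by (intro sum.cong) (auto simp: form_lincomb)
    also have "\<dots> = h x z" by (rule form_coordinates[OF x z, symmetric])
    finally show ?thesis .
  qed
  hence Pz: "?P z" using z by blast
  have "z' = z" if "?P z'" for z'
  proof -
    have "h z' (e i) = h z (e i)" if "i < n" for i
    proof -
      have "h (e i) z' = h (e i) z" using \<open>?P z'\<close> Pz e_in_V[OF that] by metis
      thus ?thesis using form_conj[of "e i"] e_in_V[OF that] z \<open>?P z'\<close> by simp
    qed
    thus ?thesis
      using orthonormal_expansion[of z'] orthonormal_expansion[OF z] \<open>?P z'\<close> by simp
  qed
  with Pz have "?P (THE z. ?P z)" by (rule theI)
  moreover have "adjoint_on V h T y = (THE z. ?P z)" using y by (simp add: adjoint_on_def)
  ultimately have "?P (adjoint_on V h T y)" by (rule ssubst[rotated])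
  thus "adjoint_on V h T y \<in> V" "\<And>x. x \<in> V \<Longrightarrow> h (T x) y = h x (adjoint_on V h T y)"
    by blast+
qed

abbreviation mat_of where "mat_of \<equiv> mat_of_map scale n e"

lemma mat_of_carrier [simp]: "mat_of T \<in> carrier_mat n n"
  by (simp add: mat_of_map_def)

lemma mat_of_index:
  "T (e j) \<in> V \<Longrightarrow> i < n \<Longrightarrow> j < n \<Longrightarrow> mat_of T $$ (i, j) = h (T (e j)) (e i)"
  by (simp add: mat_of_map_def representation_eq_form)

lemma mat_of_adjoint:
  assumes T: "linear_map_on scale V T"
  shows "mat_of (adjoint_on V h T) = conj_trans q (mat_of T)"
proof (rule eq_matI)
  fix i j assume "i < dim_row (conj_trans q (mat_of T))" "j < dim_col (conj_trans q (mat_of T))"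
  hence ij: "i < n" "j < n" by (simp_all add: conj_trans_eq mat_of_map_def)
  have TV: "T x \<in> V" if "x \<in> V" for x using T that by (auto simp: linear_map_on_def)
  note adj = adjoint_on_works[OF T e_in_V[OF ij(2)]]
  have "mat_of (adjoint_on V h T) $$ (i, j) = h (adjoint_on V h T (e j)) (e i)"
    using adj(1) ij by (rule mat_of_index)
  also have "\<dots> = frob (h (e i) (adjoint_on V h T (e j)))"
    by (rule form_conj[OF e_in_V[OF ij(1)] adj(1)])
  also have "\<dots> = frob (h (T (e i)) (e j))" unfolding adj(2)[OF e_in_V[OF ij(1)]] ..
  also have "\<dots> = frob (mat_of T $$ (j, i))" using ij TV e_in_V by (simp add: mat_of_index)
  finally show "mat_of (adjoint_on V h T) $$ (i, j) = conj_trans q (mat_of T) $$ (i, j)"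
    using ij carrier_matD[OF mat_of_carrier[of T]] by (simp add: conj_trans_eq)
qed (simp_all add: conj_trans_eq mat_of_map_def)

lemma mat_of_adjoint_comp:
  assumes T: "linear_map_on scale V T"
  shows "mat_of (adjoint_on V h T \<circ> T) = gram (mat_of T)"
proof (rule eq_matI)
  fix i j assume "i < dim_row (gram (mat_of T))" "j < dim_col (gram (mat_of T))"
  hence ij: "i < n" "j < n" by (simp_all add: gram_def conj_trans_eq mat_of_map_def)
  have TV: "T (e k) \<in> V" if "k < n" for k using T e_in_V[OF that] by (auto simp: linear_map_on_def)
  note adj = adjoint_on_works[OF T TV[OF ij(2)]]
  have "mat_of (adjoint_on V h T \<circ> T) $$ (i, j) = h (adjoint_on V h T (T (e j))) (e i)"
    using adj(1) ij by (simp add: mat_of_index)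
  also have "\<dots> = frob (h (e i) (adjoint_on V h T (T (e j))))"
    by (rule form_conj[OF e_in_V[OF ij(1)] adj(1)])
  also have "\<dots> = frob (h (T (e i)) (T (e j)))" unfolding adj(2)[OF e_in_V[OF ij(1)]] ..
  also have "\<dots> = h (T (e j)) (T (e i))" by (rule form_conj[OF TV TV, symmetric]) (use ij in auto)
  also have "\<dots> = (\<Sum>k<n. h (T (e j)) (e k) * frob (h (T (e i)) (e k)))"
    using ij TV by (intro form_coordinates) auto
  also have "\<dots> = (\<Sum>k<n. conj_trans q (mat_of T) $$ (i, k) * mat_of T $$ (k, j))"
    using ij TV carrier_matD[OF mat_of_carrier[of T]]
    by (intro sum.cong) (auto simp: conj_trans_eq mat_of_index mult.commute)
  also have "\<dots> = gram (mat_of T) $$ (i, j)"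
    using ij carrier_matD[OF mat_of_carrier[of T]]
    by (simp add: gram_def conj_trans_eq scalar_prod_def atLeast0LessThan)
  finally show "mat_of (adjoint_on V h T \<circ> T) $$ (i, j) = gram (mat_of T) $$ (i, j)" .
qed (simp_all add: gram_def conj_trans_eq mat_of_map_def)

lemma det_mat_of_nonzero:
  assumes T: "linear_map_on scale V T" and bij: "bij_betw T V V"
  shows "det (mat_of T) \<noteq> 0"
proof
  have TV: "T x \<in> V" if "x \<in> V" for x using T that by (auto simp: linear_map_on_def)
  assume "det (mat_of T) = 0"
  then obtain v where v: "v \<in> carrier_vec n" "v \<noteq> 0\<^sub>v n" "mat_of T *\<^sub>v v = 0\<^sub>v n"
    using det_0_iff_vec_prod_zero_field[OF mat_of_carrier] by blast
  define x where "x = (\<Sum>j<n. scale (v $ j) (e j))"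
  have x: "x \<in> V" unfolding x_def by (rule lincomb_in_V)
  have Tx: "T x = (\<Sum>j<n. scale (v $ j) (T (e j)))"
    unfolding x_def using e_in_V by (intro linear_sum[OF T]) auto
  have "h (T x) (e i) = 0" if i: "i < n" for i
  proof -
    have "h (T x) (e i) = (\<Sum>j<n. v $ j * h (T (e j)) (e i))"
      unfolding Tx using e_in_V TV i by (intro form_sum_left) auto
    also have "\<dots> = (mat_of T *\<^sub>v v) $ i"
      using i v(1) e_in_V TV carrier_matD[OF mat_of_carrier[of T]]
      by (auto simp: scalar_prod_def atLeast0LessThan mat_of_index mult.commute intro!: sum.cong)
    finally show ?thesis using v(3) i by simp
  qed
  hence "T x = 0" using orthonormal_expansion[OF TV[OF x]] by simp
  moreover have "T 0 = 0" using linear_sum[OF T, of "{}"] by simp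
  ultimately have "x = 0"
    using bij x subspace_0[OF subspace_V] by (metis bij_betw_def inj_onD)
  moreover have "h 0 (e i) = 0" if "i < n" for i
    using form_sum_left[of "{}"] e_in_V[OF that] by simp
  ultimately have "v $ i = 0" if "i < n" for i
    using form_lincomb[OF that, of "\<lambda>j. v $ j"] that unfolding x_def by simp
  hence "v = 0\<^sub>v n" using v(1) by (intro eq_vecI) auto
  thus False using v(2) by simp
qed

end

theorem theorem1p2:
  fixes scale :: "'a::finite_field \<Rightarrow> 'v::ab_group_add \<Rightarrow> 'v"
    and V :: "'v set" and h :: "'v \<Rightarrow> 'v \<Rightarrow> 'a" and e :: "nat \<Rightarrow> 'v"
    and n q :: nat
  assumes "primepow q"
    and "card (UNIV :: 'a set) = q\<^sup>2"
    and "hermitian_space scale V q h"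
    and "orthonormal_basis scale V h n e"
  shows
    "(\<forall>T. linear_map_on scale V T \<longrightarrow>
        mat_of_map scale n e (adjoint_on V h T) = conj_trans q (mat_of_map scale n e T)) \<and>
     (\<forall>T. linear_map_on scale V T \<and> bij_betw T V V \<longrightarrow>
        (\<exists>B\<in>carrier (GL n (Fq q)).
           conjugate_in (GL n UNIV) (mat_of_map scale n e (adjoint_on V h T \<circ> T)) B)) \<and>
     (\<forall>B\<in>carrier (GL n (Fq q :: 'a set)). \<exists>T\<in>carrier (GL n UNIV).
        conjugate_in (GL n UNIV) B (conj_trans q T * T)) \<and>
     bij_betw
       (\<lambda>\<Omega>. {B \<in> carrier (GL n (Fq q)). \<exists>T\<in>\<Omega>. conjugate_in (GL n UNIV) (conj_trans q T * T) B})
       (GUGU_orbits n q :: 'a mat set set) (conj_classes (GL n (Fq q))) \<and>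
     bij_betw (\<lambda>\<Omega>. (\<lambda>T. conj_trans q T * T) ` \<Omega>)
       (GUGU_orbits n q :: 'a mat set set) (hermitian_orbits n q) \<and>
     card (GUGU_orbits n q :: 'a mat set set) = class_number (GL n (Fq q :: 'a set))"
proof -
  interpret hermitian_space scale V q h by (fact assms(3))
  interpret unitary_space scale V q h n e
    by unfold_locales (fact assms)+
  have Fq_UNIV: "B \<in> carrier (GL n UNIV)" if "B \<in> carrier (GL n (Fq q :: 'a set))" for B
    using that by (simp add: carrier_GL_Fq carrier_GL_UNIV)
  have gram_GL: "gram T \<in> carrier (GL n UNIV)" if "T \<in> carrier (GL n UNIV)" for T
    using that gram_props[of T n] by (simp add: carrier_GL_UNIV)
  have 1: "\<exists>B\<in>carrier (GL n (Fq q)). conjugate_in (GL n UNIV) (mat_of (adjoint_on V h T \<circ> T)) B"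
    if T: "linear_map_on scale V T" "bij_betw T V V" for T
  proof -
    have "mat_of T \<in> carrier (GL n UNIV)"
      using det_mat_of_nonzero[OF T] by (simp add: carrier_GL_UNIV)
    thus ?thesis
      using gram_similar_to_Fq gram_GL Fq_UNIV
      unfolding mat_of_adjoint_comp[OF T(1)] conjugate_in_GL_UNIV by blast
  qed
  have 2: "\<exists>T\<in>carrier (GL n UNIV). conjugate_in (GL n UNIV) B (conj_trans q T * T)"
    if "B \<in> carrier (GL n (Fq q))" for B :: "'a mat"
    using Fq_similar_to_gram[OF that] Fq_UNIV[OF that] gram_GL similar_mat_sym
    unfolding conjugate_in_GL_UNIV gram_def[symmetric] by blast
  have "card (GUGU_orbits n q :: 'a mat set set) = class_number (GL n (Fq q :: 'a set))"
    unfolding class_number_def by (rule bij_betw_same_card[OF bij_betw_GUGU_orbits_conj_classes])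
  thus ?thesis
    using mat_of_adjoint 1 2 bij_betw_GUGU_orbits_conj_classes bij_betw_GUGU_orbits_hermitian_orbits
    by blast
qed

end
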